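(* Let $k>1$ be an integer, let $G$ be a finitely generated group and let $\Gamma=\mathrm{Cay}(G,S)$ be its Cayley graph with respect to a finite symmetric generating set $S$. Then the $\mathbb{Z}_k$-homology cover $\widetilde{\Gamma}$ of $\Gamma$ is a Cayley graph of a finitely generated group $\widetilde{G}$, namely the cubization of $G$ with respect to $\Gamma$. If $G$ is infinite, then $\widetilde{G}$ acts with unbounded orbits on a CAT(0) cubical complex.
   Context: $\mathbb{Z}_k=\mathbb{Z}/k\mathbb{Z}$. Cayley graph convention: $S$ is a finite symmetric generating set ($S=S^{-1}$), and every vertex of $\Gamma=\mathrm{Cay}(G,S)$ belongs to two edges corresponding to each pair $\{s,s^{-1}\}$, $s\in S$; in particular generators that are involutions give rise to double edges, and the degree of every vertex is $|S|$. That is, $S$ is regarded as a family of letters $A\sqcup A^{-1}$ (an involution contributes two letters to $|S|$), the vertex set of $\Gamma$ is $G$, and for every $g\in G$ and $a\in A$ there is one edge $(g,a)$ joining $g$ to $ga$. The same convention is used for Cayley graphs of $\widetilde G$. Each $g\in G$ defines an automorphism of $\Gamma$, also denoted $g$, by left multiplication: $h\mapsto gh$ on vertices and $(h,a)\mapsto(gh,a)$ on edges. The $\mathbb{Z}_k$-homology cover $p\colon\widetilde{\Gamma}\to\Gamma$ is the connected covering corresponding to the kernel of the natural map $\pi_1(\Gamma,1)\to H_1(\Gamma;\mathbb{Z}_k)$, where $1$ is the vertex of $\Gamma$ given by the identity of $G$. The cubization $\widetilde{G}$ of $G$ with respect to $\Gamma$ is the group (under composition) of all lifts to $\widetilde{\Gamma}$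 of the automorphisms of $\Gamma$ given by left multiplication by elements of $G$, where a lift of $g$ is an automorphism $\widetilde{g}$ of $\widetilde{\Gamma}$ with $p\circ\widetilde{g}=g\circ p$. Actions on cubical complexes are by cubical automorphisms; the complex may be infinite-dimensional. *)

theory Defs
  imports "HOL-Analysis.Analysis" "HOL-Algebra.Generated_Groups" "HOL-Algebra.Group_Action"
begin

section \<open>Graphs\<close>

text \<open>
  Graphs in the sense of Serre: every (geometric) edge is represented by two oriented edges
  (darts), exchanged by the fixed-point-free involution \<open>opp\<close>.  Multiple edges and loops are
  allowed.  Since a morphism says which way a dart is traversed, automorphisms and coverings of
  graphs are exactly the combinatorial forms of the topological ones, also at loops.
\<close>

record ('v, 'd) sgraph =
  verts :: "'v set"
  darts :: "'d set"
  src :: "'d \<Rightarrow> 'v"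
  opp :: "'d \<Rightarrow> 'd"

definition tgt :: "('v, 'd) sgraph \<Rightarrow> 'd \<Rightarrow> 'v" where
  "tgt \<Gamma> d = src \<Gamma> (opp \<Gamma> d)"

definition wf_sgraph :: "('v, 'd) sgraph \<Rightarrow> bool" where
  "wf_sgraph \<Gamma> \<longleftrightarrow>
     (\<forall>d \<in> darts \<Gamma>. src \<Gamma> d \<in> verts \<Gamma> \<and> opp \<Gamma> d \<in> darts \<Gamma> \<and>
        opp \<Gamma> (opp \<Gamma> d) = d \<and> opp \<Gamma> d \<noteq> d)"

definition graph_morphism ::
  "('v, 'd) sgraph \<Rightarrow> ('w, 'e) sgraph \<Rightarrow> ('v \<Rightarrow> 'w) \<times> ('d \<Rightarrow> 'e) \<Rightarrow> bool" where
  "graph_morphism \<Gamma> \<Delta> f \<longleftrightarrow>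
     fst f ` verts \<Gamma> \<subseteq> verts \<Delta> \<and> snd f ` darts \<Gamma> \<subseteq> darts \<Delta> \<and>
     (\<forall>d \<in> darts \<Gamma>. src \<Delta> (snd f d) = fst f (src \<Gamma> d) \<and> opp \<Delta> (snd f d) = snd f (opp \<Gamma> d))"

definition graph_iso ::
  "('v, 'd) sgraph \<Rightarrow> ('w, 'e) sgraph \<Rightarrow> ('v \<Rightarrow> 'w) \<times> ('d \<Rightarrow> 'e) \<Rightarrow> bool" where
  "graph_iso \<Gamma> \<Delta> f \<longleftrightarrow> graph_morphism \<Gamma> \<Delta> f \<and>
     bij_betw (fst f) (verts \<Gamma>) (verts \<Delta>) \<and> bij_betw (snd f) (darts \<Gamma>) (darts \<Delta>)"

fun walk :: "('v, 'd) sgraph \<Rightarrow> 'v \<Rightarrow> 'd list \<Rightarrow> 'v \<Rightarrow> bool" where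
  "walk \<Gamma> v [] w \<longleftrightarrow> v \<in> verts \<Gamma> \<and> v = w"
| "walk \<Gamma> v (d # ds) w \<longleftrightarrow> d \<in> darts \<Gamma> \<and> src \<Gamma> d = v \<and> walk \<Gamma> (tgt \<Gamma> d) ds w"

definition connected_graph :: "('v, 'd) sgraph \<Rightarrow> bool" where
  "connected_graph \<Gamma> \<longleftrightarrow>
     verts \<Gamma> \<noteq> {} \<and> (\<forall>v \<in> verts \<Gamma>. \<forall>w \<in> verts \<Gamma>. \<exists>\<gamma>. walk \<Gamma> v \<gamma> w)"

definition graph_covering ::
  "('v, 'd) sgraph \<Rightarrow> ('w, 'e) sgraph \<Rightarrow> ('v \<Rightarrow> 'w) \<times> ('d \<Rightarrow> 'e) \<Rightarrow> bool" where
  "graph_covering \<Delta> \<Gamma> p \<longleftrightarrow> wf_sgraph \<Delta> \<and> wf_sgraph \<Gamma> \<and> graph_morphism \<Delta> \<Gamma> p \<and>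
     fst p ` verts \<Delta> = verts \<Gamma> \<and>
     (\<forall>x \<in> verts \<Delta>. bij_betw (snd p) {d \<in> darts \<Delta>. src \<Delta> d = x}
                                       {d \<in> darts \<Gamma>. src \<Gamma> d = fst p x})"


section \<open>Fundamental group, homology and the homology cover\<close>

definition loops :: "('v, 'd) sgraph \<Rightarrow> 'v \<Rightarrow> 'd list set" where
  "loops \<Gamma> v = {\<gamma>. walk \<Gamma> v \<gamma> v}"

definition backtracks :: "('v, 'd) sgraph \<Rightarrow> 'v \<Rightarrow> ('d list \<times> 'd list) set" where
  "backtracks \<Gamma> v = {(xs @ ys, xs @ [d, opp \<Gamma> d] @ ys) | xs ys d.
     xs @ ys \<in> loops \<Gamma> v \<and> xs @ [d, opp \<Gamma> d] @ ys \<in> loops \<Gamma> v}"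

text \<open>Homotopy of closed edge paths at \<open>v\<close>, relative to the base point.\<close>

definition htpy :: "('v, 'd) sgraph \<Rightarrow> 'v \<Rightarrow> ('d list \<times> 'd list) set" where
  "htpy \<Gamma> v = (backtracks \<Gamma> v \<union> (backtracks \<Gamma> v)\<inverse>)\<^sup>* \<inter> loops \<Gamma> v \<times> loops \<Gamma> v"

definition pi1 :: "('v, 'd) sgraph \<Rightarrow> 'v \<Rightarrow> 'd list set monoid" where
  "pi1 \<Gamma> v = \<lparr>
     carrier = loops \<Gamma> v // htpy \<Gamma> v,
     mult = (\<lambda>C D. htpy \<Gamma> v `` {\<gamma> @ \<delta> | \<gamma> \<delta>. \<gamma> \<in> C \<and> \<delta> \<in> D}),
     one = htpy \<Gamma> v `` {[]}\<rparr>"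

definition pi1_map ::
  "('w, 'e) sgraph \<Rightarrow> ('v \<Rightarrow> 'w) \<times> ('d \<Rightarrow> 'e) \<Rightarrow> 'v \<Rightarrow> 'd list set \<Rightarrow> 'e list set" where
  "pi1_map \<Gamma> p x C = htpy \<Gamma> (fst p x) `` (map (snd p) ` C)"

text \<open>
  Cellular homology with coefficients in the integers modulo \<open>k\<close>, represented by the residues
  \<open>0, \<dots>, k - 1\<close>.  A 1-chain is a finitely supported function on the darts that changes sign under
  \<open>opp\<close>; the coefficient at \<open>v\<close> of its boundary is minus the sum of its values on the darts
  issuing from \<open>v\<close>.  A graph has no 2-cells, so the first homology is the group of 1-cycles.
\<close>

definition H1 :: "nat \<Rightarrow> ('v, 'd) sgraph \<Rightarrow> ('d \<Rightarrow> int) monoid" where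
  "H1 k \<Gamma> = \<lparr>
     carrier = {c. (\<forall>d. c d \<in> {0..<int k}) \<and> (\<forall>d. d \<notin> darts \<Gamma> \<longrightarrow> c d = 0) \<and>
       finite {d. c d \<noteq> 0} \<and>
       (\<forall>d \<in> darts \<Gamma>. c (opp \<Gamma> d) = (- c d) mod int k) \<and>
       (\<forall>v \<in> verts \<Gamma>. (\<Sum>d \<in> {d \<in> darts \<Gamma>. src \<Gamma> d = v \<and> c d \<noteq> 0}. c d) mod int k = 0)},
     mult = (\<lambda>c c' d. (c d + c' d) mod int k),
     one = (\<lambda>d. 0)\<rparr>"

definition walk_chain :: "nat \<Rightarrow> ('v, 'd) sgraph \<Rightarrow> 'd list \<Rightarrow> 'd \<Rightarrow> int" where
  "walk_chain k \<Gamma> \<gamma> d =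
     (if d \<in> darts \<Gamma>
      then (int (count_list \<gamma> d) - int (count_list \<gamma> (opp \<Gamma> d))) mod int k else 0)"

text \<open>The natural map from the fundamental group to homology; \<open>walk_chain\<close> is constant on
  homotopy classes.\<close>

definition hurewicz :: "nat \<Rightarrow> ('v, 'd) sgraph \<Rightarrow> 'd list set \<Rightarrow> 'd \<Rightarrow> int" where
  "hurewicz k \<Gamma> C = the_elem (walk_chain k \<Gamma> ` C)"

definition homology_cover ::
  "nat \<Rightarrow> ('w, 'e) sgraph \<Rightarrow> 'w \<Rightarrow> ('v, 'd) sgraph \<Rightarrow> ('v \<Rightarrow> 'w) \<times> ('d \<Rightarrow> 'e) \<Rightarrow> bool" where
  "homology_cover k \<Gamma> v0 \<Delta> p \<longleftrightarrow> graph_covering \<Delta> \<Gamma> p \<and> connected_graph \<Delta> \<and>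
     (\<exists>x \<in> verts \<Delta>. fst p x = v0 \<and>
        pi1_map \<Gamma> p x ` carrier (pi1 \<Delta> x) = kernel (pi1 \<Gamma> v0) (H1 k \<Gamma>) (hurewicz k \<Gamma>))"


section \<open>Cayley graphs and the cubization\<close>

definition symmetric_generating_set :: "('g, 'm) monoid_scheme \<Rightarrow> 'g set \<Rightarrow> bool" where
  "symmetric_generating_set G S \<longleftrightarrow>
     S \<subseteq> carrier G \<and> (\<forall>s \<in> S. inv\<^bsub>G\<^esub> s \<in> S) \<and> generate G S = carrier G"

text \<open>\<open>A\<close> contains exactly one element of each pair consisting of some \<open>s \<in> S\<close> and its inverse.\<close>

definition letters :: "('g, 'm) monoid_scheme \<Rightarrow> 'g set \<Rightarrow> 'g set \<Rightarrow> bool" where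
  "letters G S A \<longleftrightarrow>
     A \<subseteq> S \<and> (\<forall>s \<in> S. s \<in> A \<or> inv\<^bsub>G\<^esub> s \<in> A) \<and> (\<forall>a \<in> A. inv\<^bsub>G\<^esub> a \<in> A \<longrightarrow> inv\<^bsub>G\<^esub> a = a)"

text \<open>
  The edge \<open>(g, a)\<close> from \<open>g\<close> to \<open>g \<otimes> a\<close> is represented by the darts \<open>(g, a, True)\<close>, issuing from
  \<open>g\<close>, and \<open>(g, a, False)\<close>, issuing from \<open>g \<otimes> a\<close>.
\<close>

definition Cay :: "('g, 'm) monoid_scheme \<Rightarrow> 'g set \<Rightarrow> ('g, 'g \<times> 'g \<times> bool) sgraph" where
  "Cay G A = \<lparr>
     verts = carrier G,
     darts = carrier G \<times> A \<times> UNIV,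
     src = (\<lambda>(g, a, b). if b then g else g \<otimes>\<^bsub>G\<^esub> a),
     opp = (\<lambda>(g, a, b). (g, a, \<not> b))\<rparr>"

definition is_Cayley_graph_of :: "('v, 'd) sgraph \<Rightarrow> ('h, 'm) monoid_scheme \<Rightarrow> bool" where
  "is_Cayley_graph_of \<Delta> H \<longleftrightarrow> group H \<and>
     (\<exists>S A f. finite S \<and> symmetric_generating_set H S \<and> letters H S A \<and>
        graph_iso (Cay H A) \<Delta> f)"

definition left_mult ::
  "('g, 'm) monoid_scheme \<Rightarrow> 'g \<Rightarrow> ('g \<Rightarrow> 'g) \<times> ('g \<times> 'g \<times> bool \<Rightarrow> 'g \<times> 'g \<times> bool)" where
  "left_mult G g = (\<lambda>h. g \<otimes>\<^bsub>G\<^esub> h, \<lambda>(h, a, b). (g \<otimes>\<^bsub>G\<^esub> h, a, b))"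

definition is_lift ::
  "('v, 'd) sgraph \<Rightarrow> ('v \<Rightarrow> 'w) \<times> ('d \<Rightarrow> 'e) \<Rightarrow> ('w \<Rightarrow> 'w) \<times> ('e \<Rightarrow> 'e) \<Rightarrow>
     ('v \<Rightarrow> 'v) \<times> ('d \<Rightarrow> 'd) \<Rightarrow> bool" where
  "is_lift \<Delta> p \<alpha> f \<longleftrightarrow> graph_iso \<Delta> \<Delta> f \<and>
     (\<forall>x \<in> verts \<Delta>. fst p (fst f x) = fst \<alpha> (fst p x)) \<and>
     (\<forall>d \<in> darts \<Delta>. snd p (snd f d) = snd \<alpha> (snd p d))"

text \<open>
  The group operation of \<open>BijGroup\<close> is composition; its elements are extensional functions, so that
  an automorphism is determined by its values on vertices and darts.
\<close>

definition cubization ::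
  "('g, 'm) monoid_scheme \<Rightarrow> ('v, 'd) sgraph \<Rightarrow> ('v \<Rightarrow> 'g) \<times> ('d \<Rightarrow> 'g \<times> 'g \<times> bool) \<Rightarrow>
     (('v \<Rightarrow> 'v) \<times> ('d \<Rightarrow> 'd)) monoid" where
  "cubization G \<Delta> p =
     (BijGroup (verts \<Delta>) \<times>\<times> BijGroup (darts \<Delta>))
       \<lparr>carrier := {f \<in> Bij (verts \<Delta>) \<times> Bij (darts \<Delta>).
                      \<exists>g \<in> carrier G. is_lift \<Delta> p (left_mult G g) f}\<rparr>"


section \<open>CAT(0) spaces\<close>

definition geodesic_segment :: "'x set \<Rightarrow> ('x \<Rightarrow> 'x \<Rightarrow> real) \<Rightarrow> 'x \<Rightarrow> 'x \<Rightarrow> 'x set \<Rightarrow> bool" where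
  "geodesic_segment M d x y g \<longleftrightarrow>
     (\<exists>c. g = c ` {0..d x y} \<and> g \<subseteq> M \<and> c 0 = x \<and> c (d x y) = y \<and>
        (\<forall>s \<in> {0..d x y}. \<forall>t \<in> {0..d x y}. d (c s) (c t) = \<bar>s - t\<bar>))"

text \<open>\<open>X\<close> is the comparison point of \<open>x\<close> on the comparison side from \<open>P\<close> to \<open>Q\<close> of the side \<open>g\<close>,
  which starts at \<open>p\<close>.\<close>

definition comparison_point ::
  "('x \<Rightarrow> 'x \<Rightarrow> real) \<Rightarrow> 'x \<Rightarrow> 'x set \<Rightarrow> real^2 \<Rightarrow> real^2 \<Rightarrow> 'x \<Rightarrow> real^2 \<Rightarrow> bool" where
  "comparison_point d p g P Q x X \<longleftrightarrow> x \<in> g \<and> X \<in> closed_segment P Q \<and> dist P X = d p x"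

definition CAT0_space :: "'x set \<Rightarrow> ('x \<Rightarrow> 'x \<Rightarrow> real) \<Rightarrow> bool" where
  "CAT0_space M d \<longleftrightarrow> Metric_space M d \<and>
     (\<forall>x \<in> M. \<forall>y \<in> M. \<exists>g. geodesic_segment M d x y g) \<and>
     (\<forall>p \<in> M. \<forall>q \<in> M. \<forall>r \<in> M. \<forall>g1 g2 g3. \<forall>P Q R :: real^2.
        geodesic_segment M d p q g1 \<and> geodesic_segment M d q r g2 \<and>
        geodesic_segment M d r p g3 \<and>
        dist P Q = d p q \<and> dist Q R = d q r \<and> dist R P = d r p \<longrightarrow>
        (let comp = (\<lambda>x X. comparison_point d p g1 P Q x X \<or> comparison_point d q g2 Q R x X \<or>
                           comparison_point d r g3 R P x X)
         in \<forall>x X y Y. comp x X \<and> comp y Y \<longrightarrow> d x y \<le> dist X Y))"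


section \<open>Cubical complexes\<close>

text \<open>
  Bridson and Haefliger, Definition I.7.32: a cubical complex is a quotient of a disjoint union of
  unit cubes such that the projection is injective on each cube and two cubes meet, if at all,
  in a common face, glued by an isometry.  We describe it by the set of the restrictions of the
  projection: a pair \<open>(J, \<phi>)\<close> stands for the cube with coordinates indexed by the finite set \<open>J\<close>,
  mapped to the complex by \<open>\<phi>\<close>.  Dimensions need not be bounded, and faces need not be listed as
  separate cubes.
\<close>

type_synonym ('w, 'x) cubes = "('w set \<times> (('w \<Rightarrow> real) \<Rightarrow> 'x)) set"

definition unit_cube :: "'w set \<Rightarrow> ('w \<Rightarrow> real) set" where
  "unit_cube J = (\<Pi>\<^sub>E w \<in> J. {0..1})"

definition cube_dist :: "'w set \<Rightarrow> ('w \<Rightarrow> real) \<Rightarrow> ('w \<Rightarrow> real) \<Rightarrow> real" where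
  "cube_dist J u v = L2_set (\<lambda>w. u w - v w) J"

definition cube_face :: "'w set \<Rightarrow> ('w \<Rightarrow> real) set \<Rightarrow> bool" where
  "cube_face J F \<longleftrightarrow>
     (\<exists>T \<epsilon>. T \<subseteq> J \<and> \<epsilon> ` T \<subseteq> {0, 1} \<and> F = {u \<in> unit_cube J. \<forall>w \<in> T. u w = \<epsilon> w})"

definition cube_isometry ::
  "'w set \<Rightarrow> ('w \<Rightarrow> real) set \<Rightarrow> 'w set \<Rightarrow> ('w \<Rightarrow> real) set \<Rightarrow> (('w \<Rightarrow> real) \<Rightarrow> 'w \<Rightarrow> real) \<Rightarrow> bool"
  where
  "cube_isometry J F J' F' h \<longleftrightarrow> bij_betw h F F' \<and>
     (\<forall>u \<in> F. \<forall>v \<in> F. cube_dist J' (h u) (h v) = cube_dist J u v)"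

definition cubical_complex :: "('w, 'x) cubes \<Rightarrow> bool" where
  "cubical_complex K \<longleftrightarrow>
     (\<forall>(J, \<phi>) \<in> K. finite J \<and> inj_on \<phi> (unit_cube J)) \<and>
     (\<forall>(J, \<phi>) \<in> K. \<forall>(J', \<phi>') \<in> K. \<phi> ` unit_cube J \<inter> \<phi>' ` unit_cube J' \<noteq> {} \<longrightarrow>
        (\<exists>F F' h. cube_face J F \<and> cube_face J' F' \<and> cube_isometry J F J' F' h \<and>
           (\<forall>u \<in> unit_cube J. \<forall>u' \<in> unit_cube J'. \<phi> u = \<phi>' u' \<longleftrightarrow> u \<in> F \<and> u' = h u)))"

definition cc_points :: "('w, 'x) cubes \<Rightarrow> 'x set" where
  "cc_points K = (\<Union>(J, \<phi>) \<in> K. \<phi> ` unit_cube J)"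

text \<open>
  \<open>cc_string K x y l\<close>: there is a string of points from \<open>x\<close> to \<open>y\<close>, consecutive ones lying in a
  common cube, whose consecutive distances inside these cubes add up to \<open>l\<close>.  The intrinsic
  (pseudo)metric is the infimum of the lengths of strings.
\<close>

inductive cc_string :: "('w, 'x) cubes \<Rightarrow> 'x \<Rightarrow> 'x \<Rightarrow> real \<Rightarrow> bool" for K where
  start: "x \<in> cc_points K \<Longrightarrow> cc_string K x x 0"
| step: "cc_string K x (\<phi> u) l \<Longrightarrow> (J, \<phi>) \<in> K \<Longrightarrow> u \<in> unit_cube J \<Longrightarrow> v \<in> unit_cube J \<Longrightarrow>
    cc_string K x (\<phi> v) (l + cube_dist J u v)"

definition cc_connected :: "('w, 'x) cubes \<Rightarrow> bool" where
  "cc_connected K \<longleftrightarrow> (\<forall>x \<in> cc_points K. \<forall>y \<in> cc_points K. \<exists>l. cc_string K x y l)"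

text \<open>The value 0 in the absence of strings is irrelevant in connected complexes.\<close>

definition cc_dist :: "('w, 'x) cubes \<Rightarrow> 'x \<Rightarrow> 'x \<Rightarrow> real" where
  "cc_dist K x y = (if \<exists>l. cc_string K x y l then Inf {l. cc_string K x y l} else 0)"

definition CAT0_cubical_complex :: "('w, 'x) cubes \<Rightarrow> bool" where
  "CAT0_cubical_complex K \<longleftrightarrow>
     cubical_complex K \<and> cc_points K \<noteq> {} \<and> cc_connected K \<and> CAT0_space (cc_points K) (cc_dist K)"

text \<open>A cubical automorphism maps each cube isometrically onto a cube of the complex, that is, onto
  a face of a listed one, and so does its inverse.\<close>

definition cubical_map :: "('w, 'x) cubes \<Rightarrow> ('x \<Rightarrow> 'x) \<Rightarrow> bool" where
  "cubical_map K f \<longleftrightarrow>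
     (\<forall>(J, \<phi>) \<in> K. \<exists>(J', \<phi>') \<in> K. \<exists>F' h. cube_face J' F' \<and>
        cube_isometry J (unit_cube J) J' F' h \<and> (\<forall>u \<in> unit_cube J. f (\<phi> u) = \<phi>' (h u)))"

definition cubical_automorphism :: "('w, 'x) cubes \<Rightarrow> ('x \<Rightarrow> 'x) \<Rightarrow> bool" where
  "cubical_automorphism K f \<longleftrightarrow> bij_betw f (cc_points K) (cc_points K) \<and>
     cubical_map K f \<and> cubical_map K (inv_into (cc_points K) f)"

definition cubical_action ::
  "('h, 'm) monoid_scheme \<Rightarrow> ('w, 'x) cubes \<Rightarrow> ('h \<Rightarrow> 'x \<Rightarrow> 'x) \<Rightarrow> bool" where
  "cubical_action H K \<psi> \<longleftrightarrow>
     group_action H (cc_points K) \<psi> \<and> (\<forall>h \<in> carrier H. cubical_automorphism K (\<psi> h))"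

definition unbounded_orbits ::
  "('h, 'm) monoid_scheme \<Rightarrow> ('w, 'x) cubes \<Rightarrow> ('h \<Rightarrow> 'x \<Rightarrow> 'x) \<Rightarrow> bool" where
  "unbounded_orbits H K \<psi> \<longleftrightarrow>
     (\<forall>x \<in> cc_points K. \<not> Metric_space.mbounded (cc_points K) (cc_dist K) (orbit H \<psi> x))"


section \<open>Concrete types for existential statements\<close>

text \<open>
  Existence of a graph or a complex can only be asserted over given types.  The points of the
  homology cover of a Cayley graph can be taken to be classes of walks, and the complexes have
  points that are functions on (edges of the Cayley graph) \<open>\<times>\<close> (residues).
\<close>

type_synonym 'g walk_class = "('g \<times> 'g \<times> bool) list set"
type_synonym 'g cover_graph = "('g walk_class, 'g walk_class \<times> ('g \<times> 'g \<times> bool)) sgraph"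
type_synonym 'g coord = "'g \<times> 'g \<times> int"
type_synonym 'g coord_cubes = "('g coord, 'g coord \<Rightarrow> real) cubes"

end

theory Submission
  imports Defs
begin

text \<open>
  A closed walk of \<open>\<Gamma>\<close> at the base point lifts to a closed walk of the homology cover iff its chain
  modulo \<open>k\<close> vanishes.  Hence the end of a lifted walk is determined by its end in \<open>\<Gamma>\<close> together with
  its chain, every automorphism of \<open>\<Gamma>\<close> lifts, and the cubization acts simply transitively on the
  vertices of the cover; this makes the cover a Cayley graph.

  For the action, fix a vertex \<open>x0\<close> of the cover over the identity and assign to a vertex \<open>x\<close> the
  chain of the image of a walk from \<open>x0\<close> to \<open>x\<close>.  Each pair
  of an edge \<open>e\<close> of \<open>\<Gamma>\<close> and a residue \<open>i\<close> gives a wall, which separates the vertices whose chain takes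
  the value \<open>i\<close> at \<open>e\<close> from the others.  The cubization permutes the walls, hence the coordinates of the
  cube with one coordinate for each wall.  The points of this infinite cube that differ from the vertex
  of \<open>x0\<close> in finitely many coordinates form a cubical complex in which any two points lie in a common
  cube, so that its metric is the Euclidean one and CAT(0) is immediate.  A shortest walk of length \<open>n\<close>
  in \<open>\<Gamma>\<close> traverses \<open>n\<close> different edges once, so its lift moves the vertex of \<open>x0\<close> by at least \<open>\<surd>n\<close>.
\<close>

section \<open>Walks and their chains\<close>

text \<open>Removing an edge need not disconnect \<Gamma>, so \<Gamma> itself carries no walls of
  this kind. In the cover a walk closes up only if it crosses every edge, counted with sign, a
  multiple of k times. Hence the crossing number of an edge modulo k is a function on the vertices;
  this is why the cubization acts and not G. Its elements act on these functions by an affine rule: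
  a left translation of the edges followed by the addition of a chain. To make the addition cubical,
  a residue is encoded by k coordinates exactly one of which is 1, and adding a residue permutes
  them. Chains have finite support, so only finitely many coordinates of the base vertex change, and
  the permutations preserve the set of points at finite distance from it. The dual complex of the
  walls would require a check of non-positive curvature; the whole cube around it is flat, and
  enlarging the complex does no harm to the unboundedness of orbits. Finally, k > 1 makes the
  crossing numbers 1 and -1 nonzero residues.\<close>

lemma wf_sgraphD:
  assumes "wf_sgraph \<Gamma>" "d \<in> darts \<Gamma>"
  shows "src \<Gamma> d \<in> verts \<Gamma>" "opp \<Gamma> d \<in> darts \<Gamma>" "opp \<Gamma> (opp \<Gamma> d) = d" "opp \<Gamma> d \<noteq> d"
    "tgt \<Gamma> d \<in> verts \<Gamma>" "tgt \<Gamma> (opp \<Gamma> d) = src \<Gamma> d"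
  using assms by (simp_all add: wf_sgraph_def tgt_def)

lemma src_opp: "src \<Gamma> (opp \<Gamma> d) = tgt \<Gamma> d"
  by (simp add: tgt_def)

lemma walk_verts:
  assumes "wf_sgraph \<Gamma>"
  shows "walk \<Gamma> u \<gamma> v \<Longrightarrow> u \<in> verts \<Gamma> \<and> v \<in> verts \<Gamma>"
  by (induction \<gamma> arbitrary: u) (auto simp: wf_sgraphD[OF assms])

lemma walk_darts: "walk \<Gamma> u \<gamma> v \<Longrightarrow> set \<gamma> \<subseteq> darts \<Gamma>"
  by (induction \<gamma> arbitrary: u) auto

lemma walk_end_unique: "walk \<Gamma> u \<gamma> v \<Longrightarrow> walk \<Gamma> u \<gamma> w \<Longrightarrow> v = w"
  by (induction \<gamma> arbitrary: u) auto

lemma walk_append_iff: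
  assumes "wf_sgraph \<Gamma>"
  shows "walk \<Gamma> u (\<gamma> @ \<delta>) w \<longleftrightarrow> (\<exists>v. walk \<Gamma> u \<gamma> v \<and> walk \<Gamma> v \<delta> w)"
  by (induction \<gamma> arbitrary: u) (auto dest: walk_verts[OF assms])

lemma walk_appendI:
  "wf_sgraph \<Gamma> \<Longrightarrow> walk \<Gamma> u \<gamma> v \<Longrightarrow> walk \<Gamma> v \<delta> w \<Longrightarrow> walk \<Gamma> u (\<gamma> @ \<delta>) w"
  by (auto simp: walk_append_iff)

definition inv_walk :: "('v, 'd) sgraph \<Rightarrow> 'd list \<Rightarrow> 'd list" where
  "inv_walk \<Gamma> \<gamma> = rev (map (opp \<Gamma>) \<gamma>)"

lemma walk_inv_walk:
  assumes "wf_sgraph \<Gamma>"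
  shows "walk \<Gamma> u \<gamma> v \<Longrightarrow> walk \<Gamma> v (inv_walk \<Gamma> \<gamma>) u"
proof (induction \<gamma> arbitrary: u)
  case (Cons d \<gamma>)
  then show ?case
    using wf_sgraphD[OF assms, of d]
    by (auto simp: inv_walk_def walk_append_iff[OF assms] src_opp)
qed (simp add: inv_walk_def)

lemma inv_walk_inv_walk:
  assumes "wf_sgraph \<Gamma>"
  shows "set \<gamma> \<subseteq> darts \<Gamma> \<Longrightarrow> inv_walk \<Gamma> (inv_walk \<Gamma> \<gamma>) = \<gamma>"
  by (induction \<gamma>) (auto simp: inv_walk_def wf_sgraphD[OF assms])

lemma walk_chain_Nil [simp]: "walk_chain k \<Gamma> [] = (\<lambda>d. 0)"
  by (auto simp: walk_chain_def)

lemma walk_chain_append: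
  "walk_chain k \<Gamma> (\<gamma> @ \<delta>) d = (walk_chain k \<Gamma> \<gamma> d + walk_chain k \<Gamma> \<delta> d) mod int k"
proof -
  have "int (count_list (\<gamma> @ \<delta>) d) - int (count_list (\<gamma> @ \<delta>) (opp \<Gamma> d)) =
    (int (count_list \<gamma> d) - int (count_list \<gamma> (opp \<Gamma> d))) +
    (int (count_list \<delta> d) - int (count_list \<delta> (opp \<Gamma> d)))" by simp
  then show ?thesis by (simp only: walk_chain_def) (simp add: mod_add_eq)
qed

lemma walk_chain_mod [simp]: "walk_chain k \<Gamma> \<gamma> d mod int k = walk_chain k \<Gamma> \<gamma> d"
  by (simp add: walk_chain_def)

lemma walk_chain_range: "0 < k \<Longrightarrow> walk_chain k \<Gamma> \<gamma> d \<in> {0..<int k}"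
  by (simp add: walk_chain_def)

lemma walk_chain_inv_walk:
  assumes wf: "wf_sgraph \<Gamma>" and \<gamma>: "set \<gamma> \<subseteq> darts \<Gamma>"
  shows "walk_chain k \<Gamma> (inv_walk \<Gamma> \<gamma>) d = (- walk_chain k \<Gamma> \<gamma> d) mod int k"
proof -
  have "count_list (inv_walk \<Gamma> \<gamma>) d = count_list \<gamma> (opp \<Gamma> d)" if "d \<in> darts \<Gamma>" for d
    using \<gamma> that
    by (induction \<gamma>) (auto simp: inv_walk_def wf_sgraphD[OF wf])
  then show ?thesis
    using wf_sgraphD[OF wf, of d] by (simp add: walk_chain_def mod_simps)
qed

lemma walk_chain_backtrack:
  assumes "wf_sgraph \<Gamma>" "d \<in> darts \<Gamma>"
  shows "walk_chain k \<Gamma> [d, opp \<Gamma> d] = (\<lambda>_. 0)"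
  using wf_sgraphD[OF assms] wf_sgraphD(3)[OF assms(1)]
  by (auto simp: walk_chain_def fun_eq_iff)

text \<open>Chains are additive under concatenation and odd under reversal. Since residues are
  normalised to 0, ..., k - 1, congruence of the values is equality.\<close>

lemma walk_chain_eq_iff:
  assumes "wf_sgraph \<Gamma>" "set \<delta> \<subseteq> darts \<Gamma>"
  shows "walk_chain k \<Gamma> (\<gamma> @ inv_walk \<Gamma> \<delta>) = (\<lambda>_. 0) \<longleftrightarrow> walk_chain k \<Gamma> \<gamma> = walk_chain k \<Gamma> \<delta>"
proof -
  have "walk_chain k \<Gamma> (\<gamma> @ inv_walk \<Gamma> \<delta>) d = (walk_chain k \<Gamma> \<gamma> d - walk_chain k \<Gamma> \<delta> d) mod int k" for d
    by (simp add: walk_chain_append walk_chain_inv_walk[OF assms] mod_simps)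
  moreover have "(walk_chain k \<Gamma> \<gamma> d - walk_chain k \<Gamma> \<delta> d) mod int k = 0 \<longleftrightarrow>
      walk_chain k \<Gamma> \<gamma> d = walk_chain k \<Gamma> \<delta> d" for d
    using mod_eq_dvd_iff[of "walk_chain k \<Gamma> \<gamma> d" "int k" "walk_chain k \<Gamma> \<delta> d"]
    by (simp add: dvd_eq_mod_eq_0)
  ultimately show ?thesis by (simp add: fun_eq_iff)
qed

lemma morphism_walk:
  assumes "graph_morphism \<Delta> \<Gamma> f" "wf_sgraph \<Delta>"
  shows "walk \<Delta> x \<delta> y \<Longrightarrow> walk \<Gamma> (fst f x) (map (snd f) \<delta>) (fst f y)"
proof (induction \<delta> arbitrary: x)
  case (Cons d \<delta>)
  then have "d \<in> darts \<Delta>" by simp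
  moreover from this have "tgt \<Gamma> (snd f d) = fst f (tgt \<Delta> d)"
    using assms wf_sgraphD[OF assms(2), of d] by (simp add: graph_morphism_def tgt_def)
  ultimately show ?case using Cons assms by (auto simp: graph_morphism_def)
qed (use assms in \<open>auto simp: graph_morphism_def\<close>)

lemma morphism_inv_walk:
  assumes "graph_morphism \<Delta> \<Gamma> f" "set \<delta> \<subseteq> darts \<Delta>"
  shows "map (snd f) (inv_walk \<Delta> \<delta>) = inv_walk \<Gamma> (map (snd f) \<delta>)"
  using assms by (induction \<delta>) (auto simp: inv_walk_def graph_morphism_def)

lemma morphism_tgt:
  assumes "graph_morphism \<Delta> \<Gamma> f" "wf_sgraph \<Delta>" "d \<in> darts \<Delta>"
  shows "tgt \<Gamma> (snd f d) = fst f (tgt \<Delta> d)"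
  using assms wf_sgraphD[OF assms(2,3)] by (simp add: graph_morphism_def tgt_def)


section \<open>Homotopy\<close>

text \<open>Homotopy is generated by inserting and deleting backtracks, so a single insertion has to
  be checked. \<open>Q\<close> may have any type; truth values serve to propagate an
  equivalence.\<close>

lemma htpy_invariant:
  assumes "(\<gamma>, \<gamma>') \<in> htpy \<Gamma> v"
    and "\<And>\<gamma> \<gamma>'. (\<gamma>, \<gamma>') \<in> backtracks \<Gamma> v \<Longrightarrow> Q \<gamma> = Q \<gamma>'"
  shows "Q \<gamma> = Q \<gamma>'"
proof -
  have "(\<gamma>, \<gamma>') \<in> (backtracks \<Gamma> v \<union> (backtracks \<Gamma> v)\<inverse>)\<^sup>*"
    using assms(1) by (simp add: htpy_def)
  then show ?thesis by (induction rule: rtrancl_induct) (auto dest: assms(2))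
qed

lemma equiv_htpy: "equiv (loops \<Gamma> v) (htpy \<Gamma> v)"
proof (rule equivI)
  show "htpy \<Gamma> v \<subseteq> loops \<Gamma> v \<times> loops \<Gamma> v" by (auto simp: htpy_def)
  show "refl_on (loops \<Gamma> v) (htpy \<Gamma> v)" by (auto simp: refl_on_def htpy_def)
  have "sym (backtracks \<Gamma> v \<union> (backtracks \<Gamma> v)\<inverse>)" by (auto simp: sym_def)
  then show "sym (htpy \<Gamma> v)"
    unfolding htpy_def by (intro sym_Int sym_rtrancl) (auto simp: sym_def)
  show "trans (htpy \<Gamma> v)"
    unfolding htpy_def by (intro trans_Int trans_rtrancl) (auto simp: trans_def)
qed

text \<open>A backtrack crosses one edge once in each direction and contributes 0. Hence
  \<open>hurewicz\<close>, which extracts the common chain of a class by \<open>the_elem\<close>, is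
  well defined.\<close>

lemma walk_chain_htpy:
  assumes wf: "wf_sgraph \<Gamma>" and "(\<gamma>, \<gamma>') \<in> htpy \<Gamma> v"
  shows "walk_chain k \<Gamma> \<gamma> = walk_chain k \<Gamma> \<gamma>'"
  using assms(2)
proof (rule htpy_invariant)
  fix \<gamma> \<gamma>' assume "(\<gamma>, \<gamma>') \<in> backtracks \<Gamma> v"
  then obtain xs ys d where *: "\<gamma> = xs @ ys" "\<gamma>' = xs @ [d, opp \<Gamma> d] @ ys" "\<gamma>' \<in> loops \<Gamma> v"
    unfolding backtracks_def by blast
  then have "d \<in> darts \<Gamma>" using walk_darts by (fastforce simp: loops_def)
  then have "walk_chain k \<Gamma> \<gamma> e = walk_chain k \<Gamma> \<gamma>' e" for e
    unfolding * walk_chain_append by (simp add: walk_chain_backtrack[OF wf] mod_simps)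
  then show "walk_chain k \<Gamma> \<gamma> = walk_chain k \<Gamma> \<gamma>'" ..
qed

lemma hurewicz_class:
  assumes "wf_sgraph \<Gamma>" "\<gamma> \<in> loops \<Gamma> v"
  shows "hurewicz k \<Gamma> (htpy \<Gamma> v `` {\<gamma>}) = walk_chain k \<Gamma> \<gamma>"
proof -
  have "walk_chain k \<Gamma> ` (htpy \<Gamma> v `` {\<gamma>}) = {walk_chain k \<Gamma> \<gamma>}"
    using walk_chain_htpy[OF assms(1)] equiv_class_self[OF equiv_htpy assms(2)] by fastforce
  then show ?thesis by (simp add: hurewicz_def)
qed


section \<open>Coverings\<close>

text \<open>The lift itself is hidden, as later arguments only use where it ends. The relation
  composes along concatenations, and uniqueness of lifts makes it single-valued in
  \<open>y\<close>.\<close>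

definition lifts_to ::
  "('v, 'd) sgraph \<Rightarrow> ('v \<Rightarrow> 'w) \<times> ('d \<Rightarrow> 'e) \<Rightarrow> 'v \<Rightarrow> 'e list \<Rightarrow> 'v \<Rightarrow> bool" where
  "lifts_to \<Delta> p x \<gamma> y \<longleftrightarrow> (\<exists>\<delta>. walk \<Delta> x \<delta> y \<and> map (snd p) \<delta> = \<gamma>)"

locale covering =
  fixes \<Delta> :: "('v, 'd) sgraph" and \<Gamma> :: "('w, 'e) sgraph" and p :: "('v \<Rightarrow> 'w) \<times> ('d \<Rightarrow> 'e)"
  assumes covering: "graph_covering \<Delta> \<Gamma> p"
begin

lemma wf: "wf_sgraph \<Delta>" "wf_sgraph \<Gamma>"
  using covering by (auto simp: graph_covering_def)

lemma morphism: "graph_morphism \<Delta> \<Gamma> p"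
  using covering by (simp add: graph_covering_def)

lemma p_verts: "x \<in> verts \<Delta> \<Longrightarrow> fst p x \<in> verts \<Gamma>"
  using morphism by (auto simp: graph_morphism_def)

lemma p_darts: "d \<in> darts \<Delta> \<Longrightarrow> snd p d \<in> darts \<Gamma>"
  using morphism by (auto simp: graph_morphism_def)

lemma p_src: "d \<in> darts \<Delta> \<Longrightarrow> src \<Gamma> (snd p d) = fst p (src \<Delta> d)"
  using morphism by (simp add: graph_morphism_def)

lemma p_opp: "d \<in> darts \<Delta> \<Longrightarrow> opp \<Gamma> (snd p d) = snd p (opp \<Delta> d)"
  using morphism by (simp add: graph_morphism_def)

lemmas p_tgt = morphism_tgt[OF morphism wf(1)]
lemmas p_walk = morphism_walk[OF morphism wf(1)]

lemma dart_unique: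
  assumes "d \<in> darts \<Delta>" "d' \<in> darts \<Delta>" "src \<Delta> d = src \<Delta> d'" "snd p d = snd p d'"
  shows "d = d'"
proof -
  have "inj_on (snd p) {e \<in> darts \<Delta>. src \<Delta> e = src \<Delta> d}"
    using covering wf_sgraphD(1)[OF wf(1) assms(1)] by (auto simp: graph_covering_def bij_betw_def)
  then show ?thesis using assms by (auto dest: inj_onD)
qed

lemma dart_lift:
  assumes "x \<in> verts \<Delta>" "e \<in> darts \<Gamma>" "src \<Gamma> e = fst p x"
  obtains d where "d \<in> darts \<Delta>" "src \<Delta> d = x" "snd p d = e"
proof -
  have "snd p ` {d \<in> darts \<Delta>. src \<Delta> d = x} = {d \<in> darts \<Gamma>. src \<Gamma> d = fst p x}"
    using covering assms(1) by (auto simp: graph_covering_def bij_betw_def)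
  then have "e \<in> snd p ` {d \<in> darts \<Delta>. src \<Delta> d = x}" using assms by blast
  then show ?thesis using that by blast
qed

lemma lifts_to_exists:
  "walk \<Gamma> u \<gamma> v \<Longrightarrow> x \<in> verts \<Delta> \<Longrightarrow> u = fst p x \<Longrightarrow> \<exists>y. lifts_to \<Delta> p x \<gamma> y \<and> fst p y = v"
proof (induction \<gamma> arbitrary: u x)
  case Nil
  then show ?case by (auto simp: lifts_to_def intro!: exI[of _ "[]"])
next
  case (Cons e \<gamma>)
  then have e: "e \<in> darts \<Gamma>" "src \<Gamma> e = fst p x" "walk \<Gamma> (tgt \<Gamma> e) \<gamma> v" by auto
  obtain d where d: "d \<in> darts \<Delta>" "src \<Delta> d = x" "snd p d = e"
    using dart_lift[OF Cons.prems(2) e(1,2)] .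
  then obtain y \<delta> where "walk \<Delta> (tgt \<Delta> d) \<delta> y" "map (snd p) \<delta> = \<gamma>" "fst p y = v"
    using Cons.IH[OF e(3), of "tgt \<Delta> d"] p_tgt wf_sgraphD[OF wf(1) d(1)] by (auto simp: lifts_to_def)
  with d show ?case by (auto simp: lifts_to_def intro!: exI[of _ y] exI[of _ "d # \<delta>"])
qed

lemma walk_lift_unique:
  "walk \<Delta> x \<delta> y \<Longrightarrow> walk \<Delta> x \<delta>' y' \<Longrightarrow> map (snd p) \<delta> = map (snd p) \<delta>' \<Longrightarrow> \<delta> = \<delta>'"
proof (induction \<delta> arbitrary: x \<delta>')
  case (Cons d \<delta>)
  then obtain d' \<delta>'' where \<delta>': "\<delta>' = d' # \<delta>''" by (cases \<delta>') auto
  with Cons.prems have "d = d'" by (intro dart_unique) auto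
  with Cons \<delta>' show ?case by auto
qed simp

lemma lifts_to_unique: "lifts_to \<Delta> p x \<gamma> y \<Longrightarrow> lifts_to \<Delta> p x \<gamma> y' \<Longrightarrow> y = y'"
  unfolding lifts_to_def using walk_lift_unique walk_end_unique by metis

lemma lifts_to_verts: "lifts_to \<Delta> p x \<gamma> y \<Longrightarrow> x \<in> verts \<Delta> \<and> y \<in> verts \<Delta>"
  unfolding lifts_to_def using walk_verts[OF wf(1)] by blast

lemma lifts_to_walk: "lifts_to \<Delta> p x \<gamma> y \<Longrightarrow> walk \<Gamma> (fst p x) \<gamma> (fst p y)"
  unfolding lifts_to_def using p_walk by blast

lemma lifts_to_append:
  "lifts_to \<Delta> p x (\<gamma> @ \<gamma>') z \<longleftrightarrow> (\<exists>y. lifts_to \<Delta> p x \<gamma> y \<and> lifts_to \<Delta> p y \<gamma>' z)"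
proof
  assume "lifts_to \<Delta> p x (\<gamma> @ \<gamma>') z"
  then obtain \<delta> \<delta>' where "walk \<Delta> x (\<delta> @ \<delta>') z" "map (snd p) \<delta> = \<gamma>" "map (snd p) \<delta>' = \<gamma>'"
    by (auto simp: lifts_to_def map_eq_append_conv)
  then show "\<exists>y. lifts_to \<Delta> p x \<gamma> y \<and> lifts_to \<Delta> p y \<gamma>' z"
    by (auto simp: lifts_to_def walk_append_iff[OF wf(1)])
next
  assume "\<exists>y. lifts_to \<Delta> p x \<gamma> y \<and> lifts_to \<Delta> p y \<gamma>' z"
  then obtain y \<delta> \<delta>' where "walk \<Delta> x \<delta> y" "walk \<Delta> y \<delta>' z" "map (snd p) \<delta> = \<gamma>" "map (snd p) \<delta>' = \<gamma>'"
    by (auto simp: lifts_to_def)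
  then show "lifts_to \<Delta> p x (\<gamma> @ \<gamma>') z"
    unfolding lifts_to_def by (intro exI[of _ "\<delta> @ \<delta>'"]) (auto simp: walk_append_iff[OF wf(1)])
qed

lemma lifts_to_inv_walk:
  assumes "lifts_to \<Delta> p x \<gamma> y"
  shows "lifts_to \<Delta> p y (inv_walk \<Gamma> \<gamma>) x"
proof -
  obtain \<delta> where "walk \<Delta> x \<delta> y" "map (snd p) \<delta> = \<gamma>" using assms by (auto simp: lifts_to_def)
  then show ?thesis
    unfolding lifts_to_def
    using walk_inv_walk[OF wf(1), of x \<delta> y] morphism_inv_walk[OF morphism walk_darts, of x \<delta> y]
    by (intro exI[of _ "inv_walk \<Delta> \<delta>"]) simp
qed

lemma lifts_to_backtrack:
  assumes x: "x \<in> verts \<Delta>" and d: "d \<in> darts \<Gamma>" "src \<Gamma> d = fst p x"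
  shows "lifts_to \<Delta> p x [d, opp \<Gamma> d] y \<longleftrightarrow> y = x"
proof -
  obtain e where e: "e \<in> darts \<Delta>" "src \<Delta> e = x" "snd p e = d"
    using dart_lift[OF x d] .
  have "walk \<Delta> x [e, opp \<Delta> e] x"
    using e wf_sgraphD[OF wf(1) e(1)] x by (simp add: src_opp)
  then have "lifts_to \<Delta> p x [d, opp \<Gamma> d] x"
    unfolding lifts_to_def using e p_opp by (intro exI[of _ "[e, opp \<Delta> e]"]) auto
  then show ?thesis using lifts_to_unique by blast
qed

text \<open>Homotopy lifting: the lift of an inserted backtrack returns to the vertex where it
  started, so the rest of the walk is lifted from the same vertex as before.\<close>

lemma lifts_to_htpy:
  assumes "(\<gamma>, \<gamma>') \<in> htpy \<Gamma> (fst p x)" "x \<in> verts \<Delta>"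
  shows "lifts_to \<Delta> p x \<gamma> y \<longleftrightarrow> lifts_to \<Delta> p x \<gamma>' y"
  using assms(1)
proof (rule htpy_invariant)
  fix \<gamma> \<gamma>' assume "(\<gamma>, \<gamma>') \<in> backtracks \<Gamma> (fst p x)"
  then obtain xs ys d where *: "\<gamma> = xs @ ys" "\<gamma>' = xs @ [d, opp \<Gamma> d] @ ys" "\<gamma>' \<in> loops \<Gamma> (fst p x)"
    unfolding backtracks_def by blast
  then obtain u where u: "walk \<Gamma> (fst p x) xs u" "d \<in> darts \<Gamma>" "src \<Gamma> d = u"
    unfolding loops_def by (auto simp: walk_append_iff[OF wf(2)])
  then have bt: "lifts_to \<Delta> p z [d, opp \<Gamma> d] z' \<longleftrightarrow> z' = z" if "lifts_to \<Delta> p x xs z" for z z'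
    using that walk_end_unique[OF u(1) lifts_to_walk[OF that]] lifts_to_verts
    by (intro lifts_to_backtrack) auto
  show "lifts_to \<Delta> p x \<gamma> y = lifts_to \<Delta> p x \<gamma>' y"
    unfolding * lifts_to_append by (simp add: bt cong: conj_cong)
qed

end

text \<open>Replaces the equality of two subgroups of \<open>pi1\<close> by a test on single closed
  walks. By homotopy lifting, a class lies in the image of \<open>pi1_map\<close> iff its members
  lift to closed walks, and it lies in the kernel iff its members have chain 0. Both subgroups
  consist of classes of loops at \<open>v0\<close>, so agreement on these classes is
  equality.\<close>

lemma homology_cover_iff:
  "homology_cover k \<Gamma> v0 \<Delta> p \<longleftrightarrow> graph_covering \<Delta> \<Gamma> p \<and> connected_graph \<Delta> \<and>
     (\<exists>x \<in> verts \<Delta>. fst p x = v0 \<and>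
        (\<forall>\<gamma> \<in> loops \<Gamma> v0. lifts_to \<Delta> p x \<gamma> x \<longleftrightarrow> walk_chain k \<Gamma> \<gamma> = (\<lambda>_. 0)))"
proof -
  have "pi1_map \<Gamma> p x ` carrier (pi1 \<Delta> x) = kernel (pi1 \<Gamma> v0) (H1 k \<Gamma>) (hurewicz k \<Gamma>) \<longleftrightarrow>
    (\<forall>\<gamma> \<in> loops \<Gamma> v0. lifts_to \<Delta> p x \<gamma> x \<longleftrightarrow> walk_chain k \<Gamma> \<gamma> = (\<lambda>_. 0))"
    if cov: "graph_covering \<Delta> \<Gamma> p" and x: "x \<in> verts \<Delta>" "fst p x = v0" for x
  proof -
    interpret covering \<Delta> \<Gamma> p by standard (rule cov)
    let ?c = "\<lambda>\<gamma>. htpy \<Gamma> v0 `` {\<gamma>}"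
    have ploop: "map (snd p) \<delta> \<in> loops \<Gamma> v0" if "\<delta> \<in> loops \<Delta> x" for \<delta>
      using that p_walk[of x \<delta> x] x by (simp add: loops_def)
    have phtpy: "(map (snd p) \<delta>, map (snd p) \<delta>') \<in> htpy \<Gamma> v0" if dd: "(\<delta>, \<delta>') \<in> htpy \<Delta> x" for \<delta> \<delta>'
    proof -
      have l: "\<delta> \<in> loops \<Delta> x" using dd by (auto simp: htpy_def)
      \<comment> \<open>The invariant is membership in the homotopy class of the image of
        \<open>\<delta>\<close>.\<close>
      have "((map (snd p) \<delta>, map (snd p) \<delta>) \<in> htpy \<Gamma> v0) =
        ((map (snd p) \<delta>, map (snd p) \<delta>') \<in> htpy \<Gamma> v0)"
        using dd
      proof (rule htpy_invariant)
        fix \<gamma> \<gamma>' assume "(\<gamma>, \<gamma>') \<in> backtracks \<Delta> x"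
        then obtain xs ys d where *: "\<gamma> = xs @ ys" "\<gamma>' = xs @ [d, opp \<Delta> d] @ ys"
            "\<gamma> \<in> loops \<Delta> x" "\<gamma>' \<in> loops \<Delta> x"
          unfolding backtracks_def by blast
        then have "d \<in> darts \<Delta>" using walk_darts by (fastforce simp: loops_def)
        then have "(map (snd p) \<gamma>, map (snd p) \<gamma>') \<in> backtracks \<Gamma> v0"
          using ploop[OF *(3)] ploop[OF *(4)] * p_opp[of d] unfolding backtracks_def
          by (intro CollectI exI[of _ "map (snd p) xs"] exI[of _ "map (snd p) ys"] exI[of _ "snd p d"])
            simp
        then have "(map (snd p) \<gamma>, map (snd p) \<gamma>') \<in> htpy \<Gamma> v0"
          using ploop[OF *(3)] ploop[OF *(4)] by (auto simp: htpy_def)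
        then show "((map (snd p) \<delta>, map (snd p) \<gamma>) \<in> htpy \<Gamma> v0) =
            ((map (snd p) \<delta>, map (snd p) \<gamma>') \<in> htpy \<Gamma> v0)"
          using equiv_htpy[of \<Gamma> v0] unfolding equiv_def sym_def trans_def by blast
      qed
      then show ?thesis using equiv_htpy[of \<Gamma> v0] ploop[OF l] by (meson equivE refl_onD)
    qed
    have "pi1_map \<Gamma> p x (htpy \<Delta> x `` {\<delta>}) = ?c (map (snd p) \<delta>)" if "\<delta> \<in> loops \<Delta> x" for \<delta>
    proof -
      have "\<delta> \<in> htpy \<Delta> x `` {\<delta>}" using that equiv_class_self[OF equiv_htpy] by metis
      then show ?thesis
        unfolding pi1_map_def x(2) using phtpy equiv_htpy[of \<Gamma> v0]
        unfolding equiv_def trans_def by blast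
    qed
    then have im: "pi1_map \<Gamma> p x ` carrier (pi1 \<Delta> x) = (\<lambda>\<delta>. ?c (map (snd p) \<delta>)) ` loops \<Delta> x"
      by (auto simp: pi1_def quotient_def image_iff)
    have ker: "kernel (pi1 \<Gamma> v0) (H1 k \<Gamma>) (hurewicz k \<Gamma>) =
      ?c ` {\<gamma> \<in> loops \<Gamma> v0. walk_chain k \<Gamma> \<gamma> = (\<lambda>_. 0)}"
      using hurewicz_class[OF wf(2), of _ v0 k]
      by (auto simp: kernel_def pi1_def H1_def quotient_def image_iff)
    have lift: "lifts_to \<Delta> p x \<gamma> x \<longleftrightarrow> ?c \<gamma> \<in> pi1_map \<Gamma> p x ` carrier (pi1 \<Delta> x)"
      if g: "\<gamma> \<in> loops \<Gamma> v0" for \<gamma>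
    proof
      assume "lifts_to \<Delta> p x \<gamma> x"
      then show "?c \<gamma> \<in> pi1_map \<Gamma> p x ` carrier (pi1 \<Delta> x)"
        unfolding im by (auto simp: lifts_to_def loops_def)
    next
      assume "?c \<gamma> \<in> pi1_map \<Gamma> p x ` carrier (pi1 \<Delta> x)"
      then obtain \<delta> where \<delta>: "\<delta> \<in> loops \<Delta> x" "?c \<gamma> = ?c (map (snd p) \<delta>)" unfolding im by blast
      then have "(\<gamma>, map (snd p) \<delta>) \<in> htpy \<Gamma> v0"
        using eq_equiv_class[OF _ equiv_htpy ploop[OF \<delta>(1)]] by metis
      then show "lifts_to \<Delta> p x \<gamma> x"
        using lifts_to_htpy[of \<gamma> "map (snd p) \<delta>" x x] x \<delta>(1)
        by (auto simp: lifts_to_def loops_def)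
    qed
    have chain: "walk_chain k \<Gamma> \<gamma> = (\<lambda>_. 0) \<longleftrightarrow> ?c \<gamma> \<in> kernel (pi1 \<Gamma> v0) (H1 k \<Gamma>) (hurewicz k \<Gamma>)"
      if g: "\<gamma> \<in> loops \<Gamma> v0" for \<gamma>
    proof
      assume "walk_chain k \<Gamma> \<gamma> = (\<lambda>_. 0)"
      then show "?c \<gamma> \<in> kernel (pi1 \<Gamma> v0) (H1 k \<Gamma>) (hurewicz k \<Gamma>)"
        unfolding ker using g by blast
    next
      assume "?c \<gamma> \<in> kernel (pi1 \<Gamma> v0) (H1 k \<Gamma>) (hurewicz k \<Gamma>)"
      then obtain \<gamma>' where \<gamma>': "\<gamma>' \<in> loops \<Gamma> v0" "walk_chain k \<Gamma> \<gamma>' = (\<lambda>_. 0)" "?c \<gamma> = ?c \<gamma>'"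
        unfolding ker by blast
      then have "(\<gamma>, \<gamma>') \<in> htpy \<Gamma> v0"
        using eq_equiv_class[OF _ equiv_htpy \<gamma>'(1)] by metis
      then show "walk_chain k \<Gamma> \<gamma> = (\<lambda>_. 0)"
        using walk_chain_htpy[OF wf(2)] \<gamma>'(2) by metis
    qed
    show ?thesis
    proof
      assume "pi1_map \<Gamma> p x ` carrier (pi1 \<Delta> x) = kernel (pi1 \<Gamma> v0) (H1 k \<Gamma>) (hurewicz k \<Gamma>)"
      then show "\<forall>\<gamma> \<in> loops \<Gamma> v0. lifts_to \<Delta> p x \<gamma> x \<longleftrightarrow> walk_chain k \<Gamma> \<gamma> = (\<lambda>_. 0)"
        using lift chain by simp
    next
      assume R: "\<forall>\<gamma> \<in> loops \<Gamma> v0. lifts_to \<Delta> p x \<gamma> x \<longleftrightarrow> walk_chain k \<Gamma> \<gamma> = (\<lambda>_. 0)"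
      let ?I = "pi1_map \<Gamma> p x ` carrier (pi1 \<Delta> x)"
        and ?K = "kernel (pi1 \<Gamma> v0) (H1 k \<Gamma>) (hurewicz k \<Gamma>)"
      have eq: "?c \<gamma> \<in> ?I \<longleftrightarrow> ?c \<gamma> \<in> ?K" if "\<gamma> \<in> loops \<Gamma> v0" for \<gamma>
        using lift[OF that] chain[OF that] R that by simp
      have "C \<in> ?I \<longleftrightarrow> C \<in> ?K" for C
      proof (cases "\<exists>\<gamma> \<in> loops \<Gamma> v0. C = ?c \<gamma>")
        case True
        then show ?thesis using eq by auto
      next
        case False
        then have "C \<notin> ?I" unfolding im using ploop by auto
        moreover have "C \<notin> ?K" unfolding ker using False by auto
        ultimately show ?thesis by simp
      qed
      show "?I = ?K" by (rule Set.set_eqI) fact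
    qed
  qed
  then show ?thesis
    unfolding homology_cover_def by (intro conj_cong bex_cong refl)
qed


section \<open>Lifting automorphisms to the homology cover\<close>

lemma graph_iso_inverse:
  assumes iso: "graph_iso \<Gamma> \<Delta> f" and wf: "wf_sgraph \<Gamma>"
  shows "graph_iso \<Delta> \<Gamma> (inv_into (verts \<Gamma>) (fst f), inv_into (darts \<Gamma>) (snd f))"
proof -
  have V: "bij_betw (fst f) (verts \<Gamma>) (verts \<Delta>)" and D: "bij_betw (snd f) (darts \<Gamma>) (darts \<Delta>)"
    and mor: "graph_morphism \<Gamma> \<Delta> f" using iso by (auto simp: graph_iso_def)
  have "src \<Gamma> (inv_into (darts \<Gamma>) (snd f) d) = inv_into (verts \<Gamma>) (fst f) (src \<Delta> d) \<and>
    opp \<Gamma> (inv_into (darts \<Gamma>) (snd f) d) = inv_into (darts \<Gamma>) (snd f) (opp \<Delta> d)"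
    if "d \<in> darts \<Delta>" for d
  proof -
    have "d \<in> snd f ` darts \<Gamma>" using bij_betw_imp_surj_on[OF D] that by simp
    then obtain e where e: "e \<in> darts \<Gamma>" "d = snd f e" by blast
    then have "src \<Delta> d = fst f (src \<Gamma> e)" "opp \<Delta> d = snd f (opp \<Gamma> e)"
      using mor by (auto simp: graph_morphism_def)
    then show ?thesis
      using e V D wf_sgraphD[OF wf e(1)] by (simp add: bij_betw_inv_into_left)
  qed
  then have "graph_morphism \<Delta> \<Gamma> (inv_into (verts \<Gamma>) (fst f), inv_into (darts \<Gamma>) (snd f))"
    using bij_betw_imp_surj_on[OF bij_betw_inv_into[OF V]]
      bij_betw_imp_surj_on[OF bij_betw_inv_into[OF D]] by (simp add: graph_morphism_def)
  then show ?thesis using V D by (simp add: graph_iso_def bij_betw_inv_into)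
qed

lemma graph_morphism_compose:
  assumes "graph_morphism \<Gamma> \<Delta> f" "graph_morphism \<Delta> \<Lambda> g"
  shows "graph_morphism \<Gamma> \<Lambda> (fst g \<circ> fst f, snd g \<circ> snd f)"
  using assms by (auto simp: graph_morphism_def image_subset_iff)

lemma walk_chain_iso:
  assumes "graph_iso \<Gamma> \<Delta> f" "wf_sgraph \<Gamma>" "set \<gamma> \<subseteq> darts \<Gamma>" "d \<in> darts \<Gamma>"
  shows "walk_chain k \<Delta> (map (snd f) \<gamma>) (snd f d) = walk_chain k \<Gamma> \<gamma> d"
proof -
  have inj: "inj_on (snd f) (darts \<Gamma>)" and mor: "graph_morphism \<Gamma> \<Delta> f"
    using assms(1) by (auto simp: graph_iso_def bij_betw_def)
  have "count_list (map (snd f) \<gamma>) (snd f e) = count_list \<gamma> e" if "e \<in> darts \<Gamma>" for e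
    using assms(3) that by (induction \<gamma>) (simp_all add: inj_on_eq_iff[OF inj])
  then show ?thesis
    using mor assms(4) wf_sgraphD[OF assms(2,4)]
    by (simp add: walk_chain_def graph_morphism_def image_subset_iff)
qed

text \<open>An isomorphism carries the coefficient at a dart to the coefficient at its image, and
  every dart of the target is such an image. This makes the end of the lifted image of a walk
  independent of the choice of the walk.\<close>

lemma walk_chain_iso_eq_iff:
  assumes "graph_iso \<Gamma> \<Delta> f" "wf_sgraph \<Gamma>" "set \<gamma> \<subseteq> darts \<Gamma>" "set \<delta> \<subseteq> darts \<Gamma>"
  shows "walk_chain k \<Delta> (map (snd f) \<gamma>) = walk_chain k \<Delta> (map (snd f) \<delta>) \<longleftrightarrow>
    walk_chain k \<Gamma> \<gamma> = walk_chain k \<Gamma> \<delta>"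
proof
  assume eq: "walk_chain k \<Delta> (map (snd f) \<gamma>) = walk_chain k \<Delta> (map (snd f) \<delta>)"
  show "walk_chain k \<Gamma> \<gamma> = walk_chain k \<Gamma> \<delta>"
  proof
    fix d show "walk_chain k \<Gamma> \<gamma> d = walk_chain k \<Gamma> \<delta> d"
    proof (cases "d \<in> darts \<Gamma>")
      case True
      then show ?thesis using fun_cong[OF eq, of "snd f d"] by (simp add: walk_chain_iso[OF assms(1,2)] assms)
    qed (simp add: walk_chain_def)
  qed
next
  assume eq: "walk_chain k \<Gamma> \<gamma> = walk_chain k \<Gamma> \<delta>"
  show "walk_chain k \<Delta> (map (snd f) \<gamma>) = walk_chain k \<Delta> (map (snd f) \<delta>)"
  proof
    fix e show "walk_chain k \<Delta> (map (snd f) \<gamma>) e = walk_chain k \<Delta> (map (snd f) \<delta>) e"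
    proof (cases "e \<in> darts \<Delta>")
      case True
      then have "e \<in> snd f ` darts \<Gamma>"
        using assms(1) by (auto simp: graph_iso_def dest: bij_betw_imp_surj_on)
      then obtain d where "d \<in> darts \<Gamma>" "e = snd f d" by blast
      then show ?thesis using eq by (simp add: walk_chain_iso[OF assms(1,2)] assms)
    qed (simp add: walk_chain_def)
  qed
qed

context covering
begin

text \<open>The images of a walk under \<open>f\<close> and \<open>f'\<close> start at the same
  vertex and have the same projection, so they are the same lift. Connectedness reaches every
  vertex, and a dart is determined by its source and its projection.\<close>

lemma morphism_unique:
  assumes con: "connected_graph \<Delta>" and f: "graph_morphism \<Delta> \<Delta> f" "graph_morphism \<Delta> \<Delta> f'"
    and over: "\<And>d. d \<in> darts \<Delta> \<Longrightarrow> snd p (snd f d) = snd p (snd f' d)"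
    and x: "x \<in> verts \<Delta>" "fst f x = fst f' x"
  shows "\<forall>z \<in> verts \<Delta>. fst f z = fst f' z" "\<forall>d \<in> darts \<Delta>. snd f d = snd f' d"
proof -
  show V: "\<forall>z \<in> verts \<Delta>. fst f z = fst f' z"
  proof
    fix z assume "z \<in> verts \<Delta>"
    then obtain \<delta> where \<delta>: "walk \<Delta> x \<delta> z" using con x by (auto simp: connected_graph_def)
    have w: "walk \<Delta> (fst f x) (map (snd f) \<delta>) (fst f z)" "walk \<Delta> (fst f x) (map (snd f') \<delta>) (fst f' z)"
      using morphism_walk[OF f(1) wf(1) \<delta>] morphism_walk[OF f(2) wf(1) \<delta>] x by auto
    moreover have "map (snd p) (map (snd f) \<delta>) = map (snd p) (map (snd f') \<delta>)"
      using over walk_darts[OF \<delta>] by auto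
    ultimately have "map (snd f) \<delta> = map (snd f') \<delta>" using walk_lift_unique by blast
    then show "fst f z = fst f' z" using w walk_end_unique by metis
  qed
  show "\<forall>d \<in> darts \<Delta>. snd f d = snd f' d"
  proof
    fix d assume d: "d \<in> darts \<Delta>"
    then have "src \<Delta> (snd f d) = src \<Delta> (snd f' d)"
      using V f wf_sgraphD(1)[OF wf(1) d] by (auto simp: graph_morphism_def)
    then show "snd f d = snd f' d"
      using d over f by (intro dart_unique) (auto simp: graph_morphism_def)
  qed
qed

end

locale homology_covering = covering \<Delta> \<Gamma> p
  for k :: nat and \<Gamma> :: "('w, 'e) sgraph" and v0 :: 'w and \<Delta> :: "('v, 'd) sgraph"
    and p :: "('v \<Rightarrow> 'w) \<times> ('d \<Rightarrow> 'e)" and x0 :: 'v +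
  assumes connected: "connected_graph \<Delta>"
    and x0: "x0 \<in> verts \<Delta>" "fst p x0 = v0"
    and closed_lift: "\<gamma> \<in> loops \<Gamma> v0 \<Longrightarrow> lifts_to \<Delta> p x0 \<gamma> x0 \<longleftrightarrow> walk_chain k \<Gamma> \<gamma> = (\<lambda>_. 0)"
begin

lemma lifts_to_between:
  assumes "x \<in> verts \<Delta>" "y \<in> verts \<Delta>"
  obtains \<gamma> where "lifts_to \<Delta> p x \<gamma> y"
  using connected assms unfolding connected_graph_def lifts_to_def by blast

lemma lifts_to_darts: "lifts_to \<Delta> p x \<gamma> y \<Longrightarrow> set \<gamma> \<subseteq> darts \<Gamma>"
  by (blast dest: lifts_to_walk walk_darts)

text \<open>\<open>closed_lift\<close> speaks only about loops lifted from \<open>x0\<close>. A walk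
  \<open>\<beta>\<close> from \<open>x0\<close> to \<open>x\<close> is prefixed to both walks, the
  second is run backwards, and the criterion is applied to the resulting loop; the chain of
  \<open>\<beta>\<close> cancels.\<close>

lemma lift_ends_eq_iff:
  assumes y: "lifts_to \<Delta> p x \<gamma> y" and z: "lifts_to \<Delta> p x \<delta> z" and yz: "fst p y = fst p z"
  shows "y = z \<longleftrightarrow> walk_chain k \<Gamma> \<gamma> = walk_chain k \<Gamma> \<delta>"
proof -
  obtain \<beta> where \<beta>: "lifts_to \<Delta> p x0 \<beta> x"
    using lifts_to_between x0(1) lifts_to_verts[OF y] by blast
  let ?\<omega> = "(\<beta> @ \<gamma>) @ inv_walk \<Gamma> (\<beta> @ \<delta>)"
  have y': "lifts_to \<Delta> p x0 (\<beta> @ \<gamma>) y" and z': "lifts_to \<Delta> p x0 (\<beta> @ \<delta>) z"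
    using \<beta> y z by (auto simp: lifts_to_append)
  note wy = lifts_to_walk[OF y'] and wz = lifts_to_walk[OF z']
  have "?\<omega> \<in> loops \<Gamma> v0"
    unfolding loops_def
    using walk_appendI[OF wf(2) wy, of "inv_walk \<Gamma> (\<beta> @ \<delta>)" v0] walk_inv_walk[OF wf(2) wz] yz x0
    by simp
  then have "lifts_to \<Delta> p x0 ?\<omega> x0 \<longleftrightarrow> walk_chain k \<Gamma> (\<beta> @ \<gamma>) = walk_chain k \<Gamma> (\<beta> @ \<delta>)"
    by (simp only: closed_lift walk_chain_eq_iff[OF wf(2) walk_darts[OF wz]])
  moreover have "lifts_to \<Delta> p x0 ?\<omega> x0 \<longleftrightarrow> y = z"
  proof
    assume "lifts_to \<Delta> p x0 ?\<omega> x0"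
    then have "lifts_to \<Delta> p y (inv_walk \<Gamma> (\<beta> @ \<delta>)) x0"
      unfolding lifts_to_append[of _ "\<beta> @ \<gamma>"] using lifts_to_unique y' by blast
    from lifts_to_inv_walk[OF this] have "lifts_to \<Delta> p x0 (\<beta> @ \<delta>) y"
      using inv_walk_inv_walk[OF wf(2) lifts_to_darts[OF z']] by simp
    then show "y = z" using z' lifts_to_unique by blast
  next
    assume "y = z"
    then show "lifts_to \<Delta> p x0 ?\<omega> x0"
      unfolding lifts_to_append[of _ "\<beta> @ \<gamma>"] using y' lifts_to_inv_walk[OF z'] by blast
  qed
  moreover have "walk_chain k \<Gamma> (\<beta> @ \<gamma>) d = walk_chain k \<Gamma> (\<beta> @ \<delta>) d \<longleftrightarrow>
      walk_chain k \<Gamma> \<gamma> d = walk_chain k \<Gamma> \<delta> d" for d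
  proof -
    have "walk_chain k \<Gamma> (\<beta> @ \<gamma>) d = walk_chain k \<Gamma> (\<beta> @ \<delta>) d \<longleftrightarrow>
      walk_chain k \<Gamma> \<gamma> d mod int k = walk_chain k \<Gamma> \<delta> d mod int k"
      unfolding walk_chain_append mod_eq_dvd_iff by simp
    then show ?thesis by simp
  qed
  ultimately show ?thesis by (simp add: fun_eq_iff)
qed

text \<open>Automorphisms preserve the kernel of the map to homology, so they all lift.\<close>

lemma lift_morphism:
  assumes \<alpha>: "graph_iso \<Gamma> \<Gamma> \<alpha>" and x: "x \<in> verts \<Delta>" and y: "y \<in> verts \<Delta>"
    and xy: "fst p y = fst \<alpha> (fst p x)"
  obtains f where "graph_morphism \<Delta> \<Delta> f" "fst f x = y"
    "\<And>z. z \<in> verts \<Delta> \<Longrightarrow> fst p (fst f z) = fst \<alpha> (fst p z)"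
    "\<And>d. d \<in> darts \<Delta> \<Longrightarrow> snd p (snd f d) = snd \<alpha> (snd p d)"
proof -
  have mor: "graph_morphism \<Gamma> \<Gamma> \<alpha>" using \<alpha> by (simp add: graph_iso_def)
  have ex: "\<exists>w. lifts_to \<Delta> p y (map (snd \<alpha>) \<gamma>) w \<and> fst p w = fst \<alpha> (fst p z)"
    if "lifts_to \<Delta> p x \<gamma> z" for \<gamma> z
    using lifts_to_exists[OF morphism_walk[OF mor wf(2) lifts_to_walk[OF that]] y] xy by simp
  \<comment> \<open>Well-definedness: walks with the same end have equal chains,
    \<open>\<alpha>\<close> keeps them equal, and equal chains with equal projected ends force equal
    ends.\<close>
  have un: "w = w'" if "lifts_to \<Delta> p x \<gamma> z" "lifts_to \<Delta> p x \<gamma>' z"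
    "lifts_to \<Delta> p y (map (snd \<alpha>) \<gamma>) w" "lifts_to \<Delta> p y (map (snd \<alpha>) \<gamma>') w'" for \<gamma> \<gamma>' z w w'
  proof -
    have "fst p w = fst p w'"
      using ex[OF that(1)] ex[OF that(2)] lifts_to_unique[OF that(3)] lifts_to_unique[OF that(4)] by auto
    moreover have "walk_chain k \<Gamma> \<gamma> = walk_chain k \<Gamma> \<gamma>'"
      using lift_ends_eq_iff[OF that(1,2)] by simp
    ultimately show ?thesis
      using lift_ends_eq_iff[OF that(3,4)] walk_chain_iso_eq_iff[OF \<alpha> wf(2)]
        lifts_to_darts[OF that(1)] lifts_to_darts[OF that(2)] by simp
  qed
  define fv where "fv z = (SOME w. \<exists>\<gamma>. lifts_to \<Delta> p x \<gamma> z \<and> lifts_to \<Delta> p y (map (snd \<alpha>) \<gamma>) w)" for z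
  have fv: "lifts_to \<Delta> p y (map (snd \<alpha>) \<gamma>) (fv z)" if g: "lifts_to \<Delta> p x \<gamma> z" for \<gamma> z
  proof -
    obtain w where w: "lifts_to \<Delta> p y (map (snd \<alpha>) \<gamma>) w" using ex[OF g] by blast
    then have "\<exists>\<gamma>. lifts_to \<Delta> p x \<gamma> z \<and> lifts_to \<Delta> p y (map (snd \<alpha>) \<gamma>) (fv z)"
      unfolding fv_def using g by (intro someI_ex[of "\<lambda>w. \<exists>\<gamma>. lifts_to \<Delta> p x \<gamma> z \<and> lifts_to \<Delta> p y (map (snd \<alpha>) \<gamma>) w"]) blast
    then have "fv z = w" using un[OF _ g _ w] by blast
    then show ?thesis using w by simp
  qed
  have fvV: "fv z \<in> verts \<Delta> \<and> fst p (fv z) = fst \<alpha> (fst p z)" if z: "z \<in> verts \<Delta>" for z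
  proof -
    obtain \<gamma> where g: "lifts_to \<Delta> p x \<gamma> z" using lifts_to_between[OF x z] .
    show ?thesis using ex[OF g] lifts_to_unique[OF fv[OF g]] lifts_to_verts[OF fv[OF g]] by auto
  qed
  have fvx: "fv x = y"
    using fv[of "[]" x] x by (simp add: lifts_to_def)
  define fd where "fd d = (SOME e. e \<in> darts \<Delta> \<and> src \<Delta> e = fv (src \<Delta> d) \<and> snd p e = snd \<alpha> (snd p d))" for d
  have fd: "fd d \<in> darts \<Delta> \<and> src \<Delta> (fd d) = fv (src \<Delta> d) \<and> snd p (fd d) = snd \<alpha> (snd p d)"
    if d: "d \<in> darts \<Delta>" for d
  proof -
    have "snd \<alpha> (snd p d) \<in> darts \<Gamma>" "src \<Gamma> (snd \<alpha> (snd p d)) = fst p (fv (src \<Delta> d))"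
      using mor p_darts[OF d] p_src[OF d] fvV wf_sgraphD(1)[OF wf(1) d] by (auto simp: graph_morphism_def)
    then show ?thesis
      unfolding fd_def using fvV wf_sgraphD(1)[OF wf(1) d]
      by (intro someI_ex[of "\<lambda>e. e \<in> darts \<Delta> \<and> src \<Delta> e = fv (src \<Delta> d) \<and> snd p e = snd \<alpha> (snd p d)"])
        (blast elim: dart_lift)
  qed
  \<comment> \<open>\<open>fv\<close> may be computed along any walk; for the target of
    \<open>d\<close>, a walk to the source of \<open>d\<close> is extended by
    \<open>d\<close>.\<close>
  have tgt: "tgt \<Delta> (fd d) = fv (tgt \<Delta> d)" if d: "d \<in> darts \<Delta>" for d
  proof -
    obtain \<gamma> where g: "lifts_to \<Delta> p x \<gamma> (src \<Delta> d)"
      using lifts_to_between[OF x wf_sgraphD(1)[OF wf(1) d]] .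
    have step: "lifts_to \<Delta> p (src \<Delta> e) [snd p e] (tgt \<Delta> e)" if "e \<in> darts \<Delta>" for e
      using that wf_sgraphD[OF wf(1) that] unfolding lifts_to_def by (intro exI[of _ "[e]"]) simp
    have "lifts_to \<Delta> p y (map (snd \<alpha>) (\<gamma> @ [snd p d])) (fv (tgt \<Delta> d))"
      using g step[OF d] by (intro fv) (auto simp: lifts_to_append)
    moreover have "lifts_to \<Delta> p y (map (snd \<alpha>) (\<gamma> @ [snd p d])) (tgt \<Delta> (fd d))"
      using fv[OF g] step[of "fd d"] fd[OF d] by (auto simp: lifts_to_append)
    ultimately show ?thesis using lifts_to_unique by blast
  qed
  have "opp \<Delta> (fd d) = fd (opp \<Delta> d)" if d: "d \<in> darts \<Delta>" for d
  proof (rule dart_unique)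
    note D = wf_sgraphD[OF wf(1) d]
    show "opp \<Delta> (fd d) \<in> darts \<Delta>" "fd (opp \<Delta> d) \<in> darts \<Delta>"
      using fd[OF d] fd[OF D(2)] wf_sgraphD[OF wf(1)] by auto
    show "src \<Delta> (opp \<Delta> (fd d)) = src \<Delta> (fd (opp \<Delta> d))"
      using fd[OF D(2)] tgt[OF d] by (simp add: src_opp)
    show "snd p (opp \<Delta> (fd d)) = snd p (fd (opp \<Delta> d))"
      using fd[OF d] fd[OF D(2)] p_opp[OF d] p_opp[of "fd d"] mor p_darts[OF d]
      by (auto simp: graph_morphism_def)
  qed
  then have "graph_morphism \<Delta> \<Delta> (fv, fd)"
    using fd fvV by (auto simp: graph_morphism_def)
  then show ?thesis using that[of "(fv, fd)"] fvx fvV fd by auto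
qed

text \<open>The inverse of \<open>\<alpha>\<close> also lifts, taking \<open>y\<close> back to
  \<open>x\<close>. Both composites cover the identity and fix a vertex, so they are the identity by
  uniqueness of lifts.\<close>

lemma lift_automorphism:
  assumes \<alpha>: "graph_iso \<Gamma> \<Gamma> \<alpha>" and x: "x \<in> verts \<Delta>" and y: "y \<in> verts \<Delta>"
    and xy: "fst p y = fst \<alpha> (fst p x)"
  obtains f where "is_lift \<Delta> p \<alpha> f" "fst f x = y"
proof -
  let ?\<alpha>' = "(inv_into (verts \<Gamma>) (fst \<alpha>), inv_into (darts \<Gamma>) (snd \<alpha>))"
  have \<alpha>': "graph_iso \<Gamma> \<Gamma> ?\<alpha>'" by (rule graph_iso_inverse[OF \<alpha> wf(2)])
  have V: "bij_betw (fst \<alpha>) (verts \<Gamma>) (verts \<Gamma>)" and D: "bij_betw (snd \<alpha>) (darts \<Gamma>) (darts \<Gamma>)"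
    using \<alpha> by (auto simp: graph_iso_def)
  have yx: "fst p x = fst ?\<alpha>' (fst p y)"
    using xy V p_verts[OF x] by (simp add: bij_betw_inv_into_left)
  obtain f where f: "graph_morphism \<Delta> \<Delta> f" "fst f x = y"
    "\<And>z. z \<in> verts \<Delta> \<Longrightarrow> fst p (fst f z) = fst \<alpha> (fst p z)"
    "\<And>d. d \<in> darts \<Delta> \<Longrightarrow> snd p (snd f d) = snd \<alpha> (snd p d)"
    using lift_morphism[OF \<alpha> x y xy] by blast
  obtain g where g: "graph_morphism \<Delta> \<Delta> g" "fst g y = x"
    "\<And>z. z \<in> verts \<Delta> \<Longrightarrow> fst p (fst g z) = fst ?\<alpha>' (fst p z)"
    "\<And>d. d \<in> darts \<Delta> \<Longrightarrow> snd p (snd g d) = snd ?\<alpha>' (snd p d)"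
    using lift_morphism[OF \<alpha>' y x yx] by blast
  have fd: "snd f d \<in> darts \<Delta>" and gd: "snd g d \<in> darts \<Delta>" if "d \<in> darts \<Delta>" for d
    using f(1) g(1) that by (auto simp: graph_morphism_def)
  have id: "graph_morphism \<Delta> \<Delta> (id, id)" by (simp add: graph_morphism_def)
  have gf: "\<forall>z \<in> verts \<Delta>. fst g (fst f z) = z" "\<forall>d \<in> darts \<Delta>. snd g (snd f d) = d"
    using morphism_unique[OF connected graph_morphism_compose[OF f(1) g(1)] id _ x] f g fd D p_darts
    by (auto simp: bij_betw_inv_into_left)
  have fg: "\<forall>z \<in> verts \<Delta>. fst f (fst g z) = z" "\<forall>d \<in> darts \<Delta>. snd f (snd g d) = d"
    using morphism_unique[OF connected graph_morphism_compose[OF g(1) f(1)] id _ y] f g gd D p_darts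
    by (auto simp: bij_betw_inv_into_right)
  have "bij_betw (fst f) (verts \<Delta>) (verts \<Delta>)"
    using gf(1) fg(1) f(1) g(1)
    by (intro bij_betw_byWitness[where f' = "fst g"]) (auto simp: graph_morphism_def)
  moreover have "bij_betw (snd f) (darts \<Delta>) (darts \<Delta>)"
    using gf(2) fg(2) f(1) g(1)
    by (intro bij_betw_byWitness[where f' = "snd g"]) (auto simp: graph_morphism_def)
  ultimately have "is_lift \<Delta> p \<alpha> f" using f by (simp add: is_lift_def graph_iso_def)
  then show ?thesis using that f(2) by blast
qed

definition chain_at :: "'v \<Rightarrow> 'e \<Rightarrow> int" where
  "chain_at x = walk_chain k \<Gamma> (SOME \<gamma>. lifts_to \<Delta> p x0 \<gamma> x)"

lemma chain_at_eq:
  assumes "lifts_to \<Delta> p x0 \<gamma> x"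
  shows "chain_at x = walk_chain k \<Gamma> \<gamma>"
proof -
  have "lifts_to \<Delta> p x0 (SOME \<gamma>. lifts_to \<Delta> p x0 \<gamma> x) x" using assms by (rule someI)
  from lift_ends_eq_iff[OF this assms] show ?thesis by (simp add: chain_at_def)
qed

end

section \<open>Existence of the homology cover\<close>

text \<open>The vertices of the homology cover are the walks from \<open>v0\<close>, where two walks with the same
  end are identified if they have the same chain.\<close>

locale homology_model =
  fixes k :: nat and \<Gamma> :: "('v, 'd) sgraph" and v0 :: 'v
  assumes wf: "wf_sgraph \<Gamma>" and connected: "connected_graph \<Gamma>" and v0: "v0 \<in> verts \<Gamma>"
begin

definition walk_class :: "'d list \<Rightarrow> 'd list set" where
  "walk_class \<gamma> = {\<delta>. \<exists>v. walk \<Gamma> v0 \<gamma> v \<and> walk \<Gamma> v0 \<delta> v \<and> walk_chain k \<Gamma> \<delta> = walk_chain k \<Gamma> \<gamma>}"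

definition class_end :: "'d list set \<Rightarrow> 'v" where
  "class_end C = (SOME v. \<exists>\<gamma> \<in> C. walk \<Gamma> v0 \<gamma> v)"

definition class_extend :: "'d list set \<Rightarrow> 'd \<Rightarrow> 'd list set" where
  "class_extend C d = walk_class ((SOME \<gamma>. \<gamma> \<in> C) @ [d])"

definition class_verts :: "'d list set set" where
  "class_verts = {walk_class \<gamma> | \<gamma> v. walk \<Gamma> v0 \<gamma> v}"

text \<open>With this choice the darts at a vertex correspond to the darts at its image, so the
  covering property is immediate; the work goes into \<open>opp\<close> being an involution.\<close>

definition class_graph :: "('d list set, 'd list set \<times> 'd) sgraph" where
  "class_graph = \<lparr>verts = class_verts,
     darts = {(C, d). C \<in> class_verts \<and> d \<in> darts \<Gamma> \<and> src \<Gamma> d = class_end C},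
     src = fst,
     opp = (\<lambda>(C, d). (class_extend C d, opp \<Gamma> d))\<rparr>"

lemma walk_class_eq:
  assumes "walk \<Gamma> v0 \<gamma> v"
  shows "walk_class \<gamma> = {\<delta>. walk \<Gamma> v0 \<delta> v \<and> walk_chain k \<Gamma> \<delta> = walk_chain k \<Gamma> \<gamma>}"
  unfolding walk_class_def using assms walk_end_unique[OF assms] by blast

lemma walk_class_eqI:
  "walk \<Gamma> v0 \<gamma> v \<Longrightarrow> walk \<Gamma> v0 \<delta> v \<Longrightarrow> walk_chain k \<Gamma> \<gamma> = walk_chain k \<Gamma> \<delta> \<Longrightarrow>
    walk_class \<gamma> = walk_class \<delta>"
  by (simp add: walk_class_eq)

lemma self_in_walk_class: "walk \<Gamma> v0 \<gamma> v \<Longrightarrow> \<gamma> \<in> walk_class \<gamma>"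
  by (simp add: walk_class_eq)

lemma class_end_walk_class:
  assumes "walk \<Gamma> v0 \<gamma> v"
  shows "class_end (walk_class \<gamma>) = v"
proof -
  have "\<exists>\<delta> \<in> walk_class \<gamma>. walk \<Gamma> v0 \<delta> v"
    using self_in_walk_class[OF assms] assms by blast
  moreover have "w = v" if "\<delta> \<in> walk_class \<gamma>" "walk \<Gamma> v0 \<delta> w" for \<delta> w
    using that(1) walk_end_unique[OF that(2)] by (auto simp: walk_class_eq[OF assms])
  ultimately show ?thesis unfolding class_end_def by (intro some_equality) blast+
qed

lemma class_extend_walk_class:
  assumes \<gamma>: "walk \<Gamma> v0 \<gamma> v" and d: "d \<in> darts \<Gamma>" "src \<Gamma> d = v"
  shows "class_extend (walk_class \<gamma>) d = walk_class (\<gamma> @ [d])"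
proof -
  define \<delta> where "\<delta> = (SOME \<delta>. \<delta> \<in> walk_class \<gamma>)"
  have "\<delta> \<in> walk_class \<gamma>" unfolding \<delta>_def using self_in_walk_class[OF \<gamma>] by (rule someI)
  then have \<delta>: "walk \<Gamma> v0 \<delta> v" "walk_chain k \<Gamma> \<delta> = walk_chain k \<Gamma> \<gamma>"
    by (auto simp: walk_class_eq[OF \<gamma>])
  have w: "walk \<Gamma> v [d] (tgt \<Gamma> d)" using d wf_sgraphD[OF wf d(1)] by simp
  show ?thesis
    unfolding class_extend_def \<delta>_def[symmetric]
    using walk_appendI[OF wf \<delta>(1) w] walk_appendI[OF wf \<gamma> w] \<delta>(2)
    by (intro walk_class_eqI) (auto simp: walk_chain_append fun_eq_iff)
qed

lemma walk_snoc:
  assumes "walk \<Gamma> v0 \<gamma> v" "d \<in> darts \<Gamma>" "src \<Gamma> d = v"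
  shows "walk \<Gamma> v0 (\<gamma> @ [d]) (tgt \<Gamma> d)"
  using assms wf_sgraphD[OF wf assms(2)] by (intro walk_appendI[OF wf assms(1)]) simp

lemma wf_class_graph: "wf_sgraph class_graph"
proof -
  have "class_extend C d \<in> class_verts \<and> class_end (class_extend C d) = src \<Gamma> (opp \<Gamma> d) \<and>
     class_extend (class_extend C d) (opp \<Gamma> d) = C"
    if "C \<in> class_verts" "d \<in> darts \<Gamma>" "src \<Gamma> d = class_end C" for C d
  proof -
    obtain \<gamma> v where \<gamma>: "C = walk_class \<gamma>" "walk \<Gamma> v0 \<gamma> v"
      using \<open>C \<in> class_verts\<close> by (auto simp: class_verts_def)
    then have d: "d \<in> darts \<Gamma>" "src \<Gamma> d = v" using that class_end_walk_class by auto
    note D = wf_sgraphD[OF wf d(1)]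
    have w: "walk \<Gamma> v0 (\<gamma> @ [d]) (tgt \<Gamma> d)" by (rule walk_snoc[OF \<gamma>(2) d])
    then have w2: "walk \<Gamma> v0 ((\<gamma> @ [d]) @ [opp \<Gamma> d]) v"
      using walk_snoc[OF w D(2)] D d by (simp add: src_opp)
    have e: "class_extend C d = walk_class (\<gamma> @ [d])"
      using class_extend_walk_class[OF \<gamma>(2) d] \<gamma>(1) by simp
    have "class_extend (walk_class (\<gamma> @ [d])) (opp \<Gamma> d) = walk_class ((\<gamma> @ [d]) @ [opp \<Gamma> d])"
      using class_extend_walk_class[OF w D(2)] by (simp add: src_opp)
    \<comment> \<open>A backtrack does not change the chain, so reversing twice leads back to the
      same class.\<close>
    also have "\<dots> = walk_class \<gamma>"
      using w2 \<gamma>(2) walk_chain_backtrack[OF wf d(1)]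
      by (intro walk_class_eqI) (auto simp: walk_chain_append fun_eq_iff)
    finally show ?thesis
      using e w \<gamma>(1) class_end_walk_class[OF w] by (auto simp: class_verts_def src_opp)
  qed
  then show ?thesis
    using wf_sgraphD[OF wf] by (auto simp: wf_sgraph_def class_graph_def)
qed

lemma covering_class_graph: "graph_covering class_graph \<Gamma> (class_end, snd)"
proof -
  have end_verts: "class_end C \<in> verts \<Gamma>" if "C \<in> class_verts" for C
    using that class_end_walk_class walk_verts[OF wf] by (auto simp: class_verts_def)
  have "verts \<Gamma> \<subseteq> class_end ` class_verts"
  proof
    fix v assume "v \<in> verts \<Gamma>"
    then obtain \<gamma> where "walk \<Gamma> v0 \<gamma> v" using connected v0 by (auto simp: connected_graph_def)
    then show "v \<in> class_end ` class_verts"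
      using class_end_walk_class by (force simp: class_verts_def)
  qed
  moreover have "bij_betw snd {d \<in> darts class_graph. src class_graph d = C}
      {d \<in> darts \<Gamma>. src \<Gamma> d = class_end C}" if "C \<in> class_verts" for C
    using that by (intro bij_betw_byWitness[where f' = "\<lambda>d. (C, d)"]) (auto simp: class_graph_def)
  ultimately show ?thesis
    using wf wf_class_graph end_verts
    by (auto simp: graph_covering_def graph_morphism_def class_graph_def)
qed

text \<open>The lift of a walk runs through the classes of its initial segments.\<close>

lemma lifts_to_class_graph:
  "walk \<Gamma> v0 \<gamma> v \<Longrightarrow> lifts_to class_graph (class_end, snd) (walk_class []) \<gamma> (walk_class \<gamma>)"
proof (induction \<gamma> arbitrary: v rule: rev_induct)
  case Nil
  have "walk \<Gamma> v0 [] v0" using v0 by simp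
  then have "walk_class [] \<in> verts class_graph"
    by (auto simp: class_graph_def class_verts_def simp del: walk.simps)
  then show ?case by (auto simp: lifts_to_def intro!: exI[of _ "[]"])
next
  case (snoc d \<gamma>)
  interpret covering class_graph \<Gamma> "(class_end, snd)"
    by standard (rule covering_class_graph)
  obtain u where u: "walk \<Gamma> v0 \<gamma> u" "d \<in> darts \<Gamma>" "src \<Gamma> d = u"
    using snoc.prems by (auto simp: walk_append_iff[OF wf(2)])
  have "(walk_class \<gamma>, d) \<in> darts class_graph"
    using u class_end_walk_class[OF u(1)] by (auto simp: class_graph_def class_verts_def)
  moreover have "tgt class_graph (walk_class \<gamma>, d) = walk_class (\<gamma> @ [d])"
    using class_extend_walk_class[OF u] by (simp add: tgt_def class_graph_def)
  ultimately have "walk class_graph (walk_class \<gamma>) [(walk_class \<gamma>, d)] (walk_class (\<gamma> @ [d]))"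
    using wf_sgraphD(5)[OF wf_class_graph, of "(walk_class \<gamma>, d)"] by (simp add: class_graph_def)
  then have "lifts_to class_graph (class_end, snd) (walk_class \<gamma>) [d] (walk_class (\<gamma> @ [d]))"
    unfolding lifts_to_def by (intro exI[of _ "[(walk_class \<gamma>, d)]"]) (simp del: walk.simps)
  then show ?case using snoc.IH[OF u(1)] by (auto simp: lifts_to_append)
qed

lemma homology_cover_class_graph: "homology_cover k \<Gamma> v0 class_graph (class_end, snd)"
proof -
  interpret covering class_graph \<Gamma> "(class_end, snd)"
    by standard (rule covering_class_graph)
  have base: "walk \<Gamma> v0 [] v0" using v0 by simp
  then have base': "walk_class [] \<in> verts class_graph" by (auto simp: class_graph_def class_verts_def simp del: walk.simps)
  have conn: "\<exists>\<delta>. walk class_graph (walk_class []) \<delta> C" if "C \<in> verts class_graph" for C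
    using that lifts_to_class_graph by (force simp: class_graph_def class_verts_def lifts_to_def)
  have "connected_graph class_graph"
    unfolding connected_graph_def
  proof (intro conjI ballI)
    fix C D assume "C \<in> verts class_graph" "D \<in> verts class_graph"
    then show "\<exists>\<gamma>. walk class_graph C \<gamma> D"
      using conn walk_inv_walk[OF wf_class_graph] walk_appendI[OF wf_class_graph] by meson
  qed (use base' in blast)
  moreover have "lifts_to class_graph (class_end, snd) (walk_class []) \<gamma> (walk_class []) \<longleftrightarrow>
      walk_chain k \<Gamma> \<gamma> = (\<lambda>_. 0)" if "\<gamma> \<in> loops \<Gamma> v0" for \<gamma>
  proof -
    have \<gamma>: "walk \<Gamma> v0 \<gamma> v0" using that by (simp add: loops_def)
    have "lifts_to class_graph (class_end, snd) (walk_class []) \<gamma> (walk_class []) \<longleftrightarrow>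
      walk_class \<gamma> = walk_class []"
    proof
      assume "lifts_to class_graph (class_end, snd) (walk_class []) \<gamma> (walk_class [])"
      from lifts_to_unique[OF lifts_to_class_graph[OF \<gamma>] this]
      show "walk_class \<gamma> = walk_class []" .
    next
      assume "walk_class \<gamma> = walk_class []"
      with lifts_to_class_graph[OF \<gamma>]
      show "lifts_to class_graph (class_end, snd) (walk_class []) \<gamma> (walk_class [])" by simp
    qed
    also have "\<dots> \<longleftrightarrow> walk_chain k \<Gamma> \<gamma> = walk_chain k \<Gamma> []"
      using walk_class_eqI[OF \<gamma> base] self_in_walk_class[OF \<gamma>]
      by (auto simp: walk_class_eq[OF base])
    finally show ?thesis by simp
  qed
  ultimately show ?thesis
    unfolding homology_cover_iff using covering_class_graph base' class_end_walk_class[OF base]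
    by auto
qed

end


section \<open>Infinite cubes\<close>

text \<open>\<open>L2_set\<close> vanishes on infinite sets, so this is a distance only between functions that differ
  at finitely many places.\<close>

definition fin_dist :: "('w \<Rightarrow> real) \<Rightarrow> ('w \<Rightarrow> real) \<Rightarrow> real" where
  "fin_dist x y = L2_set (\<lambda>w. x w - y w) {w. x w \<noteq> y w}"

lemma fin_dist_eq_L2_set:
  assumes "finite J" "\<And>w. w \<notin> J \<Longrightarrow> x w = y w"
  shows "fin_dist x y = L2_set (\<lambda>w. x w - y w) J"
  unfolding fin_dist_def L2_set_def using assms
  by (intro arg_cong[where f = sqrt] sum.mono_neutral_left) auto

lemma fin_dist_nonneg [simp]: "0 \<le> fin_dist x y"
  by (simp add: fin_dist_def)

lemma fin_dist_self [simp]: "fin_dist x x = 0"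
  by (simp add: fin_dist_def)

lemma fin_dist_commute: "fin_dist x y = fin_dist y x"
proof -
  have "{w. x w \<noteq> y w} = {w. y w \<noteq> x w}" by auto
  then show ?thesis
    unfolding fin_dist_def L2_set_def by (simp add: power2_commute[of "x w" "y w" for w])
qed

definition cube_chart :: "('w \<Rightarrow> real) \<Rightarrow> 'w set \<Rightarrow> ('w \<Rightarrow> real) \<Rightarrow> 'w \<Rightarrow> real" where
  "cube_chart b J u = (\<lambda>w. if w \<in> J then u w else b w)"

text \<open>Only the cubes that contain the vertex \<open>b\<close> are listed. Every other cube has
  finitely many fixed coordinates different from those of \<open>b\<close> and is a face of a listed
  one.\<close>

definition infinite_cube :: "'w set \<Rightarrow> ('w \<Rightarrow> real) \<Rightarrow> ('w, 'w \<Rightarrow> real) cubes" where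
  "infinite_cube W b = {(J, cube_chart b J) | J. finite J \<and> J \<subseteq> W}"

definition infinite_cube_points :: "'w set \<Rightarrow> ('w \<Rightarrow> real) \<Rightarrow> ('w \<Rightarrow> real) set" where
  "infinite_cube_points W b =
     {z. finite {w. z w \<noteq> b w} \<and> {w. z w \<noteq> b w} \<subseteq> W \<and> (\<forall>w \<in> W. 0 \<le> z w \<and> z w \<le> 1)}"

text \<open>The distance of two points given by barycentric coordinates in a triangle depends only
  on the side lengths; \<open>s\<close>, \<open>t\<close>, \<open>u\<close> are differences of such
  coordinates, hence the sum 0. It is applied to real numbers, one coordinate of the cube at a time,
  and to the comparison triangle in the plane.\<close>

lemma norm_combination_square:
  fixes P Q R :: "'a :: real_inner" and s t u :: real
  assumes "s + t + u = 0"
  shows "(norm (s *\<^sub>R P + t *\<^sub>R Q + u *\<^sub>R R))\<^sup>2 =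
    - (s * t * (dist P Q)\<^sup>2 + t * u * (dist Q R)\<^sup>2 + u * s * (dist R P)\<^sup>2)"
proof -
  have u: "u = - s - t" using assms by simp
  show ?thesis
    unfolding u dist_norm power2_norm_eq_inner
    by (simp add: inner_commute algebra_simps)
qed

locale cube_base =
  fixes W :: "'w set" and b :: "'w \<Rightarrow> real"
  assumes base01: "w \<in> W \<Longrightarrow> b w \<in> {0, 1}"
begin

abbreviation "K \<equiv> infinite_cube W b"
abbreviation "P \<equiv> infinite_cube_points W b"

lemma base_in_points: "b \<in> P"
proof -
  have "0 \<le> b w \<and> b w \<le> 1" if "w \<in> W" for w
    using base01[OF that] by auto
  then show ?thesis by (simp add: infinite_cube_points_def)
qed

lemma chart_in_points:
  assumes "finite J" "J \<subseteq> W" "u \<in> unit_cube J"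
  shows "cube_chart b J u \<in> P"
proof -
  have "{w. cube_chart b J u w \<noteq> b w} \<subseteq> J"
    by (auto simp: cube_chart_def)
  moreover have "0 \<le> cube_chart b J u w \<and> cube_chart b J u w \<le> 1" if "w \<in> W" for w
    using base01[OF that] PiE_mem[OF assms(3)[unfolded unit_cube_def], of w]
    by (auto simp: cube_chart_def)
  ultimately show ?thesis
    using assms(1,2) by (auto simp: infinite_cube_points_def intro: finite_subset)
qed

lemma point_in_chart:
  assumes "z \<in> P" "finite J" "J \<subseteq> W" "{w. z w \<noteq> b w} \<subseteq> J"
  shows "restrict z J \<in> unit_cube J" "cube_chart b J (restrict z J) = z"
proof -
  show "restrict z J \<in> unit_cube J"
    using assms(1,3) by (auto simp: infinite_cube_points_def unit_cube_def)
  show "cube_chart b J (restrict z J) = z"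
    using assms(4) by (force simp: cube_chart_def)
qed

lemma cc_points_infinite_cube: "cc_points K = P"
proof
  show "cc_points K \<subseteq> P"
    using chart_in_points by (auto simp: cc_points_def infinite_cube_def)
  show "P \<subseteq> cc_points K"
  proof
    fix z assume z: "z \<in> P"
    let ?J = "{w. z w \<noteq> b w}"
    have J: "finite ?J" "?J \<subseteq> W" using z by (auto simp: infinite_cube_points_def)
    then have "(?J, cube_chart b ?J) \<in> K" by (auto simp: infinite_cube_def)
    with point_in_chart[OF z J order_refl] show "z \<in> cc_points K"
      unfolding cc_points_def by (metis (no_types, lifting) UN_I imageI old.prod.case)
  qed
qed

lemma cube_dist_chart:
  assumes "finite J" "u \<in> unit_cube J" "v \<in> unit_cube J"
  shows "cube_dist J u v = fin_dist (cube_chart b J u) (cube_chart b J v)"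
proof -
  have "fin_dist (cube_chart b J u) (cube_chart b J v)
    = L2_set (\<lambda>w. cube_chart b J u w - cube_chart b J v w) J"
    using assms by (intro fin_dist_eq_L2_set) (auto simp: cube_chart_def)
  then show ?thesis by (simp add: cube_dist_def cube_chart_def cong: L2_set_cong)
qed

text \<open>Finitely many points lie in one finite-dimensional cube, which reduces metric statements
  to sums over a single finite set \<open>J\<close>.\<close>

lemma common_support:
  assumes "finite Z" "Z \<subseteq> P"
  shows "\<exists>J. finite J \<and> J \<subseteq> W \<and> (\<forall>z\<in>Z. {w. z w \<noteq> b w} \<subseteq> J)"
proof (intro exI conjI ballI)
  let ?J = "\<Union>z\<in>Z. {w. z w \<noteq> b w}"
  show "finite ?J" "?J \<subseteq> W" using assms by (auto simp: infinite_cube_points_def)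
qed blast

lemma fin_dist_support:
  assumes "finite J" "{w. x w \<noteq> b w} \<subseteq> J" "{w. y w \<noteq> b w} \<subseteq> J"
  shows "fin_dist x y = L2_set (\<lambda>w. x w - y w) J"
  using assms(1)
proof (rule fin_dist_eq_L2_set)
  fix w assume "w \<notin> J"
  then have "x w = b w" "y w = b w" using assms(2,3) by blast+
  then show "x w = y w" by simp
qed

lemma fin_dist_square_support:
  assumes "finite J" "{w. x w \<noteq> b w} \<subseteq> J" "{w. y w \<noteq> b w} \<subseteq> J"
  shows "(fin_dist x y)\<^sup>2 = (\<Sum>w\<in>J. (x w - y w)\<^sup>2)"
  using fin_dist_support[OF assms] by (simp add: L2_set_def sum_nonneg)

lemma fin_dist_triangle:
  assumes "x \<in> P" "y \<in> P" "z \<in> P"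
  shows "fin_dist x z \<le> fin_dist x y + fin_dist y z"
proof -
  obtain J where J: "finite J" "\<forall>v \<in> {x, y, z}. {w. v w \<noteq> b w} \<subseteq> J"
    using common_support[of "{x, y, z}"] assms by blast
  have "fin_dist v v' = L2_set (\<lambda>w. v w - v' w) J" if "v \<in> {x, y, z}" "v' \<in> {x, y, z}" for v v'
    using J that by (intro fin_dist_support) blast+
  moreover have "L2_set (\<lambda>w. x w - z w) J \<le> L2_set (\<lambda>w. x w - y w) J + L2_set (\<lambda>w. y w - z w) J"
    using L2_set_triangle_ineq[of "\<lambda>w. x w - y w" "\<lambda>w. y w - z w" J] by simp
  ultimately show ?thesis by simp
qed

lemma fin_dist_eq_0:
  assumes "x \<in> P" "y \<in> P"
  shows "fin_dist x y = 0 \<longleftrightarrow> x = y"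
proof
  obtain J where J: "finite J" "\<forall>v \<in> {x, y}. {w. v w \<noteq> b w} \<subseteq> J"
    using common_support[of "{x, y}"] assms by blast
  then have x: "{w. x w \<noteq> b w} \<subseteq> J" and y: "{w. y w \<noteq> b w} \<subseteq> J" by blast+
  assume "fin_dist x y = 0"
  then have "x w = y w" if "w \<in> J" for w
    using that J(1) fin_dist_support[OF J(1) x y] L2_set_eq_0_iff[OF J(1)] by auto
  moreover have "x w = y w" if "w \<notin> J" for w
  proof -
    have "x w = b w" "y w = b w" using J(2) that by blast+
    then show ?thesis by simp
  qed
  ultimately show "x = y" by (intro ext) blast
qed simp

section \<open>The intrinsic metric of the infinite cube\<close>

lemma cc_string_points: "cc_string K x y l \<Longrightarrow> x \<in> P \<and> y \<in> P"
proof (induction rule: cc_string.induct)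
  case (step x \<phi> u l J v)
  then have "\<phi> v \<in> cc_points K" by (force simp: cc_points_def)
  then show ?case using step by (simp add: cc_points_infinite_cube)
qed (simp add: cc_points_infinite_cube)

lemma cc_string_ge_fin_dist: "cc_string K x y l \<Longrightarrow> fin_dist x y \<le> l"
proof (induction rule: cc_string.induct)
  case (step x \<phi> u l J v)
  then have J: "finite J" "J \<subseteq> W" and \<phi>: "\<phi> = cube_chart b J"
    by (auto simp: infinite_cube_def)
  have "fin_dist x (\<phi> v) \<le> fin_dist x (\<phi> u) + fin_dist (\<phi> u) (\<phi> v)"
    using step cc_string_points[OF step(1)] chart_in_points J \<phi>
    by (intro fin_dist_triangle) auto
  then show ?case using step cube_dist_chart J \<phi> by force
qed simp

lemma cc_string_fin_dist:
  assumes "x \<in> P" "y \<in> P"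
  shows "cc_string K x y (fin_dist x y)"
proof -
  obtain J where J: "finite J" "J \<subseteq> W" "\<forall>v \<in> {x, y}. {w. v w \<noteq> b w} \<subseteq> J"
    using common_support[of "{x, y}"] assms by blast
  then have "{w. x w \<noteq> b w} \<subseteq> J" "{w. y w \<noteq> b w} \<subseteq> J" by blast+
  note x = point_in_chart[OF assms(1) J(1,2) this(1)]
    and y = point_in_chart[OF assms(2) J(1,2) this(2)]
  have K: "(J, cube_chart b J) \<in> K" using J by (auto simp: infinite_cube_def)
  have "cc_string K x (cube_chart b J (restrict x J)) 0"
    using assms x by (simp add: cc_string.start cc_points_infinite_cube)
  from cc_string.step[OF this K x(1) y(1)] show ?thesis
    using J(1) x y by (simp add: cube_dist_chart)
qed

text \<open>No string is shorter than the Euclidean distance, by the triangle inequality, and a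
  common cube provides a string of exactly this length. The value off the complex is recorded
  because \<open>Metric_space\<close> demands nonnegativity and symmetry everywhere.\<close>

lemma cc_dist_infinite_cube:
  "cc_dist K x y = (if x \<in> P \<and> y \<in> P then fin_dist x y else 0)"
proof (cases "x \<in> P \<and> y \<in> P")
  case True
  then have "Inf {l. cc_string K x y l} = fin_dist x y"
    using cc_string_ge_fin_dist cc_string_fin_dist by (intro cInf_eq_minimum) auto
  then show ?thesis using True cc_string_fin_dist by (auto simp: cc_dist_def)
next
  case False
  then show ?thesis using cc_string_points unfolding cc_dist_def by metis
qed

lemma Metric_space_infinite_cube: "Metric_space P (cc_dist K)"
  by unfold_locales
    (auto simp: cc_dist_infinite_cube fin_dist_eq_0 fin_dist_triangle fin_dist_commute)

section \<open>Gluing of the cubes along faces\<close>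

lemma chart_eq_iff:
  assumes "u \<in> unit_cube J" "v \<in> unit_cube J"
  shows "cube_chart b J u = cube_chart b J v \<longleftrightarrow> u = v"
proof
  assume "cube_chart b J u = cube_chart b J v"
  then have "u w = v w" if "w \<in> J" for w
    using that by (auto simp: cube_chart_def fun_eq_iff split: if_splits)
  then show "u = v" using assms by (auto simp: unit_cube_def intro: PiE_ext)
qed simp

lemma restrict_chart_in_unit_cube:
  assumes "J \<subseteq> W" "J' \<subseteq> W" "u \<in> unit_cube J"
  shows "restrict (cube_chart b J u) J' \<in> unit_cube J'"
proof -
  have "cube_chart b J u w \<in> {0..1}" if "w \<in> W" for w
    using base01[OF that] PiE_mem[OF assms(3)[unfolded unit_cube_def], of w]
    by (auto simp: cube_chart_def)
  then show ?thesis using assms(2) by (auto simp: unit_cube_def)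
qed

lemma cubical_complex_infinite_cube: "cubical_complex K"
proof -
  have inj: "finite J \<and> inj_on \<phi> (unit_cube J)" if "(J, \<phi>) \<in> K" for J \<phi>
    using that by (auto simp: infinite_cube_def inj_on_def chart_eq_iff)
  have glue: "\<exists>F F' h. cube_face J F \<and> cube_face J' F' \<and> cube_isometry J F J' F' h \<and>
           (\<forall>u \<in> unit_cube J. \<forall>u' \<in> unit_cube J'. \<phi> u = \<phi>' u' \<longleftrightarrow> u \<in> F \<and> u' = h u)"
    if "(J, \<phi>) \<in> K" "(J', \<phi>') \<in> K" for J \<phi> J' \<phi>'
  proof -
    from that have J: "finite J" "J \<subseteq> W" "\<phi> = cube_chart b J"
      and J': "finite J'" "J' \<subseteq> W" "\<phi>' = cube_chart b J'"
      by (auto simp: infinite_cube_def)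
    \<comment> \<open>Two listed cubes overlap, in \<open>b\<close> at least, where the coordinates
      that the other one lacks agree with \<open>b\<close>. This is a face because \<open>b\<close>
      takes the values 0 and 1 on \<open>W\<close>. The gluing map \<open>h\<close> drops the
      coordinates in \<open>J - J'\<close> and fills in \<open>b\<close> on
      \<open>J' - J\<close>.\<close>
    define F where "F = {u \<in> unit_cube J. \<forall>w \<in> J - J'. u w = b w}"
    define F' where "F' = {u \<in> unit_cube J'. \<forall>w \<in> J' - J. u w = b w}"
    define h where "h u = restrict (cube_chart b J u) J'" for u
    have face: "cube_face J F"
      unfolding cube_face_def F_def using base01 J(2)
      by (intro exI[of _ "J - J'"] exI[of _ b]) auto
    have face': "cube_face J' F'"
      unfolding cube_face_def F'_def using base01 J'(2)
      by (intro exI[of _ "J' - J"] exI[of _ b]) auto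
    have hcube: "h u \<in> unit_cube J'" if "u \<in> unit_cube J" for u
      using restrict_chart_in_unit_cube[OF J(2) J'(2) that] by (simp add: h_def)
    have iff: "\<phi> u = \<phi>' u' \<longleftrightarrow> u \<in> F \<and> u' = h u"
      if u: "u \<in> unit_cube J" and u': "u' \<in> unit_cube J'" for u u'
    proof
      assume eq: "\<phi> u = \<phi>' u'"
      have "u w = b w" if "w \<in> J - J'" for w
        using fun_cong[OF eq, of w] that J J' by (simp add: cube_chart_def)
      then have "u \<in> F" using u by (simp add: F_def)
      moreover have "cube_chart b J' u' w = h u w" if "w \<in> J'" for w
        using fun_cong[OF eq, of w] that J J' by (simp add: h_def)
      then have "u' w = h u w" if "w \<in> J'" for w
        using that by (simp add: cube_chart_def)
      then have "u' = h u"
        using PiE_ext[OF u'[unfolded unit_cube_def] hcube[OF u, unfolded unit_cube_def]] by blast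
      ultimately show "u \<in> F \<and> u' = h u" ..
    next
      assume "u \<in> F \<and> u' = h u"
      then show "\<phi> u = \<phi>' u'" using J J' by (auto simp: F_def h_def cube_chart_def fun_eq_iff)
    qed
    have \<phi>h: "\<phi> u = \<phi>' (h u)" if "u \<in> F" for u
      using that iff[of u "h u"] hcube by (auto simp: F_def)
    have hF: "h u \<in> F'" if "u \<in> F" for u
    proof -
      have "h u w = b w" if "w \<in> J' - J" for w
        using that by (auto simp: h_def cube_chart_def)
      then show ?thesis using hcube that by (simp add: F_def F'_def)
    qed
    have "cube_isometry J F J' F' h"
      unfolding cube_isometry_def
    proof (intro conjI ballI)
      show "bij_betw h F F'"
      proof (intro bij_betw_imageI subset_antisym subsetI)
        show "inj_on h F"
        proof (rule inj_onI)
          fix u v assume uv: "u \<in> F" "v \<in> F" "h u = h v"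
          then have "\<phi> u = \<phi> v" using \<phi>h by metis
          then show "u = v" using uv J(3) by (auto simp: F_def chart_eq_iff)
        qed
        show "u' \<in> F'" if "u' \<in> h ` F" for u' using that hF by auto
        show "u' \<in> h ` F" if u': "u' \<in> F'" for u'
        proof -
          let ?u = "restrict (cube_chart b J' u') J"
          have u: "?u \<in> unit_cube J"
            using restrict_chart_in_unit_cube[OF J'(2) J(2)] u' by (auto simp: F'_def)
          moreover have "\<phi> ?u = \<phi>' u'"
            using u' J J' by (auto simp: F'_def cube_chart_def fun_eq_iff)
          ultimately show ?thesis using iff[OF u] u' by (auto simp: F'_def)
        qed
      qed
      \<comment> \<open>Both sides are the distance of the same two points of the complex.\<close>
      show "cube_dist J' (h u) (h v) = cube_dist J u v" if "u \<in> F" "v \<in> F" for u v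
        using that cube_dist_chart[OF J(1), of u v] cube_dist_chart[OF J'(1), of "h u" "h v"]
          hcube \<phi>h J(3) J'(3) by (simp add: F_def)
    qed
    then show ?thesis
      by (intro exI[of _ F] exI[of _ F'] exI[of _ h] conjI ballI face face' iff)
  qed
  have "\<forall>(J, \<phi>) \<in> K. finite J \<and> inj_on \<phi> (unit_cube J)"
    using inj by blast
  moreover have "\<forall>(J, \<phi>) \<in> K. \<forall>(J', \<phi>') \<in> K.
      \<exists>F F' h. cube_face J F \<and> cube_face J' F' \<and> cube_isometry J F J' F' h \<and>
           (\<forall>u \<in> unit_cube J. \<forall>u' \<in> unit_cube J'. \<phi> u = \<phi>' u' \<longleftrightarrow> u \<in> F \<and> u' = h u)"
    by (intro ballI, clarify, rule glue)
  ultimately show ?thesis unfolding cubical_complex_def by (simp add: case_prod_beta)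
qed

section \<open>Geodesics and comparison triangles\<close>

lemma geodesic_point:
  assumes "p \<in> P" "q \<in> P" "geodesic_segment P (cc_dist K) p q g" "x \<in> g"
  obtains s where "0 \<le> s" "s \<le> 1" "x \<in> P" "fin_dist p x = s * fin_dist p q"
    "\<And>w. x w = (1 - s) * p w + s * q w"
proof -
  let ?d = "fin_dist p q"
  have pq: "cc_dist K p q = ?d" using assms by (simp add: cc_dist_infinite_cube)
  obtain c where c: "g = c ` {0..?d}" "g \<subseteq> P" "c 0 = p" "c ?d = q"
    "\<forall>s \<in> {0..?d}. \<forall>t \<in> {0..?d}. cc_dist K (c s) (c t) = \<bar>s - t\<bar>"
    using assms(3) unfolding geodesic_segment_def pq by blast
  then obtain t where t: "0 \<le> t" "t \<le> ?d" "x = c t" using assms(4) by auto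
  have x: "x \<in> P" using c(2) assms(4) by blast
  have px: "fin_dist p x = t"
    using c(5)[rule_format, of 0 t] t c(3) x assms(1) by (simp add: cc_dist_infinite_cube)
  have xq: "fin_dist x q = ?d - t"
    using c(5)[rule_format, of t ?d] t c(4) x assms(2) by (simp add: cc_dist_infinite_cube)
  show ?thesis
  proof (cases "?d = 0")
    case True
    then have "p = q" "p = x" using px t fin_dist_eq_0 x assms by auto
    then show ?thesis using x True by (intro that[of 0]) auto
  next
    case False
    define s where "s = t / ?d"
    have d: "?d > 0" using False fin_dist_nonneg[of p q] by linarith
    have ts: "t = s * ?d" using False by (simp add: s_def)
    obtain J where J: "finite J" "\<forall>v \<in> {p, q, x}. {w. v w \<noteq> b w} \<subseteq> J"
      using common_support[of "{p, q, x}"] assms x by blast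
    then have "{w. p w \<noteq> b w} \<subseteq> J" "{w. q w \<noteq> b w} \<subseteq> J" "{w. x w \<noteq> b w} \<subseteq> J" by blast+
    note dist = fin_dist_square_support[OF J(1) this(1,2)] fin_dist_square_support[OF J(1) this(1,3)]
      fin_dist_square_support[OF J(1) this(3,2)]
    \<comment> \<open>Stewart's identity in each coordinate. In the sum, the distances
      \<open>s * ?d\<close> and \<open>(1 - s) * ?d\<close> of \<open>x\<close> from the ends make
      the right side vanish, which forces \<open>x\<close> onto the straight segment; so every
      geodesic is straight.\<close>
    have pw: "(x w - ((1 - s) * p w + s * q w))\<^sup>2 =
      (1 - s) * (p w - x w)\<^sup>2 + s * (x w - q w)\<^sup>2 - s * (1 - s) * (p w - q w)\<^sup>2" for w
      by (simp add: power2_eq_square algebra_simps)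
    have "(\<Sum>w\<in>J. (x w - ((1 - s) * p w + s * q w))\<^sup>2) =
      (1 - s) * (fin_dist p x)\<^sup>2 + s * (fin_dist x q)\<^sup>2 - s * (1 - s) * ?d\<^sup>2"
      unfolding dist pw by (simp add: sum.distrib sum_subtractf sum_distrib_left)
    also have "\<dots> = 0"
      unfolding px xq ts by (simp add: power2_eq_square algebra_simps)
    finally have J0: "\<forall>w\<in>J. (x w - ((1 - s) * p w + s * q w))\<^sup>2 = 0"
      using J(1) by (subst (asm) sum_nonneg_eq_0_iff) auto
    have "x w = (1 - s) * p w + s * q w" for w
    proof (cases "w \<in> J")
      case False
      then have "p w = b w" "q w = b w" "x w = b w" using J(2) by blast+
      then show ?thesis by (simp add: algebra_simps)
    qed (use J0 in auto)
    moreover have "0 \<le> s" "s \<le> 1" using t d by (auto simp: s_def)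
    ultimately show ?thesis using px ts x by (intro that[of s]) auto
  qed
qed

lemma comparison_point_combination:
  fixes X PP QQ :: "real^2"
  assumes "p \<in> P" "q \<in> P" "geodesic_segment P (cc_dist K) p q g"
    and "dist PP QQ = cc_dist K p q" "comparison_point (cc_dist K) p g PP QQ x X"
  obtains s where "x \<in> P" "\<And>w. x w = (1 - s) * p w + s * q w"
    "X = (1 - s) *\<^sub>R PP + s *\<^sub>R QQ"
proof -
  have x: "x \<in> g" "X \<in> closed_segment PP QQ" "dist PP X = cc_dist K p x"
    using assms(5) by (auto simp: comparison_point_def)
  obtain s where s: "0 \<le> s" "s \<le> 1" "x \<in> P" "fin_dist p x = s * fin_dist p q"
    "\<And>w. x w = (1 - s) * p w + s * q w"
    using geodesic_point[OF assms(1-3) x(1)] by metis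
  obtain u where u: "0 \<le> u" "u \<le> 1" "X = (1 - u) *\<^sub>R PP + u *\<^sub>R QQ"
    using x(2) by (auto simp: closed_segment_def)
  have "PP - X = u *\<^sub>R (PP - QQ)" unfolding u(3) by (simp add: algebra_simps)
  then have "dist PP X = u * dist PP QQ" using u by (simp add: dist_norm)
  moreover have "dist PP X = s * fin_dist p q" "dist PP QQ = fin_dist p q"
    using x(3) s(3,4) assms(1,2,4) by (simp_all add: cc_dist_infinite_cube)
  \<comment> \<open>If the comparison side is a single point, the parameter of \<open>X\<close> is
    undetermined, but every parameter gives the same \<open>X\<close>.\<close>
  ultimately have "u = s \<or> PP = QQ"
    by (metis mult_right_cancel dist_eq_0_iff)
  then have "X = (1 - s) *\<^sub>R PP + s *\<^sub>R QQ" unfolding u(3) by (auto simp: algebra_simps)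
  with s show ?thesis by (intro that)
qed

text \<open>The same barycentric coordinates in two triangles with equal sides give the same
  distance, since both are one expression in the side lengths. So the CAT(0) inequality holds here
  with equality.\<close>

lemma fin_dist_eq_comparison_dist:
  fixes PP QQ RR :: "real^2"
  assumes mem: "p \<in> P" "q \<in> P" "r \<in> P" "x \<in> P" "y \<in> P"
    and dist: "dist PP QQ = fin_dist p q" "dist QQ RR = fin_dist q r" "dist RR PP = fin_dist r p"
    and sum1: "\<alpha> + \<beta> + \<gamma> = 1" "\<alpha>' + \<beta>' + \<gamma>' = 1"
    and x: "\<And>w. x w = \<alpha> * p w + \<beta> * q w + \<gamma> * r w"
    and y: "\<And>w. y w = \<alpha>' * p w + \<beta>' * q w + \<gamma>' * r w"
    and X: "X = \<alpha> *\<^sub>R PP + \<beta> *\<^sub>R QQ + \<gamma> *\<^sub>R RR"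
    and Y: "Y = \<alpha>' *\<^sub>R PP + \<beta>' *\<^sub>R QQ + \<gamma>' *\<^sub>R RR"
  shows "fin_dist x y = dist X Y"
proof -
  obtain J where J: "finite J" "\<forall>v \<in> {p, q, r, x, y}. {w. v w \<noteq> b w} \<subseteq> J"
    using common_support[of "{p, q, r, x, y}"] mem by blast
  have sq: "(fin_dist v v')\<^sup>2 = (\<Sum>w\<in>J. (v w - v' w)\<^sup>2)"
    if "v \<in> {p, q, r, x, y}" "v' \<in> {p, q, r, x, y}" for v v'
    using J that by (intro fin_dist_square_support) blast+
  define s t u where "s = \<alpha> - \<alpha>'" and "t = \<beta> - \<beta>'" and "u = \<gamma> - \<gamma>'"
  have stu: "s + t + u = 0" using sum1 by (simp add: s_def t_def u_def)
  have "(x w - y w)\<^sup>2 =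
    - (s * t * (p w - q w)\<^sup>2 + t * u * (q w - r w)\<^sup>2 + u * s * (r w - p w)\<^sup>2)" for w
  proof -
    have "x w - y w = s *\<^sub>R p w + t *\<^sub>R q w + u *\<^sub>R r w"
      unfolding x y by (simp add: s_def t_def u_def algebra_simps)
    then show ?thesis
      using norm_combination_square[OF stu, of "p w" "q w" "r w"] by (simp add: dist_real_def)
  qed
  then have "(fin_dist x y)\<^sup>2 =
    - (s * t * (fin_dist p q)\<^sup>2 + t * u * (fin_dist q r)\<^sup>2 + u * s * (fin_dist r p)\<^sup>2)"
    by (simp add: sq sum.distrib sum_negf sum_distrib_left sum_subtractf)
  also have "\<dots> = (norm (s *\<^sub>R PP + t *\<^sub>R QQ + u *\<^sub>R RR))\<^sup>2"
    using norm_combination_square[OF stu, of PP QQ RR] by (simp add: dist)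
  also have "s *\<^sub>R PP + t *\<^sub>R QQ + u *\<^sub>R RR = X - Y"
    unfolding X Y by (simp add: s_def t_def u_def algebra_simps)
  finally show ?thesis by (simp add: dist_norm)
qed

lemma geodesic_infinite_cube:
  assumes "p \<in> P" "q \<in> P"
  shows "\<exists>g. geodesic_segment P (cc_dist K) p q g"
proof -
  let ?d = "fin_dist p q"
  \<comment> \<open>For \<open>?d = 0\<close> the quotient \<open>t / ?d\<close> is 0 by convention,
    and \<open>c\<close> is the constant path at \<open>p = q\<close>.\<close>
  define c where "c t = (\<lambda>w. p w + t / ?d * (q w - p w))" for t
  obtain J where J: "finite J" "J \<subseteq> W" "\<forall>v \<in> {p, q}. {w. v w \<noteq> b w} \<subseteq> J"
    using common_support[of "{p, q}"] assms by blast
  have cJ: "{w. c t w \<noteq> b w} \<subseteq> J" for t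
  proof
    fix w assume "w \<in> {w. c t w \<noteq> b w}"
    then have "\<not> (p w = b w \<and> q w = b w)" by (auto simp: c_def)
    then show "w \<in> J" using J(3) by blast
  qed
  have c01: "0 \<le> c t w \<and> c t w \<le> 1" if "t \<in> {0..?d}" "w \<in> W" for t w
  proof -
    have "c t w = (1 - t / ?d) * p w + t / ?d * q w"
      by (simp add: c_def algebra_simps diff_divide_distrib)
    moreover have "0 \<le> t / ?d" "t / ?d \<le> 1" using that fin_dist_nonneg[of p q] by (auto simp: divide_le_eq)
    moreover have "p w \<in> {0..1}" "q w \<in> {0..1}"
      using assms that by (auto simp: infinite_cube_points_def)
    ultimately show ?thesis
      using convexD_alt[of "{0..1::real}" "p w" "q w" "t / ?d"] by auto
  qed
  have cP: "c t \<in> P" if "t \<in> {0..?d}" for t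
    using c01[OF that] cJ[of t] J(1,2) finite_subset[OF cJ J(1)]
    by (simp add: infinite_cube_points_def subset_trans[OF cJ J(2)])
  have "fin_dist (c s) (c t) = \<bar>s - t\<bar>" if "s \<in> {0..?d}" "t \<in> {0..?d}" for s t
  proof (cases "?d = 0")
    case True
    then show ?thesis using that by simp
  next
    case False
    have "fin_dist (c s) (c t) = L2_set (\<lambda>w. c s w - c t w) J"
      by (rule fin_dist_support[OF J(1) cJ cJ])
    also have "\<dots> = L2_set (\<lambda>w. \<bar>s - t\<bar> / ?d * (p w - q w)) J"
      unfolding L2_set_def c_def
      by (simp add: power_mult_distrib power_divide flip: left_diff_distrib diff_divide_distrib)
        (simp add: power2_commute)
    also have "\<dots> = \<bar>s - t\<bar> / ?d * L2_set (\<lambda>w. p w - q w) J"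
      by (rule L2_set_right_distrib[symmetric]) simp
    also have "L2_set (\<lambda>w. p w - q w) J = ?d"
      by (rule fin_dist_support[symmetric]) (use J in blast)+
    finally show ?thesis using False by simp
  qed
  moreover have "c 0 = p" by (simp add: c_def)
  moreover have "c ?d = q"
    using fin_dist_eq_0[OF assms] by (cases "?d = 0") (auto simp: c_def)
  ultimately have "geodesic_segment P (cc_dist K) p q (c ` {0..?d})"
    unfolding geodesic_segment_def using cP assms
    by (intro exI[of _ c]) (auto simp: cc_dist_infinite_cube)
  then show ?thesis by blast
qed

lemma CAT0_infinite_cube: "CAT0_space P (cc_dist K)"
  unfolding CAT0_space_def
proof (intro conjI ballI allI impI, goal_cases)
  case (3 p q r g1 g2 g3 PP QQ RR)
  then have mem: "p \<in> P" "q \<in> P" "r \<in> P" by simp_all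
  have geo: "geodesic_segment P (cc_dist K) p q g1" "geodesic_segment P (cc_dist K) q r g2"
    "geodesic_segment P (cc_dist K) r p g3" and
    dist: "dist PP QQ = cc_dist K p q" "dist QQ RR = cc_dist K q r" "dist RR PP = cc_dist K r p"
    using 3 by simp_all
  define comp where "comp x X \<longleftrightarrow> comparison_point (cc_dist K) p g1 PP QQ x X \<or>
    comparison_point (cc_dist K) q g2 QQ RR x X \<or> comparison_point (cc_dist K) r g3 RR PP x X"
    for x X
  \<comment> \<open>A point on a side has barycentric coordinates, one of them 0. In this form all
    pairs of sides, equal ones included, are treated alike.\<close>
  have bary: "x \<in> P \<and> (\<exists>\<alpha> \<beta> \<gamma>. \<alpha> + \<beta> + \<gamma> = 1 \<and> (\<forall>w. x w = \<alpha> * p w + \<beta> * q w + \<gamma> * r w) \<and>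
    X = \<alpha> *\<^sub>R PP + \<beta> *\<^sub>R QQ + \<gamma> *\<^sub>R RR)" if "comp x X" for x X
    using that unfolding comp_def
  proof (elim disjE)
    assume "comparison_point (cc_dist K) p g1 PP QQ x X"
    from comparison_point_combination[OF mem(1,2) geo(1) dist(1) this]
    obtain s where "x \<in> P" "\<And>w. x w = (1 - s) * p w + s * q w" "X = (1 - s) *\<^sub>R PP + s *\<^sub>R QQ"
      by metis
    then show ?thesis by (intro conjI exI[of _ "1 - s"] exI[of _ s] exI[of _ 0]) auto
  next
    assume "comparison_point (cc_dist K) q g2 QQ RR x X"
    from comparison_point_combination[OF mem(2,3) geo(2) dist(2) this]
    obtain s where "x \<in> P" "\<And>w. x w = (1 - s) * q w + s * r w" "X = (1 - s) *\<^sub>R QQ + s *\<^sub>R RR"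
      by metis
    then show ?thesis by (intro conjI exI[of _ 0] exI[of _ "1 - s"] exI[of _ s]) auto
  next
    assume "comparison_point (cc_dist K) r g3 RR PP x X"
    from comparison_point_combination[OF mem(3,1) geo(3) dist(3) this]
    obtain s where "x \<in> P" "\<And>w. x w = (1 - s) * r w + s * p w" "X = (1 - s) *\<^sub>R RR + s *\<^sub>R PP"
      by metis
    then show ?thesis by (intro conjI exI[of _ s] exI[of _ 0] exI[of _ "1 - s"]) auto
  qed
  have "cc_dist K x y \<le> dist X Y" if xX: "comp x X" and yY: "comp y Y" for x X y Y
  proof -
    obtain \<alpha> \<beta> \<gamma> where x: "x \<in> P" "\<alpha> + \<beta> + \<gamma> = 1" "\<And>w. x w = \<alpha> * p w + \<beta> * q w + \<gamma> * r w"
      "X = \<alpha> *\<^sub>R PP + \<beta> *\<^sub>R QQ + \<gamma> *\<^sub>R RR" using bary[OF xX] by blast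
    obtain \<alpha>' \<beta>' \<gamma>' where y: "y \<in> P" "\<alpha>' + \<beta>' + \<gamma>' = 1"
      "\<And>w. y w = \<alpha>' * p w + \<beta>' * q w + \<gamma>' * r w"
      "Y = \<alpha>' *\<^sub>R PP + \<beta>' *\<^sub>R QQ + \<gamma>' *\<^sub>R RR" using bary[OF yY] by blast
    have "fin_dist x y = dist X Y"
      using dist mem
      by (intro fin_dist_eq_comparison_dist[OF mem x(1) y(1) _ _ _ x(2) y(2) x(3) y(3) x(4) y(4)])
       (simp_all add: cc_dist_infinite_cube)
    then show ?thesis using x(1) y(1) by (simp add: cc_dist_infinite_cube)
  qed
  then show ?case unfolding Let_def comp_def by blast
qed (use Metric_space_infinite_cube geodesic_infinite_cube in auto)

lemma CAT0_cubical_complex_infinite_cube: "CAT0_cubical_complex K"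
  unfolding CAT0_cubical_complex_def cc_connected_def cc_points_infinite_cube
  using cubical_complex_infinite_cube CAT0_infinite_cube base_in_points cc_string_fin_dist by blast

section \<open>Cubical maps given by permutations of the coordinates\<close>

lemma fin_dist_permute:
  assumes \<pi>: "bij_betw \<pi> W W" and x: "x \<in> P" and y: "y \<in> P"
    and x': "\<And>w. w \<in> W \<Longrightarrow> x' w = x (\<pi> w)" and y': "\<And>w. w \<in> W \<Longrightarrow> y' w = y (\<pi> w)"
    and off: "\<And>w. w \<notin> W \<Longrightarrow> x' w = y' w"
  shows "fin_dist x' y' = fin_dist x y"
proof -
  have sub: "{w. x w \<noteq> y w} \<subseteq> W"
  proof
    fix w assume "w \<in> {w. x w \<noteq> y w}"
    then have "\<not> (x w = b w \<and> y w = b w)" by auto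
    then show "w \<in> W" using x y by (auto simp: infinite_cube_points_def)
  qed
  have "bij_betw \<pi> {w. x' w \<noteq> y' w} {w. x w \<noteq> y w}"
  proof (rule bij_betw_subset[OF \<pi>])
    show "{w. x' w \<noteq> y' w} \<subseteq> W" using off by blast
    show "\<pi> ` {w. x' w \<noteq> y' w} = {w. x w \<noteq> y w}"
    proof (intro subset_antisym subsetI)
      fix v assume "v \<in> \<pi> ` {w. x' w \<noteq> y' w}"
      then obtain w where w: "v = \<pi> w" "x' w \<noteq> y' w" by blast
      then have "w \<in> W" using off by blast
      then show "v \<in> {w. x w \<noteq> y w}" using w x' y' by simp
    next
      fix v assume v: "v \<in> {w. x w \<noteq> y w}"
      then obtain w where "w \<in> W" "v = \<pi> w" using sub \<pi> by (auto simp: bij_betw_def)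
      then show "v \<in> \<pi> ` {w. x' w \<noteq> y' w}" using v x' y' by auto
    qed
  qed
  then have "(\<Sum>w | x' w \<noteq> y' w. (x (\<pi> w) - y (\<pi> w))\<^sup>2) = (\<Sum>w | x w \<noteq> y w. (x w - y w)\<^sup>2)"
    by (rule sum.reindex_bij_betw)
  moreover have "(\<Sum>w | x' w \<noteq> y' w. (x (\<pi> w) - y (\<pi> w))\<^sup>2) = (\<Sum>w | x' w \<noteq> y' w. (x' w - y' w)\<^sup>2)"
  proof (rule sum.cong)
    fix w assume "w \<in> {w. x' w \<noteq> y' w}"
    then have "w \<in> W" using off by blast
    then show "(x (\<pi> w) - y (\<pi> w))\<^sup>2 = (x' w - y' w)\<^sup>2" using x' y' by simp
  qed simp
  ultimately show ?thesis by (simp add: fin_dist_def L2_set_def)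
qed

text \<open>A permutation of infinitely many coordinates could lead infinitely far away from
  \<open>b\<close>. By \<open>fin\<close> it moves \<open>b\<close> only a finite distance, and then
  the same holds for every point at finite distance from \<open>b\<close>.\<close>

lemma permute_in_points:
  assumes \<pi>: "bij_betw \<pi> W W" and fin: "finite {w \<in> W. b (\<pi> w) \<noteq> b w}" and z: "z \<in> P"
  shows "(\<lambda>w. if w \<in> W then z (\<pi> w) else b w) \<in> P"
proof -
  have "finite (inv_into W \<pi> ` {w. z w \<noteq> b w} \<union> {w \<in> W. b (\<pi> w) \<noteq> b w})"
    using fin z by (auto simp: infinite_cube_points_def)
  moreover have "{w \<in> W. z (\<pi> w) \<noteq> b w} \<subseteq>
    inv_into W \<pi> ` {w. z w \<noteq> b w} \<union> {w \<in> W. b (\<pi> w) \<noteq> b w}"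
  proof
    fix w assume w: "w \<in> {w \<in> W. z (\<pi> w) \<noteq> b w}"
    then have "w = inv_into W \<pi> (\<pi> w)"
      using \<pi> by (simp add: bij_betw_inv_into_left)
    then show "w \<in> inv_into W \<pi> ` {w. z w \<noteq> b w} \<union> {w \<in> W. b (\<pi> w) \<noteq> b w}"
      using w by (cases "z (\<pi> w) = b (\<pi> w)") auto
  qed
  ultimately have "finite {w \<in> W. z (\<pi> w) \<noteq> b w}" by (rule finite_subset[rotated])
  moreover have "{w. (if w \<in> W then z (\<pi> w) else b w) \<noteq> b w} = {w \<in> W. z (\<pi> w) \<noteq> b w}"
    by auto
  moreover have "0 \<le> z (\<pi> w) \<and> z (\<pi> w) \<le> 1" if "w \<in> W" for w
    using z that \<pi> by (auto simp: infinite_cube_points_def bij_betw_def)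
  ultimately show ?thesis by (simp add: infinite_cube_points_def)
qed

text \<open>The permuted cube need not contain \<open>b\<close>, so it may be a proper face of a
  listed cube. Its free coordinates are \<open>I\<close>; the finitely many others in which
  \<open>b \<circ> \<pi>\<close> and \<open>b\<close> differ are added to form \<open>J'\<close> and
  are held fixed.\<close>

lemma cubical_map_permute:
  assumes \<pi>: "bij_betw \<pi> W W" and fin: "finite {w \<in> W. b (\<pi> w) \<noteq> b w}"
    and f: "\<And>z. z \<in> P \<Longrightarrow> f z = (\<lambda>w. if w \<in> W then z (\<pi> w) else b w)"
  shows "cubical_map K f"
proof -
  have "\<exists>(J', \<phi>') \<in> K. \<exists>F' h. cube_face J' F' \<and>
        cube_isometry J (unit_cube J) J' F' h \<and> (\<forall>u \<in> unit_cube J. f (\<phi> u) = \<phi>' (h u))"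
    if JK: "(J, \<phi>) \<in> K" for J \<phi>
  proof -
    from JK have J: "finite J" "J \<subseteq> W" "\<phi> = cube_chart b J" by (auto simp: infinite_cube_def)
    define I where "I = {w \<in> W. \<pi> w \<in> J}"
    define J' where "J' = I \<union> {w \<in> W. b (\<pi> w) \<noteq> b w}"
    have "I \<subseteq> inv_into W \<pi> ` J"
    proof
      fix w assume w: "w \<in> I"
      then have "w = inv_into W \<pi> (\<pi> w)" using \<pi> by (simp add: I_def bij_betw_inv_into_left)
      then show "w \<in> inv_into W \<pi> ` J" using w by (auto simp: I_def)
    qed
    then have J': "finite J'" "J' \<subseteq> W"
      using fin J(1) by (auto simp: J'_def I_def intro: finite_subset)
    have J'K: "(J', cube_chart b J') \<in> K" using J' by (auto simp: infinite_cube_def)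
    define F' where "F' = {u \<in> unit_cube J'. \<forall>w \<in> J' - I. u w = b (\<pi> w)}"
    define h where "h u = restrict (f (\<phi> u)) J'" for u
    have \<pi>W: "\<pi> w \<in> W" if "w \<in> W" for w using \<pi> that by (auto simp: bij_betw_def)
    have face: "cube_face J' F'"
      unfolding cube_face_def F'_def using base01 \<pi>W J'(2)
      by (intro exI[of _ "J' - I"] exI[of _ "b \<circ> \<pi>"]) auto
    have fP: "\<phi> u \<in> P" "f (\<phi> u) \<in> P" if "u \<in> unit_cube J" for u
      using permute_in_points[OF \<pi> fin, of "\<phi> u"] chart_in_points[OF J(1,2) that] f J(3) by auto
    have supp: "{w. f (\<phi> u) w \<noteq> b w} \<subseteq> J'" if u: "u \<in> unit_cube J" for u
      using f[OF fP(1)[OF u]] J(3) by (auto simp: J'_def I_def cube_chart_def split: if_splits)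
    note pc = point_in_chart[OF fP(2) J' supp]
    have fh: "f (\<phi> u) = cube_chart b J' (h u)" if u: "u \<in> unit_cube J" for u
      using pc(2)[OF u u] by (simp add: h_def)
    have hcube: "h u \<in> unit_cube J'" if u: "u \<in> unit_cube J" for u
      using pc(1)[OF u u] by (simp add: h_def)
    have hF: "h u \<in> F'" if u: "u \<in> unit_cube J" for u
    proof -
      have "h u w = b (\<pi> w)" if w: "w \<in> J' - I" for w
        using f[OF fP(1)[OF u]] w J' J(3) by (auto simp: h_def I_def cube_chart_def)
      then show ?thesis using hcube[OF u] by (simp add: F'_def)
    qed
    have iso: "cube_dist J' (h u) (h v) = cube_dist J u v"
      if u: "u \<in> unit_cube J" and v: "v \<in> unit_cube J" for u v
    proof -
      have "cube_dist J' (h u) (h v) = fin_dist (f (\<phi> u)) (f (\<phi> v))"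
        using cube_dist_chart[OF J'(1) hcube[OF u] hcube[OF v]] fh u v by simp
      also have "\<dots> = fin_dist (\<phi> u) (\<phi> v)"
        by (rule fin_dist_permute[OF \<pi> fP(1)[OF u] fP(1)[OF v]])
          (simp_all add: f fP(1)[OF u] fP(1)[OF v])
      finally show ?thesis using cube_dist_chart[OF J(1) u v] J(3) by simp
    qed
    have "bij_betw h (unit_cube J) F'"
    proof (intro bij_betw_imageI subset_antisym subsetI)
      show "inj_on h (unit_cube J)"
      proof (rule inj_onI)
        fix u v assume uv: "u \<in> unit_cube J" "v \<in> unit_cube J" "h u = h v"
        then have "cube_dist J u v = 0" using iso[OF uv(1,2)] by (simp add: cube_dist_def L2_set_def)
        then have "\<phi> u = \<phi> v"
          using cube_dist_chart[OF J(1) uv(1,2)] fin_dist_eq_0 fP uv J(3) by simp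
        then show "u = v" using uv J(3) chart_eq_iff by simp
      qed
      show "u' \<in> F'" if "u' \<in> h ` unit_cube J" for u' using that hF by auto
      show "u' \<in> h ` unit_cube J" if u': "u' \<in> F'" for u'
      proof -
        \<comment> \<open>The candidate preimage of \<open>u'\<close> takes over its free
          coordinates along the inverse of \<open>\<pi>\<close>.\<close>
        define u where "u = restrict (\<lambda>w. u' (inv_into W \<pi> w)) J"
        have mem: "u' w \<in> {0..1}" if "w \<in> J'" for w
          using u' that by (auto simp: F'_def unit_cube_def)
        have inv: "inv_into W \<pi> w \<in> W" "\<pi> (inv_into W \<pi> w) = w" if "w \<in> W" for w
          using \<pi> that by (auto simp: bij_betw_def inv_into_into f_inv_into_f)
        have "inv_into W \<pi> w \<in> I" if "w \<in> J" for w
          using inv[of w] that J(2) by (auto simp: I_def)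
        then have u: "u \<in> unit_cube J"
          using mem by (fastforce simp: u_def unit_cube_def J'_def)
        have "h u w = u' w" if w: "w \<in> J'" for w
        proof (cases "w \<in> I")
          case True
          then have "w \<in> W" "\<pi> w \<in> J" by (auto simp: I_def)
          then show ?thesis using w f[OF fP(1)[OF u]] J(3) \<pi>
            by (simp add: h_def cube_chart_def u_def bij_betw_inv_into_left)
        next
          case False
          then have "h u w = b (\<pi> w)" using hF[OF u] w by (simp add: F'_def)
          then show ?thesis using u' w False by (simp add: F'_def)
        qed
        moreover have "u' \<in> unit_cube J'" using u' by (simp add: F'_def)
        ultimately have "h u = u'"
          using PiE_ext[OF hcube[OF u, unfolded unit_cube_def] _, of u'] by (simp add: unit_cube_def)
        then show ?thesis using u by blast
      qed
    qed
    then have "cube_isometry J (unit_cube J) J' F' h"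
      using iso by (simp add: cube_isometry_def)
    then show ?thesis using J'K face fh by blast
  qed
  then show ?thesis unfolding cubical_map_def by blast
qed

end


section \<open>The cubization of a Cayley graph\<close>

lemma (in group) wf_Cay: "A \<subseteq> carrier G \<Longrightarrow> wf_sgraph (Cay G A)"
  by (auto simp: wf_sgraph_def Cay_def)

lemma Cay_simps [simp]:
  "verts (Cay G A) = carrier G" "darts (Cay G A) = carrier G \<times> A \<times> UNIV"
  "src (Cay G A) (g, a, c) = (if c then g else g \<otimes>\<^bsub>G\<^esub> a)"
  "tgt (Cay G A) (g, a, c) = (if c then g \<otimes>\<^bsub>G\<^esub> a else g)"
  "opp (Cay G A) (g, a, c) = (g, a, \<not> c)"
  by (auto simp: Cay_def tgt_def)

lemma (in group) connected_Cay:
  assumes A: "A \<subseteq> carrier G" and S: "symmetric_generating_set G S" "letters G S A"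
  shows "connected_graph (Cay G A)"
proof -
  note wf = wf_Cay[OF A]
  have S_walk: "\<exists>\<gamma>. walk (Cay G A) u \<gamma> (u \<otimes> s)" if "s \<in> S" "u \<in> carrier G" for s u
  proof -
    have s: "s \<in> carrier G" using S(1) that by (auto simp: symmetric_generating_set_def)
    show ?thesis
    proof (cases "s \<in> A")
      case True
      then show ?thesis using that s by (intro exI[of _ "[(u, s, True)]"]) simp
    next
      case False
      then have "inv s \<in> A" using S(2) that by (auto simp: letters_def)
      \<comment> \<open>The edge that issues from \<open>u \<otimes> s\<close> with the letter
        \<open>inv s\<close> is traversed backwards.\<close>
      then show ?thesis using that s
        by (intro exI[of _ "[(u \<otimes> s, inv s, False)]"]) (simp add: m_assoc)
    qed
  qed
  have walk: "\<exists>\<gamma>. walk (Cay G A) u \<gamma> (u \<otimes> h)" if "h \<in> generate G S" "u \<in> carrier G" for h u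
    using that
  proof (induction arbitrary: u)
    case one
    then show ?case by (intro exI[of _ "[]"]) simp
  next
    case (incl h)
    then show ?case by (rule S_walk)
  next
    case (inv h)
    then show ?case using S(1) by (intro S_walk) (auto simp: symmetric_generating_set_def)
  next
    case (eng h1 h2)
    have h: "h1 \<in> carrier G" "h2 \<in> carrier G"
      using S(1) eng.hyps by (auto simp: symmetric_generating_set_def)
    obtain \<gamma> where "walk (Cay G A) u \<gamma> (u \<otimes> h1)" using eng by blast
    moreover obtain \<delta> where "walk (Cay G A) (u \<otimes> h1) \<delta> ((u \<otimes> h1) \<otimes> h2)"
      using eng.IH(2)[of "u \<otimes> h1"] eng.prems h by auto
    ultimately have "walk (Cay G A) u (\<gamma> @ \<delta>) (u \<otimes> (h1 \<otimes> h2))"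
      using walk_appendI[OF wf] eng.prems h by (simp add: m_assoc)
    then show ?case by blast
  qed
  show ?thesis
    unfolding connected_graph_def
  proof (intro conjI ballI)
    fix v w assume "v \<in> verts (Cay G A)" "w \<in> verts (Cay G A)"
    then have vw: "v \<in> carrier G" "w \<in> carrier G" by simp_all
    then have "inv v \<otimes> w \<in> generate G S" using S(1) by (simp add: symmetric_generating_set_def)
    from walk[OF this vw(1)] show "\<exists>\<gamma>. walk (Cay G A) v \<gamma> w" using vw by (simp add: m_assoc[symmetric])
  qed auto
qed

lemma (in group) left_mult_iso:
  assumes "g \<in> carrier G" "A \<subseteq> carrier G"
  shows "graph_iso (Cay G A) (Cay G A) (left_mult G g)"
proof -
  have "bij_betw (fst (left_mult G g)) (carrier G) (carrier G)"
    using assms by (intro bij_betw_byWitness[where f' = "\<lambda>h. inv g \<otimes> h"])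
      (auto simp: left_mult_def m_assoc[symmetric])
  moreover have "bij_betw (snd (left_mult G g)) (carrier G \<times> A \<times> UNIV) (carrier G \<times> A \<times> UNIV)"
    using assms by (intro bij_betw_byWitness[where f' = "\<lambda>(h, a, c). (inv g \<otimes> h, a, c)"])
      (auto simp: left_mult_def m_assoc[symmetric])
  moreover have "graph_morphism (Cay G A) (Cay G A) (left_mult G g)"
    using assms by (auto simp: graph_morphism_def left_mult_def m_assoc)
  ultimately show ?thesis by (simp add: graph_iso_def)
qed

text \<open>Elements of the cubization are extensional functions; a lift obtained from the covering
  becomes one after restriction.\<close>

lemma is_lift_restrict:
  assumes wf: "wf_sgraph \<Delta>" and f: "is_lift \<Delta> p \<alpha> f"
  shows "is_lift \<Delta> p \<alpha> (restrict (fst f) (verts \<Delta>), restrict (snd f) (darts \<Delta>))"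
  using f wf_sgraphD[OF wf] unfolding is_lift_def graph_iso_def graph_morphism_def
  by (auto cong: bij_betw_cong)

lemma is_lift_verts: "is_lift \<Delta> p \<alpha> f \<Longrightarrow> x \<in> verts \<Delta> \<Longrightarrow> fst f x \<in> verts \<Delta>"
  and is_lift_darts: "is_lift \<Delta> p \<alpha> f \<Longrightarrow> d \<in> darts \<Delta> \<Longrightarrow> snd f d \<in> darts \<Delta>"
  by (auto simp: is_lift_def graph_iso_def graph_morphism_def)

locale cayley_homology_cover = group G + homology_covering k "Cay G A" "\<one>\<^bsub>G\<^esub>" \<Delta> p x0
  for G :: "('g, 'm) monoid_scheme" (structure) and k :: nat and A :: "'g set"
    and \<Delta> :: "('v, 'd) sgraph" and p :: "('v \<Rightarrow> 'g) \<times> ('d \<Rightarrow> 'g \<times> 'g \<times> bool)" and x0 :: 'v +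
  assumes A: "A \<subseteq> carrier G" "finite A" and k: "1 < k"
begin

section \<open>The cubization is simply transitive on the vertices of the cover\<close>

definition H :: "(('v \<Rightarrow> 'v) \<times> ('d \<Rightarrow> 'd)) monoid" where
  "H = cubization G \<Delta> p"

text \<open>For a lift this is the element of \<open>G\<close> that is lifted: it can be read off at
  \<open>x0\<close>, which lies over the identity.\<close>

definition deg :: "('v \<Rightarrow> 'v) \<times> ('d \<Rightarrow> 'd) \<Rightarrow> 'g" where
  "deg f = fst p (fst f x0)"

lemma carrier_H:
  "carrier H = {f \<in> Bij (verts \<Delta>) \<times> Bij (darts \<Delta>). \<exists>g \<in> carrier G. is_lift \<Delta> p (left_mult G g) f}"
  by (simp add: H_def cubization_def)

lemma deg_eq: "is_lift \<Delta> p (left_mult G g) f \<Longrightarrow> g \<in> carrier G \<Longrightarrow> deg f = g"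
  using x0 by (simp add: deg_def is_lift_def left_mult_def)

lemma H_lift:
  assumes "f \<in> carrier H"
  shows "deg f \<in> carrier G" "is_lift \<Delta> p (left_mult G (deg f)) f"
  using assms deg_eq by (auto simp: carrier_H)

lemma H_verts [simp]: "f \<in> carrier H \<Longrightarrow> x \<in> verts \<Delta> \<Longrightarrow> fst f x \<in> verts \<Delta>"
  using is_lift_verts H_lift(2) by metis

lemma H_darts [simp]: "f \<in> carrier H \<Longrightarrow> d \<in> darts \<Delta> \<Longrightarrow> snd f d \<in> darts \<Delta>"
  using is_lift_darts H_lift(2) by metis

lemma H_morphism: "f \<in> carrier H \<Longrightarrow> graph_morphism \<Delta> \<Delta> f"
  using H_lift(2) by (auto simp: is_lift_def graph_iso_def)

lemma H_p_verts: "f \<in> carrier H \<Longrightarrow> x \<in> verts \<Delta> \<Longrightarrow> fst p (fst f x) = deg f \<otimes> fst p x"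
  using H_lift(2)[of f] by (simp add: is_lift_def left_mult_def)

lemma H_p_darts: "f \<in> carrier H \<Longrightarrow> d \<in> darts \<Delta> \<Longrightarrow> snd p (snd f d) = snd (left_mult G (deg f)) (snd p d)"
  using H_lift(2)[of f] by (simp add: is_lift_def)

lemma p_verts_carrier [simp]: "x \<in> verts \<Delta> \<Longrightarrow> fst p x \<in> carrier G"
  using p_verts by simp

lemma H_transitive:
  assumes "x \<in> verts \<Delta>" "y \<in> verts \<Delta>"
  obtains f where "f \<in> carrier H" "fst f x = y"
proof -
  \<comment> \<open>The only left multiplication that takes the image of \<open>x\<close> to the
    image of \<open>y\<close>.\<close>
  let ?g = "fst p y \<otimes> inv (fst p x)"
  have g: "?g \<in> carrier G" using assms by simp
  have "fst p y = fst (left_mult G ?g) (fst p x)"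
    using assms by (simp add: left_mult_def m_assoc)
  then obtain f where f: "is_lift \<Delta> p (left_mult G ?g) f" "fst f x = y"
    using lift_automorphism[OF left_mult_iso[OF g A(1)] assms] by blast
  let ?f = "(restrict (fst f) (verts \<Delta>), restrict (snd f) (darts \<Delta>))"
  have "is_lift \<Delta> p (left_mult G ?g) ?f" by (rule is_lift_restrict[OF wf(1) f(1)])
  then have "?f \<in> carrier H"
    using g unfolding carrier_H by (auto simp: Bij_def is_lift_def graph_iso_def)
  then show ?thesis using that[of ?f] f(2) assms by simp
qed

text \<open>The image of one vertex determines the degree, hence the automorphism that is lifted,
  and lifts of one automorphism that agree at a vertex are equal.\<close>

lemma H_free:
  assumes f: "f \<in> carrier H" "f' \<in> carrier H" and x: "x \<in> verts \<Delta>" "fst f x = fst f' x"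
  shows "f = f'"
proof -
  have "deg f \<otimes> fst p x = deg f' \<otimes> fst p x" using H_p_verts f x by metis
  then have "deg f = deg f'" using H_lift(1) f x by simp
  then have over: "snd p (snd f d) = snd p (snd f' d)" if "d \<in> darts \<Delta>" for d
    using H_p_darts f that by simp
  note eq = morphism_unique[OF connected H_morphism[OF f(1)] H_morphism[OF f(2)] over x]
  have "fst f = fst f'"
    using eq(1) f by (intro extensionalityI[of _ "verts \<Delta>"]) (auto simp: carrier_H Bij_def)
  moreover have "snd f = snd f'"
    using eq(2) f by (intro extensionalityI[of _ "darts \<Delta>"]) (auto simp: carrier_H Bij_def)
  ultimately show ?thesis by (rule prod_eqI)
qed

lemma mult_H: "f \<in> carrier H \<Longrightarrow> f' \<in> carrier H \<Longrightarrow>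
    f \<otimes>\<^bsub>H\<^esub> f' = (compose (verts \<Delta>) (fst f) (fst f'), compose (darts \<Delta>) (snd f) (snd f'))"
  by (auto simp: H_def cubization_def BijGroup_def mult_DirProd')

lemma H_subgroup: "subgroup (carrier H) (BijGroup (verts \<Delta>) \<times>\<times> BijGroup (darts \<Delta>))"
proof -
  interpret B: group "BijGroup (verts \<Delta>) \<times>\<times> BijGroup (darts \<Delta>)"
    by (intro DirProd_group group_BijGroup)
  have sub: "carrier H \<subseteq> carrier (BijGroup (verts \<Delta>) \<times>\<times> BijGroup (darts \<Delta>))"
    by (auto simp: carrier_H BijGroup_def)
  show ?thesis
  proof (rule B.subgroupI[OF sub])
    show "carrier H \<noteq> {}" using H_transitive[OF x0(1) x0(1)] by blast
  next
    fix f assume f: "f \<in> carrier H"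
    let ?i = "(inv_into (verts \<Delta>) (fst f), inv_into (darts \<Delta>) (snd f))"
    note l = H_lift[OF f]
    have iso: "graph_iso \<Delta> \<Delta> f" using l by (simp add: is_lift_def)
    then have V: "bij_betw (fst f) (verts \<Delta>) (verts \<Delta>)" and D: "bij_betw (snd f) (darts \<Delta>) (darts \<Delta>)"
      by (auto simp: graph_iso_def)
    have "fst p (inv_into (verts \<Delta>) (fst f) x) = inv (deg f) \<otimes> fst p x" if "x \<in> verts \<Delta>" for x
    proof -
      let ?y = "inv_into (verts \<Delta>) (fst f) x"
      have y: "?y \<in> verts \<Delta>" "fst f ?y = x"
        using V that by (auto simp: bij_betw_inv_into_right bij_betw_apply[OF bij_betw_inv_into])
      then show ?thesis using H_p_verts[OF f y(1)] l by (simp add: m_assoc[symmetric])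
    qed
    moreover have "snd p (inv_into (darts \<Delta>) (snd f) d) = snd (left_mult G (inv (deg f))) (snd p d)"
      if "d \<in> darts \<Delta>" for d
    proof -
      let ?e = "inv_into (darts \<Delta>) (snd f) d"
      have e: "?e \<in> darts \<Delta>" "snd f ?e = d"
        using D that by (auto simp: bij_betw_inv_into_right bij_betw_apply[OF bij_betw_inv_into])
      obtain h a c where "snd p ?e = (h, a, c)" "h \<in> carrier G" using p_darts[OF e(1)] by auto
      then show ?thesis
        using H_p_darts[OF f e(1)] e l by (simp add: left_mult_def m_assoc[symmetric])
    qed
    ultimately have "is_lift \<Delta> p (left_mult G (inv (deg f))) ?i"
      using graph_iso_inverse[OF iso wf(1)] by (simp add: is_lift_def left_mult_def)
    from is_lift_restrict[OF wf(1) this]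
    have "(restrict (fst ?i) (verts \<Delta>), restrict (snd ?i) (darts \<Delta>)) \<in> carrier H"
      using f l by (auto simp: carrier_H restrict_inv_into_Bij)
    moreover have fB: "fst f \<in> Bij (verts \<Delta>)" "snd f \<in> Bij (darts \<Delta>)"
      using f by (auto simp: carrier_H)
    then have "inv\<^bsub>BijGroup (verts \<Delta>) \<times>\<times> BijGroup (darts \<Delta>)\<^esub> (fst f, snd f) =
      (restrict (fst ?i) (verts \<Delta>), restrict (snd ?i) (darts \<Delta>))"
      using inv_DirProd[OF group_BijGroup group_BijGroup, of "fst f" "verts \<Delta>" "snd f" "darts \<Delta>"]
        inv_BijGroup[OF fB(1)] inv_BijGroup[OF fB(2)] by (simp add: BijGroup_def)
    ultimately show "inv\<^bsub>BijGroup (verts \<Delta>) \<times>\<times> BijGroup (darts \<Delta>)\<^esub> f \<in> carrier H" by simp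
  next
    fix f f' assume f: "f \<in> carrier H" "f' \<in> carrier H"
    have "is_lift \<Delta> p (left_mult G (deg f \<otimes> deg f')) (fst f \<circ> fst f', snd f \<circ> snd f')"
    proof -
      have "snd p (snd f (snd f' d)) = snd (left_mult G (deg f \<otimes> deg f')) (snd p d)" if d: "d \<in> darts \<Delta>" for d
      proof -
        obtain h a c where "snd p d = (h, a, c)" "h \<in> carrier G" using p_darts[OF d] by auto
        then show ?thesis
          using H_p_darts f d H_lift(1) by (simp add: left_mult_def m_assoc)
      qed
      moreover have "graph_iso \<Delta> \<Delta> (fst f \<circ> fst f', snd f \<circ> snd f')"
        using graph_morphism_compose[OF H_morphism[OF f(2)] H_morphism[OF f(1)]] H_lift(2)[OF f(1)]
          H_lift(2)[OF f(2)]
        by (auto simp: graph_iso_def is_lift_def intro: bij_betw_trans)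
      ultimately show ?thesis
        using f H_lift(1) by (simp add: is_lift_def H_p_verts left_mult_def m_assoc)
    qed
    from is_lift_restrict[OF wf(1) this]
    have "is_lift \<Delta> p (left_mult G (deg f \<otimes> deg f')) (f \<otimes>\<^bsub>H\<^esub> f')"
      by (simp add: mult_H f compose_def comp_def)
    moreover have "f \<otimes>\<^bsub>H\<^esub> f' \<in> Bij (verts \<Delta>) \<times> Bij (darts \<Delta>)"
      using f by (auto simp: mult_H carrier_H intro: compose_Bij)
    moreover have B_mult:
      "f \<otimes>\<^bsub>BijGroup (verts \<Delta>) \<times>\<times> BijGroup (darts \<Delta>)\<^esub> f' = f \<otimes>\<^bsub>H\<^esub> f'"
      by (simp add: H_def cubization_def)
    ultimately show "f \<otimes>\<^bsub>BijGroup (verts \<Delta>) \<times>\<times> BijGroup (darts \<Delta>)\<^esub> f' \<in> carrier H"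
      using m_closed[OF H_lift(1)[OF f(1)] H_lift(1)[OF f(2)]]
      unfolding carrier_H B_mult by blast
  qed
qed

lemma group_H: "group H"
proof -
  have "H = (BijGroup (verts \<Delta>) \<times>\<times> BijGroup (darts \<Delta>))\<lparr>carrier := carrier H\<rparr>"
    by (simp add: H_def cubization_def)
  then show ?thesis
    using subgroup.subgroup_is_group[OF H_subgroup DirProd_group[OF group_BijGroup group_BijGroup]]
    by simp
qed

lemma fst_mult_H [simp]: "f \<in> carrier H \<Longrightarrow> f' \<in> carrier H \<Longrightarrow> x \<in> verts \<Delta> \<Longrightarrow>
    fst (f \<otimes>\<^bsub>H\<^esub> f') x = fst f (fst f' x)"
  and snd_mult_H [simp]: "f \<in> carrier H \<Longrightarrow> f' \<in> carrier H \<Longrightarrow> d \<in> darts \<Delta> \<Longrightarrow>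
    snd (f \<otimes>\<^bsub>H\<^esub> f') d = snd f (snd f' d)"
  by (simp_all add: mult_H compose_eq)

lemma deg_hom: "group_hom H G deg"
proof -
  have "deg \<in> hom H G"
  proof (rule homI)
    fix f f' assume f: "f \<in> carrier H" "f' \<in> carrier H"
    show "deg f \<in> carrier G" by (rule H_lift(1)[OF f(1)])
    show "deg (f \<otimes>\<^bsub>H\<^esub> f') = deg f \<otimes> deg f'"
      using H_p_verts[OF f(1) H_verts[OF f(2) x0(1)]] fst_mult_H[OF f x0(1)]
      by (simp add: deg_def[of "f \<otimes>\<^bsub>H\<^esub> f'"] deg_def[of f'])
  qed
  then show ?thesis by (simp add: group_hom_def group_hom_axioms_def group_H is_group)
qed

lemma one_H: "x \<in> verts \<Delta> \<Longrightarrow> fst \<one>\<^bsub>H\<^esub> x = x"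
  by (simp add: H_def cubization_def BijGroup_def)

section \<open>Generators of the cubization and the Cayley graph structure of the cover\<close>

definition base_dart :: "'g \<Rightarrow> 'd" where
  "base_dart a = (SOME d. d \<in> darts \<Delta> \<and> src \<Delta> d = x0 \<and> snd p d = (\<one>, a, True))"

lemma base_dart:
  assumes "a \<in> A"
  shows "base_dart a \<in> darts \<Delta>" "src \<Delta> (base_dart a) = x0" "snd p (base_dart a) = (\<one>, a, True)"
proof -
  have "\<exists>d. d \<in> darts \<Delta> \<and> src \<Delta> d = x0 \<and> snd p d = (\<one>, a, True)"
    using dart_lift[OF x0(1), of "(\<one>, a, True)"] assms x0(2) by auto
  from someI_ex[OF this]
  show "base_dart a \<in> darts \<Delta>" "src \<Delta> (base_dart a) = x0" "snd p (base_dart a) = (\<one>, a, True)"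
    by (simp_all add: base_dart_def)
qed

text \<open>Among the lifts of left multiplication by \<open>a\<close>, this is the one that moves
  \<open>x0\<close> along the lifted edge with letter \<open>a\<close>; it is unique because the
  action is free.\<close>

definition lifted_gen :: "'g \<Rightarrow> ('v \<Rightarrow> 'v) \<times> ('d \<Rightarrow> 'd)" where
  "lifted_gen a = (SOME f. f \<in> carrier H \<and> fst f x0 = tgt \<Delta> (base_dart a))"

lemma lifted_gen:
  assumes "a \<in> A"
  shows "lifted_gen a \<in> carrier H" "fst (lifted_gen a) x0 = tgt \<Delta> (base_dart a)" "deg (lifted_gen a) = a"
proof -
  have "\<exists>f. f \<in> carrier H \<and> fst f x0 = tgt \<Delta> (base_dart a)"
    using H_transitive[OF x0(1) wf_sgraphD(5)[OF wf(1) base_dart(1)[OF assms]]] by blast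
  from someI_ex[OF this]
  show *: "lifted_gen a \<in> carrier H" "fst (lifted_gen a) x0 = tgt \<Delta> (base_dart a)"
    by (simp_all add: lifted_gen_def)
  show "deg (lifted_gen a) = a"
    using p_tgt[OF base_dart(1)[OF assms]] base_dart(3)[OF assms] assms A(1) *(2)
    by (auto simp: deg_def)
qed

text \<open>Applying \<open>h\<close> to the dart from \<open>x0\<close> to
  \<open>lifted_gen a\<close> of \<open>x0\<close> turns it into a Cayley edge, on which the
  generator multiplies \<open>h\<close> from the right. Letter and direction are kept, so no edge is
  inverted.\<close>

lemma translated_dart:
  assumes "h \<in> carrier H" "a \<in> A"
  shows "snd h (base_dart a) \<in> darts \<Delta>" "src \<Delta> (snd h (base_dart a)) = fst h x0"
    "tgt \<Delta> (snd h (base_dart a)) = fst (h \<otimes>\<^bsub>H\<^esub> lifted_gen a) x0"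
    "snd p (snd h (base_dart a)) = (deg h, a, True)"
proof -
  note e = base_dart[OF assms(2)] and m = H_morphism[OF assms(1)]
  show "snd h (base_dart a) \<in> darts \<Delta>" using e assms by simp
  show "src \<Delta> (snd h (base_dart a)) = fst h x0" using e m by (simp add: graph_morphism_def)
  show "tgt \<Delta> (snd h (base_dart a)) = fst (h \<otimes>\<^bsub>H\<^esub> lifted_gen a) x0"
    using morphism_tgt[OF m wf(1) e(1)] lifted_gen[OF assms(2)] assms x0(1) by simp
  show "snd p (snd h (base_dart a)) = (deg h, a, True)"
    using H_p_darts[OF assms(1) e(1)] e(3) H_lift(1)[OF assms(1)] by (simp add: left_mult_def)
qed

lemma dart_is_translate:
  assumes d: "d \<in> darts \<Delta>" "snd p d = (g, a, True)" and h: "h \<in> carrier H" "fst h x0 = src \<Delta> d"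
  shows "a \<in> A" "d = snd h (base_dart a)"
proof -
  show a: "a \<in> A" using p_darts[OF d(1)] d(2) by simp
  have "deg h = g" using p_src[OF d(1)] d(2) h by (simp add: deg_def)
  then show "d = snd h (base_dart a)"
    using translated_dart[OF h(1) a] d h by (intro dart_unique) auto
qed

text \<open>The orbit map of \<open>x0\<close>. A dart of the Cayley graph stores its generator as
  an element of \<open>H\<close>, and \<open>deg\<close> recovers the letter of
  \<open>A\<close>.\<close>

definition cayley_map ::
  "(('v \<Rightarrow> 'v) \<times> ('d \<Rightarrow> 'd) \<Rightarrow> 'v) \<times>
    ((('v \<Rightarrow> 'v) \<times> ('d \<Rightarrow> 'd)) \<times> (('v \<Rightarrow> 'v) \<times> ('d \<Rightarrow> 'd)) \<times> bool \<Rightarrow> 'd)" where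
  "cayley_map = (\<lambda>h. fst h x0,
     \<lambda>(h, s, c). if c then snd h (base_dart (deg s)) else opp \<Delta> (snd h (base_dart (deg s))))"

lemma cayley_map_iso: "graph_iso (Cay H (lifted_gen ` A)) \<Delta> cayley_map"
proof -
  interpret H: group H by (rule group_H)
  have V: "bij_betw (fst cayley_map) (carrier H) (verts \<Delta>)"
  proof (intro bij_betw_imageI subset_antisym subsetI)
    show "inj_on (fst cayley_map) (carrier H)"
      using H_free[OF _ _ x0(1)] by (auto simp: inj_on_def cayley_map_def)
    show "x \<in> verts \<Delta>" if x: "x \<in> fst cayley_map ` carrier H" for x
    proof -
      obtain h where h: "x = fst cayley_map h" "h \<in> carrier H" using x by blast
      then show ?thesis using H_verts[OF h(2) x0(1)] by (simp add: cayley_map_def)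
    qed
    show "x \<in> fst cayley_map ` carrier H" if x: "x \<in> verts \<Delta>" for x
    proof -
      obtain h where "h \<in> carrier H" "fst h x0 = x" using H_transitive[OF x0(1) x] .
      then show ?thesis by (intro image_eqI[of _ _ h]) (simp_all add: cayley_map_def)
    qed
  qed
  have img: "snd cayley_map (h, lifted_gen a, c) \<in> darts \<Delta> \<and>
      snd p (snd cayley_map (h, lifted_gen a, c)) = (deg h, a, c)"
    if "h \<in> carrier H" "a \<in> A" for h a c
    using translated_dart[OF that] lifted_gen[OF that(2)] wf_sgraphD[OF wf(1)]
      p_opp[of "snd h (base_dart a)"] by (auto simp: cayley_map_def)
  have D: "bij_betw (snd cayley_map) (carrier H \<times> lifted_gen ` A \<times> UNIV) (darts \<Delta>)"
  proof (intro bij_betw_imageI subset_antisym subsetI)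
    show "inj_on (snd cayley_map) (carrier H \<times> lifted_gen ` A \<times> UNIV)"
    proof (rule inj_onI)
      fix t t' assume tt: "t \<in> carrier H \<times> lifted_gen ` A \<times> UNIV"
        "t' \<in> carrier H \<times> lifted_gen ` A \<times> UNIV" "snd cayley_map t = snd cayley_map t'"
      obtain h a c where t: "t = (h, lifted_gen a, c)" "h \<in> carrier H" "a \<in> A"
        using tt(1) by (elim SigmaE imageE) simp
      obtain h' a' c' where t': "t' = (h', lifted_gen a', c')" "h' \<in> carrier H" "a' \<in> A"
        using tt(2) by (elim SigmaE imageE) simp
      have eq: "a' = a" "c' = c"
        using img[OF t(2,3), of c] img[OF t'(2,3), of c'] tt(3) unfolding t(1) t'(1) by auto
      note h = translated_dart[OF t(2,3)] and h' = translated_dart[OF t'(2) t(3)]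
      have "snd h (base_dart a) = snd h' (base_dart a)"
      proof (cases c)
        case True
        then show ?thesis
          using tt(3) lifted_gen(3)[OF t(3)] unfolding t(1) t'(1) eq by (simp add: cayley_map_def)
      next
        case False
        then have "opp \<Delta> (snd h (base_dart a)) = opp \<Delta> (snd h' (base_dart a))"
          using tt(3) lifted_gen(3)[OF t(3)] unfolding t(1) t'(1) eq by (simp add: cayley_map_def)
        then show ?thesis
          by (metis wf_sgraphD(3)[OF wf(1) h(1)] wf_sgraphD(3)[OF wf(1) h'(1)])
      qed
      then have "fst h x0 = fst h' x0" using h(2) h'(2) by simp
      then show "t = t'" using H_free[OF t(2) t'(2) x0(1)] t(1) t'(1) eq by simp
    qed
    show "d \<in> darts \<Delta>" if "d \<in> snd cayley_map ` (carrier H \<times> lifted_gen ` A \<times> UNIV)" for d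
      using that img by auto
    show "d \<in> snd cayley_map ` (carrier H \<times> lifted_gen ` A \<times> UNIV)" if d: "d \<in> darts \<Delta>" for d
    proof -
      obtain g a c where gac: "snd p d = (g, a, c)" by (rule prod_cases3)
      have opp: "snd p (opp \<Delta> d) = (g, a, \<not> c)" using p_opp[OF d] unfolding gac by simp
      \<comment> \<open>Of the two directions of the edge, the one along its letter is a translate
        of a \<open>base_dart\<close>.\<close>
      define e where "e = (if c then d else opp \<Delta> d)"
      have e: "e \<in> darts \<Delta>" and ga: "snd p e = (g, a, True)"
        using d wf_sgraphD(2)[OF wf(1) d] gac opp by (simp_all add: e_def)
      obtain h where h: "h \<in> carrier H" "fst h x0 = src \<Delta> e"
        using H_transitive[OF x0(1) wf_sgraphD(1)[OF wf(1) e]] .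
      note t = dart_is_translate[OF e ga h]
      have "d = snd cayley_map (h, lifted_gen a, c)"
      proof (cases c)
        case True
        then show ?thesis using t(2) lifted_gen(3)[OF t(1)] by (simp add: cayley_map_def e_def)
      next
        case False
        then have "opp \<Delta> d = snd h (base_dart a)" using t(2) by (simp add: e_def)
        then show ?thesis
          using False lifted_gen(3)[OF t(1)] wf_sgraphD(3)[OF wf(1) d]
          by (simp add: cayley_map_def)
      qed
      then show ?thesis using h t(1) by blast
    qed
  qed
  have "graph_morphism (Cay H (lifted_gen ` A)) \<Delta> cayley_map"
    using translated_dart lifted_gen wf_sgraphD[OF wf(1)] bij_betw_imp_surj_on[OF V]
      bij_betw_imp_surj_on[OF D]
    by (auto simp: graph_morphism_def cayley_map_def src_opp)
  then show ?thesis using V D by (simp add: graph_iso_def)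
qed

lemma generate_lifted_gen:
  defines "S \<equiv> lifted_gen ` A \<union> m_inv H ` lifted_gen ` A"
  shows "generate H S = carrier H"
proof -
  interpret H: group H by (rule group_H)
  have SH: "S \<subseteq> carrier H" using lifted_gen(1) by (auto simp: S_def)
  have reach: "\<exists>h \<in> generate H S. fst h x0 = y" if "walk \<Delta> x0 \<delta> y" for \<delta> y
    using that
  proof (induction \<delta> arbitrary: y rule: rev_induct)
    case Nil
    then show ?case using generate.one one_H by (intro bexI[of _ "\<one>\<^bsub>H\<^esub>"]) auto
  next
    case (snoc d \<delta>)
    then obtain x where x: "walk \<Delta> x0 \<delta> x" "d \<in> darts \<Delta>" "src \<Delta> d = x" "y = tgt \<Delta> d"
      by (auto simp: walk_append_iff[OF wf(1)])
    then obtain h where h: "h \<in> generate H S" "fst h x0 = x" using snoc.IH by blast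
    have hH: "h \<in> carrier H" using h(1) H.generate_incl[OF SH] by blast
    note D = wf_sgraphD[OF wf(1) x(2)]
    obtain g a c where gac: "snd p d = (g, a, c)" by (rule prod_cases3)
    show ?case
    proof (cases c)
      case True
      then have "snd p d = (g, a, True)" using gac by simp
      note t = dart_is_translate[OF x(2) this hH h(2)[folded x(3)]]
      have "h \<otimes>\<^bsub>H\<^esub> lifted_gen a \<in> generate H S"
        using h(1) t(1) by (intro generate.eng[OF h(1)] generate.incl) (auto simp: S_def)
      moreover have "fst (h \<otimes>\<^bsub>H\<^esub> lifted_gen a) x0 = y"
        using translated_dart(3)[OF hH t(1)] t(2) x(4) by simp
      ultimately show ?thesis by blast
    next
      case False
      \<comment> \<open>A backward step: the reversed dart leads from \<open>y\<close>, the image of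
        \<open>x0\<close> under \<open>h'\<close>, to that under \<open>h\<close>. So
        \<open>h\<close> is \<open>h'\<close> times a generator, and \<open>h'\<close> is
        \<open>h\<close> times the inverse of this generator.\<close>
      obtain h' where h': "h' \<in> carrier H" "fst h' x0 = y"
        using H_transitive[OF x0(1) D(5)] x(4) by blast
      have "snd p (opp \<Delta> d) = (g, a, True)" using p_opp[OF x(2)] gac False by simp
      note t = dart_is_translate[OF D(2) this h'(1)]
      have t: "a \<in> A" "opp \<Delta> d = snd h' (base_dart a)" using t h'(2) x(4) by (simp_all add: src_opp)
      have "fst (h' \<otimes>\<^bsub>H\<^esub> lifted_gen a) x0 = fst h x0"
        using translated_dart(3)[OF h'(1) t(1)] t(2) D(6) x(3) h(2) by simp
      then have "h' \<otimes>\<^bsub>H\<^esub> lifted_gen a = h"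
        using h'(1) lifted_gen(1)[OF t(1)] hH H_free[OF _ _ x0(1)] by blast
      then have "h' = h \<otimes>\<^bsub>H\<^esub> inv\<^bsub>H\<^esub> lifted_gen a"
        using h'(1) lifted_gen(1)[OF t(1)] hH H.inv_solve_right by blast
      moreover have "h \<otimes>\<^bsub>H\<^esub> inv\<^bsub>H\<^esub> lifted_gen a \<in> generate H S"
        using h(1) t(1) by (intro generate.eng[OF h(1)] generate.incl) (auto simp: S_def)
      ultimately show ?thesis using h'(2) by blast
    qed
  qed
  show ?thesis
  proof
    show "generate H S \<subseteq> carrier H" by (rule H.generate_incl[OF SH])
    show "carrier H \<subseteq> generate H S"
    proof
      fix f assume f: "f \<in> carrier H"
      obtain \<gamma> where "lifts_to \<Delta> p x0 \<gamma> (fst f x0)"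
        using lifts_to_between[OF x0(1) H_verts[OF f x0(1)]] .
      then obtain \<delta> where "walk \<Delta> x0 \<delta> (fst f x0)" by (auto simp: lifts_to_def)
      then obtain h where h: "h \<in> generate H S" "fst h x0 = fst f x0" using reach by blast
      then have "h = f" using H_free[OF _ f x0(1)] H.generate_incl[OF SH] by blast
      then show "f \<in> generate H S" using h by simp
    qed
  qed
qed

text \<open>\<open>deg\<close> takes a lifted letter back to its letter, so the condition
  \<open>letters\<close> transfers from \<open>A\<close>: if the inverse of a lifted letter is a
  lifted letter again, both belong to the same letter and hence coincide.\<close>

lemma is_Cayley_graph_of_cubization:
  assumes S: "letters G S A"
  shows "is_Cayley_graph_of \<Delta> (cubization G \<Delta> p)"
proof -
  interpret H: group H by (rule group_H)
  interpret deg: group_hom H G deg by (rule deg_hom)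
  let ?A = "lifted_gen ` A" and ?S = "lifted_gen ` A \<union> m_inv H ` lifted_gen ` A"
  have sym: "symmetric_generating_set H ?S"
    using generate_lifted_gen lifted_gen(1) by (auto simp: symmetric_generating_set_def)
  have inv_eq: "inv\<^bsub>H\<^esub> lifted_gen a = lifted_gen a" if a: "a \<in> A" "inv\<^bsub>H\<^esub> lifted_gen a \<in> ?A" for a
  proof -
    obtain a' where a': "a' \<in> A" "inv\<^bsub>H\<^esub> lifted_gen a = lifted_gen a'" using a(2) by blast
    have "inv a = a'"
      using deg.hom_inv[OF lifted_gen(1)[OF a(1)]] a' lifted_gen(3) a(1) by simp
    then have "a' = a" using S a(1) a'(1) by (auto simp: letters_def)
    then show ?thesis using a' by simp
  qed
  have "letters H ?S ?A"
    unfolding letters_def using inv_eq lifted_gen(1) by auto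
  then show ?thesis
    unfolding is_Cayley_graph_of_def H_def[symmetric]
    using group_H sym cayley_map_iso A(2)
    by (intro conjI exI[of _ ?S] exI[of _ ?A] exI[of _ cayley_map]) simp_all
qed

end


section \<open>The action on the infinite cube\<close>

text \<open>If a dart occurs twice, a closed piece can be cut out; if a dart and its reverse occur,
  both can be cut out with everything between them. So a shortest walk crosses no edge twice, and
  its chain is 1 or -1 modulo k on each edge that it crosses.\<close>

lemma shortest_walk_simple:
  assumes wf: "wf_sgraph \<Gamma>" and \<gamma>: "walk \<Gamma> u \<gamma> v"
    and shortest: "\<forall>\<delta>. walk \<Gamma> u \<delta> v \<longrightarrow> length \<gamma> \<le> length \<delta>"
  shows "distinct \<gamma>" "d \<in> set \<gamma> \<Longrightarrow> opp \<Gamma> d \<notin> set \<gamma>"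
proof -
  show "distinct \<gamma>"
  proof (rule ccontr)
    assume "\<not> distinct \<gamma>"
    then obtain xs ys zs e where e: "\<gamma> = xs @ [e] @ ys @ [e] @ zs" using not_distinct_decomp by blast
    then have "walk \<Gamma> u (xs @ [e] @ zs) v" using \<gamma> by (auto simp: walk_append_iff[OF wf])
    then show False using shortest[rule_format, of "xs @ [e] @ zs"] e by simp
  qed
  have no_return: False if e: "\<gamma> = xs @ [e] @ ys @ [opp \<Gamma> e] @ zs" for xs e ys zs
  proof -
    have "e \<in> darts \<Gamma>" using walk_darts[OF \<gamma>] e by auto
    then have "walk \<Gamma> u (xs @ zs) v"
      using \<gamma> e wf_sgraphD(6)[OF wf] by (auto simp: walk_append_iff[OF wf])
    then show False using shortest[rule_format, of "xs @ zs"] e by simp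
  qed
  assume d: "d \<in> set \<gamma>"
  show "opp \<Gamma> d \<notin> set \<gamma>"
  proof
    assume o: "opp \<Gamma> d \<in> set \<gamma>"
    have D: "opp \<Gamma> (opp \<Gamma> d) = d" "opp \<Gamma> d \<noteq> d"
      using wf_sgraphD[OF wf] walk_darts[OF \<gamma>] d by auto
    obtain xs zs where xz: "\<gamma> = xs @ d # zs" using d split_list by metis
    then consider "opp \<Gamma> d \<in> set xs" | "opp \<Gamma> d \<in> set zs" using o D(2) by auto
    then show False
    proof cases
      case 1
      then obtain as bs where "xs = as @ opp \<Gamma> d # bs" using split_list by metis
      then show False using no_return[of as "opp \<Gamma> d" bs zs] xz D(1) by simp
    next
      case 2
      then obtain as bs where "zs = as @ opp \<Gamma> d # bs" using split_list by metis
      then show False using no_return[of xs d as bs] xz by simp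
    qed
  qed
qed

text \<open>A vertex has at most two neighbours for each letter. In an infinite \<open>G\<close>
  this yields vertices that no walk of bounded length reaches.\<close>

lemma (in group) finite_Cay_sphere:
  assumes "A \<subseteq> carrier G" "finite A" "u \<in> carrier G"
  shows "finite {v. \<exists>\<gamma>. walk (Cay G A) u \<gamma> v \<and> length \<gamma> = n}"
proof (induction n)
  case 0
  then show ?case by (rule finite_subset[of _ "{u}"]) auto
next
  case (Suc n)
  let ?B = "{v. \<exists>\<gamma>. walk (Cay G A) u \<gamma> v \<and> length \<gamma> = n}"
  let ?C = "(\<lambda>(w, a). w \<otimes> a) ` (?B \<times> A) \<union> (\<lambda>(w, a). w \<otimes> inv a) ` (?B \<times> A)"
  have "{v. \<exists>\<gamma>. walk (Cay G A) u \<gamma> v \<and> length \<gamma> = Suc n} \<subseteq> ?C"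
  proof clarify
    fix v \<gamma> assume v: "walk (Cay G A) u \<gamma> v" "length \<gamma> = Suc n" "v \<notin> (\<lambda>(w, a). w \<otimes> inv a) ` (?B \<times> A)"
    then obtain \<delta> d where \<gamma>: "\<gamma> = \<delta> @ [d]" "length \<delta> = n" by (auto simp: length_Suc_conv_rev)
    obtain g a c where d: "d = (g, a, c)" by (rule prod_cases3)
    obtain w where w: "walk (Cay G A) u \<delta> w" "g \<in> carrier G" "a \<in> A"
      "w = (if c then g else g \<otimes> a)" "v = (if c then g \<otimes> a else g)"
      using v(1) unfolding \<gamma> d by (auto simp: walk_append_iff[OF wf_Cay[OF assms(1)]])
    then have wB: "w \<in> ?B" using \<gamma>(2) by blast
    show "v \<in> (\<lambda>(w, a). w \<otimes> a) ` (?B \<times> A)"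
    proof (cases c)
      case True
      then show ?thesis using w wB by force
    next
      case False
      then have "v = w \<otimes> inv a" using w assms(1) by (auto simp: m_assoc)
      then have "v \<in> (\<lambda>(w, a). w \<otimes> inv a) ` (?B \<times> A)"
        using w(3) wB by (intro image_eqI[of _ _ "(w, a)"]) simp_all
      then show ?thesis using v(3) by contradiction
    qed
  qed
  then show ?case by (rule finite_subset) (use Suc assms(2) in simp)
qed

context cayley_homology_cover
begin

section \<open>Walls and their permutation by the cubization\<close>

definition cover_walls :: "'g coord set" where
  "cover_walls = carrier G \<times> A \<times> {0..<int k}"

text \<open>A chain is encoded by its graph: the coordinate \<open>(g, a, i)\<close> is 1 iff the
  coefficient at the edge \<open>(g, a)\<close> is \<open>i\<close>. This is the code of the chain
  0, which belongs to \<open>x0\<close>.\<close>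

definition base_point :: "'g coord \<Rightarrow> real" where
  "base_point = (\<lambda>(g, a, i). if i = 0 then 1 else 0)"

text \<open>Meant for precomposition, hence the inverse and the minus sign: after precomposition,
  \<open>base_point\<close> has the value 1 at a wall \<open>(g, a, i)\<close> iff \<open>i\<close>
  is the coefficient at \<open>(g, a)\<close> of the chain of \<open>h x0\<close>. The entry
  \<open>True\<close> fixes the orientation of the edge.\<close>

definition wall_perm :: "('v \<Rightarrow> 'v) \<times> ('d \<Rightarrow> 'd) \<Rightarrow> 'g coord \<Rightarrow> 'g coord" where
  "wall_perm h = (\<lambda>(g, a, i). (inv (deg h) \<otimes> g, a, (i - chain_at (fst h x0) (g, a, True)) mod int k))"

abbreviation "wall_complex \<equiv> infinite_cube cover_walls base_point"
abbreviation "wall_points \<equiv> infinite_cube_points cover_walls base_point"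

text \<open>The restriction to \<open>wall_points\<close> is there because
  \<open>group_action\<close> requires extensional bijections.\<close>

definition wall_action :: "('v \<Rightarrow> 'v) \<times> ('d \<Rightarrow> 'd) \<Rightarrow> ('g coord \<Rightarrow> real) \<Rightarrow> 'g coord \<Rightarrow> real" where
  "wall_action h = (\<lambda>z \<in> wall_points. \<lambda>w. if w \<in> cover_walls then z (wall_perm h w) else base_point w)"

sublocale cube: cube_base cover_walls base_point
  by unfold_locales (auto simp: base_point_def)

lemma chain_at_range: "x \<in> verts \<Delta> \<Longrightarrow> chain_at x d \<in> {0..<int k}"
  using walk_chain_range[of k "Cay G A" _ d] k unfolding chain_at_def by simp

lemma chain_at_base: "chain_at x0 = (\<lambda>_. 0)"
  using chain_at_eq[of "[]" x0] x0(1) by (simp add: lifts_to_def)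

text \<open>Cocycle identity: a walk from \<open>x0\<close> to \<open>h x0\<close> followed by the \<open>h\<close>-translate of a walk from
  \<open>x0\<close> to \<open>h' x0\<close>.\<close>

lemma chain_at_mult:
  assumes h: "h \<in> carrier H" "h' \<in> carrier H" and e: "g \<in> carrier G" "a \<in> A"
  shows "chain_at (fst (h \<otimes>\<^bsub>H\<^esub> h') x0) (g, a, c) =
    (chain_at (fst h x0) (g, a, c) + chain_at (fst h' x0) (inv (deg h) \<otimes> g, a, c)) mod int k"
proof -
  note d = H_lift(1)[OF h(1)]
  obtain \<gamma> where \<gamma>: "lifts_to \<Delta> p x0 \<gamma> (fst h x0)"
    using lifts_to_between[OF x0(1) H_verts[OF h(1) x0(1)]] .
  obtain \<gamma>' where \<gamma>': "lifts_to \<Delta> p x0 \<gamma>' (fst h' x0)"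
    using lifts_to_between[OF x0(1) H_verts[OF h(2) x0(1)]] .
  then obtain \<delta> where \<delta>: "walk \<Delta> x0 \<delta> (fst h' x0)" "map (snd p) \<delta> = \<gamma>'" by (auto simp: lifts_to_def)
  let ?\<gamma>'' = "map (snd (left_mult G (deg h))) \<gamma>'"
  have "map (snd p) (map (snd h) \<delta>) = ?\<gamma>''"
    unfolding \<delta>(2)[symmetric] by (simp add: H_p_darts[OF h(1)] subsetD[OF walk_darts[OF \<delta>(1)]])
  then have "lifts_to \<Delta> p (fst h x0) ?\<gamma>'' (fst h (fst h' x0))"
    using morphism_walk[OF H_morphism[OF h(1)] wf(1) \<delta>(1)] unfolding lifts_to_def by blast
  with \<gamma> have "lifts_to \<Delta> p x0 (\<gamma> @ ?\<gamma>'') (fst (h \<otimes>\<^bsub>H\<^esub> h') x0)"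
    using h x0(1) by (auto simp: lifts_to_append)
  then have "chain_at (fst (h \<otimes>\<^bsub>H\<^esub> h') x0) (g, a, c) =
    (chain_at (fst h x0) (g, a, c) + walk_chain k (Cay G A) ?\<gamma>'' (g, a, c)) mod int k"
    by (simp add: chain_at_eq[OF \<gamma>] chain_at_eq walk_chain_append)
  also have "(g, a, c) = snd (left_mult G (deg h)) (inv (deg h) \<otimes> g, a, c)"
    using e d by (simp add: left_mult_def m_assoc[symmetric])
  then have "walk_chain k (Cay G A) ?\<gamma>'' (g, a, c) = chain_at (fst h' x0) (inv (deg h) \<otimes> g, a, c)"
    using walk_chain_iso[OF left_mult_iso[OF d A(1)] wf(2) lifts_to_darts[OF \<gamma>'], of "(inv (deg h) \<otimes> g, a, c)" k]
      d e by (simp add: chain_at_eq[OF \<gamma>'])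
  finally show ?thesis .
qed

lemma wall_perm_closed: "h \<in> carrier H \<Longrightarrow> w \<in> cover_walls \<Longrightarrow> wall_perm h w \<in> cover_walls"
  using H_lift(1)[of h] k by (auto simp: cover_walls_def wall_perm_def)

text \<open>The cocycle identity in contravariant form; precomposition turns it into a left
  action.\<close>

lemma wall_perm_mult:
  assumes h: "h \<in> carrier H" "h' \<in> carrier H" and w: "w \<in> cover_walls"
  shows "wall_perm (h \<otimes>\<^bsub>H\<^esub> h') w = wall_perm h' (wall_perm h w)"
proof -
  interpret deg: group_hom H G deg by (rule deg_hom)
  obtain g a i where w': "w = (g, a, i)" "g \<in> carrier G" "a \<in> A" using w by (auto simp: cover_walls_def)
  then show ?thesis
    using h H_lift(1) chain_at_mult[OF h w'(2,3), of True]
    by (simp add: wall_perm_def inv_mult_group m_assoc mod_simps diff_diff_eq del: fst_mult_H)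
qed

lemma wall_perm_one:
  assumes "w \<in> cover_walls"
  shows "wall_perm \<one>\<^bsub>H\<^esub> w = w"
proof -
  interpret deg: group_hom H G deg by (rule deg_hom)
  show ?thesis
    using assms one_H[OF x0(1)] by (auto simp: wall_perm_def cover_walls_def chain_at_base)
qed

lemma wall_perm_bij:
  assumes h: "h \<in> carrier H"
  shows "bij_betw (wall_perm h) cover_walls cover_walls"
proof -
  interpret H: group H by (rule group_H)
  show ?thesis
    using wall_perm_closed[OF h] wall_perm_closed[OF H.inv_closed[OF h]] h
      wall_perm_mult[of h "inv\<^bsub>H\<^esub> h"] wall_perm_mult[of "inv\<^bsub>H\<^esub> h" h] wall_perm_one
    by (intro bij_betw_byWitness[where f' = "wall_perm (inv\<^bsub>H\<^esub> h)"] ballI image_subsetI) simp_all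
qed

lemma finite_chain_support:
  assumes "x \<in> verts \<Delta>"
  shows "finite {(g, a). chain_at x (g, a, True) \<noteq> 0}"
proof -
  obtain \<gamma> where \<gamma>: "lifts_to \<Delta> p x0 \<gamma> x" using lifts_to_between[OF x0(1) assms] .
  have "{(g, a). chain_at x (g, a, True) \<noteq> 0} \<subseteq> (\<lambda>(g, a, c). (g, a)) ` set \<gamma>"
  proof clarify
    fix g a assume "chain_at x (g, a, True) \<noteq> 0"
    then have "\<not> (count_list \<gamma> (g, a, True) = 0 \<and> count_list \<gamma> (g, a, False) = 0)"
      by (rule contrapos_nn) (simp add: chain_at_eq[OF \<gamma>] walk_chain_def)
    then show "(g, a) \<in> (\<lambda>(g, a, c). (g, a)) ` set \<gamma>"
      by (force simp: count_list_0_iff)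
  qed
  then show ?thesis by (rule finite_subset) simp
qed

text \<open>Where the chain of \<open>h x0\<close> vanishes, residues are kept, and
  \<open>base_point\<close> depends on the residue alone. The support of the chain is finite, with k
  walls over each of its edges.\<close>

lemma finite_moved:
  assumes h: "h \<in> carrier H"
  shows "finite {w \<in> cover_walls. base_point (wall_perm h w) \<noteq> base_point w}"
proof (rule finite_subset)
  let ?E = "{(g, a). chain_at (fst h x0) (g, a, True) \<noteq> 0}"
  show "{w \<in> cover_walls. base_point (wall_perm h w) \<noteq> base_point w} \<subseteq>
    (\<lambda>((g, a), i). (g, a, i)) ` (?E \<times> {0..<int k})"
  proof clarify
    fix g a i assume w: "(g, a, i) \<in> cover_walls" "base_point (wall_perm h (g, a, i)) \<noteq> base_point (g, a, i)"
    then have i: "i \<in> {0..<int k}" by (simp add: cover_walls_def)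
    then have "chain_at (fst h x0) (g, a, True) \<noteq> 0"
      using w(2) by (auto simp: wall_perm_def base_point_def)
    then show "(g, a, i) \<in> (\<lambda>((g, a), i). (g, a, i)) ` (?E \<times> {0..<int k})"
      using i by force
  qed
  show "finite ((\<lambda>((g, a), i). (g, a, i)) ` (?E \<times> {0..<int k}))"
    using finite_chain_support[OF H_verts[OF h x0(1)]] by simp
qed

lemma wall_action_eq:
  "z \<in> wall_points \<Longrightarrow> wall_action h z = (\<lambda>w. if w \<in> cover_walls then z (wall_perm h w) else base_point w)"
  by (simp add: wall_action_def)

lemma wall_action_closed: "h \<in> carrier H \<Longrightarrow> z \<in> wall_points \<Longrightarrow> wall_action h z \<in> wall_points"
  using cube.permute_in_points[OF wall_perm_bij finite_moved] by (simp add: wall_action_eq)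

lemma wall_action_mult:
  assumes "h \<in> carrier H" "h' \<in> carrier H" "z \<in> wall_points"
  shows "wall_action (h \<otimes>\<^bsub>H\<^esub> h') z = wall_action h (wall_action h' z)"
proof -
  have "wall_action h (wall_action h' z) =
      (\<lambda>w. if w \<in> cover_walls then wall_action h' z (wall_perm h w) else base_point w)"
    by (rule wall_action_eq[OF wall_action_closed[OF assms(2,3)]])
  also have "\<dots> = (\<lambda>w. if w \<in> cover_walls then z (wall_perm (h \<otimes>\<^bsub>H\<^esub> h') w) else base_point w)"
    by (rule ext) (simp add: wall_action_eq[OF assms(3)] wall_perm_mult[OF assms(1,2)]
        wall_perm_closed[OF assms(1)])
  also have "\<dots> = wall_action (h \<otimes>\<^bsub>H\<^esub> h') z"
    by (rule wall_action_eq[OF assms(3), symmetric])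
  finally show ?thesis ..
qed

lemma wall_action_one: "z \<in> wall_points \<Longrightarrow> wall_action \<one>\<^bsub>H\<^esub> z = z"
proof
  fix w assume z: "z \<in> wall_points"
  have "{w. z w \<noteq> base_point w} \<subseteq> cover_walls" using z by (simp add: infinite_cube_points_def)
  then have "z w = base_point w" if "w \<notin> cover_walls" using that by blast
  then show "wall_action \<one>\<^bsub>H\<^esub> z w = z w"
    using z by (simp add: wall_action_eq wall_perm_one)
qed

lemma wall_action_bij:
  assumes h: "h \<in> carrier H"
  shows "bij_betw (wall_action h) wall_points wall_points"
proof -
  interpret H: group H by (rule group_H)
  have "wall_action (inv\<^bsub>H\<^esub> h) (wall_action h z) = z \<and> wall_action h (wall_action (inv\<^bsub>H\<^esub> h) z) = z"
    if "z \<in> wall_points" for z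
    using h that wall_action_mult[of h "inv\<^bsub>H\<^esub> h" z] wall_action_mult[of "inv\<^bsub>H\<^esub> h" h z] wall_action_one
    by simp
  then show ?thesis
    using wall_action_closed[OF h] wall_action_closed[OF H.inv_closed[OF h]]
    by (intro bij_betw_byWitness[where f' = "wall_action (inv\<^bsub>H\<^esub> h)"] ballI image_subsetI) simp_all
qed

lemma wall_action_group_action: "group_action H wall_points wall_action"
proof (rule group_action.intro)
  have Bij: "wall_action h \<in> Bij wall_points" if "h \<in> carrier H" for h
    using wall_action_bij[OF that] by (simp add: Bij_def wall_action_def)
  have "wall_action (h \<otimes>\<^bsub>H\<^esub> h') = compose wall_points (wall_action h) (wall_action h')"
    if "h \<in> carrier H" "h' \<in> carrier H" for h h'
    using that by (intro extensionalityI[of _ wall_points])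
      (simp_all add: wall_action_mult compose_eq, simp add: wall_action_def)
  then have "wall_action \<in> hom H (BijGroup wall_points)"
    using Bij by (simp add: hom_def BijGroup_def)
  then show "group_hom H (BijGroup wall_points) wall_action"
    by (simp add: group_hom_def group_hom_axioms_def group_H group_BijGroup)
qed

lemma wall_action_cubical: "cubical_action H wall_complex wall_action"
  unfolding cubical_action_def cubical_automorphism_def cube.cc_points_infinite_cube
proof (intro conjI ballI wall_action_group_action)
  interpret H: group H by (rule group_H)
  fix h assume h: "h \<in> carrier H"
  show "bij_betw (wall_action h) wall_points wall_points" by (rule wall_action_bij[OF h])
  have map: "cubical_map wall_complex (wall_action h)" if "h \<in> carrier H" for h
    using wall_perm_bij[OF that] finite_moved[OF that] wall_action_eq
    by (rule cube.cubical_map_permute)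
  then show "cubical_map wall_complex (wall_action h)" using h .
  have inv_eq: "inv_into wall_points (wall_action h) z = wall_action (inv\<^bsub>H\<^esub> h) z" if z: "z \<in> wall_points" for z
  proof -
    have "wall_action h (wall_action (inv\<^bsub>H\<^esub> h) z) = z"
      using h z wall_action_mult[of h "inv\<^bsub>H\<^esub> h" z] wall_action_one by simp
    then show ?thesis
      using bij_betw_inv_into_left[OF wall_action_bij[OF h] wall_action_closed[OF H.inv_closed[OF h] z]]
      by simp
  qed
  show "cubical_map wall_complex (inv_into wall_points (wall_action h))"
    using wall_perm_bij[OF H.inv_closed[OF h]] finite_moved[OF H.inv_closed[OF h]]
    by (rule cube.cubical_map_permute) (simp add: inv_eq wall_action_eq)
qed

lemma wall_action_isometry:
  assumes "h \<in> carrier H" "y \<in> wall_points" "z \<in> wall_points"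
  shows "fin_dist (wall_action h y) (wall_action h z) = fin_dist y z"
  using assms by (intro cube.fin_dist_permute[OF wall_perm_bij[OF assms(1)]]) (simp_all add: wall_action_eq)

section \<open>Displacement of the base point and unbounded orbits\<close>

lemma base_point_displacement:
  assumes h: "h \<in> carrier H" and E: "finite E" "E \<subseteq> carrier G \<times> A"
    and moved: "\<And>g a. (g, a) \<in> E \<Longrightarrow> chain_at (fst h x0) (g, a, True) \<noteq> 0"
  shows "real (card E) \<le> (fin_dist (wall_action h base_point) base_point)\<^sup>2"
proof -
  let ?x = "wall_action h base_point"
  have P: "base_point \<in> wall_points" "?x \<in> wall_points"
    using cube.base_in_points wall_action_closed[OF h] by auto
  obtain J where J: "finite J" "\<forall>v \<in> {?x, base_point}. {w. v w \<noteq> base_point w} \<subseteq> J"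
    using cube.common_support[of "{?x, base_point}"] P by blast
  \<comment> \<open>One coordinate per edge suffices for the estimate: that of residue 0 drops from
    1 to 0.\<close>
  let ?W = "(\<lambda>(g, a). (g, a, 0 :: int)) ` E"
  have diff: "?x w = 0 \<and> base_point w = 1" if w: "w \<in> ?W" for w
  proof -
    obtain g a where ga: "w = (g, a, 0)" "(g, a) \<in> E" using w by auto
    let ?t = "chain_at (fst h x0) (g, a, True)"
    have "?t \<in> {0..<int k}" "?t \<noteq> 0"
      using chain_at_range[OF H_verts[OF h x0(1)]] moved ga(2) by auto
    then have "(- ?t) mod int k \<noteq> 0" by (auto simp: zmod_zminus1_eq_if)
    moreover have "w \<in> cover_walls" using ga E(2) k by (auto simp: cover_walls_def)
    ultimately have "?x w = base_point (wall_perm h w)" "base_point (wall_perm h w) = 0"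
      using ga(1) by (simp add: wall_action_eq[OF P(1)], simp add: wall_perm_def base_point_def)
    then show ?thesis using ga(1) by (simp add: base_point_def)
  qed
  have WJ: "?W \<subseteq> J"
  proof
    fix w assume "w \<in> ?W"
    then have "?x w \<noteq> base_point w" using diff by simp
    then show "w \<in> J" using J(2) by blast
  qed
  have "inj_on (\<lambda>(g, a). (g, a, 0 :: int)) E" by (auto simp: inj_on_def)
  then have "real (card E) = (\<Sum>w\<in>?W. (?x w - base_point w)\<^sup>2)"
    using diff by (simp add: card_image)
  also have "\<dots> \<le> (\<Sum>w\<in>J. (?x w - base_point w)\<^sup>2)"
    by (rule sum_mono2[OF J(1) WJ]) simp
  also have "\<dots> = (fin_dist ?x base_point)\<^sup>2"
    by (rule cube.fin_dist_square_support[symmetric]) (use J in blast)+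
  finally show ?thesis .
qed

lemma far_element:
  assumes inf: "infinite (carrier G)"
  obtains h E where "h \<in> carrier H" "finite E" "E \<subseteq> carrier G \<times> A" "n \<le> card E"
    "\<And>g a. (g, a) \<in> E \<Longrightarrow> chain_at (fst h x0) (g, a, True) \<noteq> 0"
proof -
  \<comment> \<open>Walks shorter than \<open>n\<close> reach only finitely many vertices; any other
    vertex has a shortest walk of length at least \<open>n\<close>.\<close>
  have "finite (\<Union>m<n. {v. \<exists>\<gamma>. walk (Cay G A) \<one> \<gamma> v \<and> length \<gamma> = m})"
    using finite_Cay_sphere[OF A one_closed] by simp
  then obtain v where v: "v \<in> carrier G" "v \<notin> (\<Union>m<n. {v. \<exists>\<gamma>. walk (Cay G A) \<one> \<gamma> v \<and> length \<gamma> = m})"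
    using inf by (meson finite_subset subsetI)
  then obtain x where x: "x \<in> verts \<Delta>" "fst p x = v"
    using covering by (force simp: graph_covering_def)
  then obtain \<gamma>' where "lifts_to \<Delta> p x0 \<gamma>' x" using lifts_to_between[OF x0(1) x(1)] by blast
  then have "walk (Cay G A) \<one> \<gamma>' v" using lifts_to_walk x x0 by metis
  then obtain \<gamma> where \<gamma>: "walk (Cay G A) \<one> \<gamma> v" "\<forall>\<delta>. walk (Cay G A) \<one> \<delta> v \<longrightarrow> length \<gamma> \<le> length \<delta>"
    using ex_has_least_nat[of "\<lambda>\<gamma>. walk (Cay G A) \<one> \<gamma> v" \<gamma>' length] by blast
  note simple = shortest_walk_simple[OF wf(2) \<gamma>]
  have n: "n \<le> length \<gamma>" using v(2) \<gamma>(1) by (force simp: not_less[symmetric])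
  obtain y where y: "lifts_to \<Delta> p x0 \<gamma> y" using lifts_to_exists[OF \<gamma>(1) x0(1)] x0(2) by auto
  obtain h where h: "h \<in> carrier H" "fst h x0 = y"
    using H_transitive[OF x0(1)] lifts_to_verts[OF y] by blast
  let ?E = "(\<lambda>(g, a, c). (g, a)) ` set \<gamma>"
  have darts: "set \<gamma> \<subseteq> carrier G \<times> A \<times> UNIV" using walk_darts[OF \<gamma>(1)] by simp
  have "inj_on (\<lambda>(g, a, c). (g, a)) (set \<gamma>)"
  proof (rule inj_onI)
    fix d d' :: "'g \<times> 'g \<times> bool"
    assume d: "d \<in> set \<gamma>" "d' \<in> set \<gamma>" "(case d of (g, a, c) \<Rightarrow> (g, a)) = (case d' of (g, a, c) \<Rightarrow> (g, a))"
    obtain g a c where g: "d = (g, a, c)" by (rule prod_cases3)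
    then obtain c' where g': "d' = (g, a, c')" using d(3) by (cases d') auto
    have "(g, a, \<not> c) \<noteq> (g, a, c')" using simple(2)[OF d(1)] d(2) unfolding g g' Cay_simps by metis
    then show "d = d'" unfolding g g' by simp
  qed
  then have card: "card ?E = length \<gamma>" using distinct_card[OF simple(1)] by (simp add: card_image)
  have moved: "chain_at (fst h x0) (g, a, True) \<noteq> 0" if ga: "(g, a) \<in> ?E" for g a
  proof -
    obtain c where c: "(g, a, c) \<in> set \<gamma>" using ga by auto
    have "distinct \<delta> \<Longrightarrow> d \<in> set \<delta> \<Longrightarrow> count_list \<delta> d = 1" for \<delta> :: "('g \<times> 'g \<times> bool) list" and d
      by (induction \<delta>) (auto simp: count_list_0_iff)
    then have "count_list \<gamma> (g, a, c) = 1" using simple(1) c by blast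
    moreover have "count_list \<gamma> (g, a, \<not> c) = 0"
      using simple(2)[OF c] by (simp add: count_list_0_iff)
    \<comment> \<open>The coefficient is -1 if the walk crosses the edge against its direction; for
      k > 1 this residue is nonzero, like 1.\<close>
    moreover have "(- 1) mod int k \<noteq> 0" using k by (simp add: zmod_zminus1_eq_if)
    ultimately show ?thesis
      using darts c k h(2) by (cases c) (auto simp: chain_at_eq[OF y] walk_chain_def)
  qed
  show ?thesis
    using that[of h ?E] h(1) darts card n moved by force
qed

text \<open>The action is isometric, so every orbit stays at constant distance from that of
  \<open>base_point\<close>, element by element; it suffices that \<open>base_point\<close> is moved
  arbitrarily far.\<close>

lemma wall_action_unbounded:
  assumes "infinite (carrier G)"
  shows "unbounded_orbits H wall_complex wall_action"
  unfolding unbounded_orbits_def cube.cc_points_infinite_cube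
proof (intro ballI notI)
  interpret H: group H by (rule group_H)
  interpret Metric_space wall_points "cc_dist wall_complex" by (rule cube.Metric_space_infinite_cube)
  fix z assume z: "z \<in> wall_points" and "mbounded (orbit H wall_action z)"
  then obtain B where B: "\<And>x y. x \<in> orbit H wall_action z \<Longrightarrow> y \<in> orbit H wall_action z \<Longrightarrow> cc_dist wall_complex x y \<le> B"
    unfolding mbounded_alt by blast
  \<comment> \<open>Bounds the displacement of \<open>base_point\<close> along the images of
    \<open>base_point\<close> and \<open>z\<close>, then \<open>z\<close>, then
    \<open>base_point\<close>. The distance from \<open>z\<close> to \<open>base_point\<close>
    enters twice, once for the images.\<close>
  let ?r = "B + 2 * fin_dist z base_point"
  obtain n :: nat where n: "?r\<^sup>2 < real n" using reals_Archimedean2 by blast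
  obtain h E where h: "h \<in> carrier H" and E: "finite E" "E \<subseteq> carrier G \<times> A" "n \<le> card E"
    "\<And>g a. (g, a) \<in> E \<Longrightarrow> chain_at (fst h x0) (g, a, True) \<noteq> 0"
    using far_element[OF assms, of n] by metis
  note b = cube.base_in_points
  note hz = wall_action_closed[OF h z] and hb = wall_action_closed[OF h b]
  have "wall_action h z \<in> orbit H wall_action z" "z \<in> orbit H wall_action z"
    using h wall_action_one[OF z, symmetric] unfolding orbit_def by blast+
  from B[OF this] have "fin_dist (wall_action h z) z \<le> B"
    using hz z by (simp add: cube.cc_dist_infinite_cube)
  moreover have "fin_dist (wall_action h base_point) base_point \<le>
    fin_dist (wall_action h base_point) (wall_action h z) + fin_dist (wall_action h z) base_point"
    by (rule cube.fin_dist_triangle[OF hb hz b])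
  moreover have "fin_dist (wall_action h z) base_point \<le>
    fin_dist (wall_action h z) z + fin_dist z base_point"
    by (rule cube.fin_dist_triangle[OF hz z b])
  moreover have "fin_dist (wall_action h base_point) (wall_action h z) = fin_dist z base_point"
    using wall_action_isometry[OF h b z] by (simp add: fin_dist_commute)
  ultimately have "fin_dist (wall_action h base_point) base_point \<le> ?r" by simp
  then have "(fin_dist (wall_action h base_point) base_point)\<^sup>2 \<le> ?r\<^sup>2"
    by (intro power_mono) simp_all
  moreover have "real n \<le> (fin_dist (wall_action h base_point) base_point)\<^sup>2"
    using base_point_displacement[OF h E(1,2,4)] E(3) by linarith
  ultimately show False using n by simp
qed

end

text \<open>Existence over one concrete type keeps the second part from being vacuous; that part
  treats an arbitrary homology cover, over arbitrary types of vertices and darts.\<close>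

theorem theorem2:
  fixes k :: nat
    and G :: "('g, 'm) monoid_scheme"
    and S A :: "'g set"
    and \<Gamma>t :: "('v, 'd) sgraph"
    and p :: "('v \<Rightarrow> 'g) \<times> ('d \<Rightarrow> 'g \<times> 'g \<times> bool)"
  assumes "k > 1"
    and "group G"
    and "finite S" and "symmetric_generating_set G S"
    and "letters G S A"
  shows "(\<exists>(\<Gamma>0 :: 'g cover_graph) q. homology_cover k (Cay G A) \<one>\<^bsub>G\<^esub> \<Gamma>0 q) \<and>
    (homology_cover k (Cay G A) \<one>\<^bsub>G\<^esub> \<Gamma>t p \<longrightarrow>
      is_Cayley_graph_of \<Gamma>t (cubization G \<Gamma>t p) \<and>
      (infinite (carrier G) \<longrightarrow>
        (\<exists>(K :: 'g coord_cubes) \<psi>.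
           CAT0_cubical_complex K \<and> cubical_action (cubization G \<Gamma>t p) K \<psi> \<and>
           unbounded_orbits (cubization G \<Gamma>t p) K \<psi>)))"
proof (intro conjI impI)
  interpret G: group G by fact
  have A: "A \<subseteq> carrier G" "finite A"
    using assms(3-5) by (auto simp: letters_def symmetric_generating_set_def intro: finite_subset)
  interpret model: homology_model k "Cay G A" "\<one>\<^bsub>G\<^esub>"
    using G.wf_Cay[OF A(1)] G.connected_Cay[OF A(1) assms(4,5)] by unfold_locales simp_all
  show "\<exists>(\<Gamma>0 :: 'g cover_graph) q. homology_cover k (Cay G A) \<one>\<^bsub>G\<^esub> \<Gamma>0 q"
    using model.homology_cover_class_graph by blast
  have cover: "\<exists>x0. cayley_homology_cover G k A \<Gamma>t p x0"
    if cov: "homology_cover k (Cay G A) \<one>\<^bsub>G\<^esub> \<Gamma>t p"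
  proof -
    obtain x where x: "graph_covering \<Gamma>t (Cay G A) p" "connected_graph \<Gamma>t" "x \<in> verts \<Gamma>t" "fst p x = \<one>\<^bsub>G\<^esub>"
      "\<forall>\<gamma> \<in> loops (Cay G A) \<one>\<^bsub>G\<^esub>. lifts_to \<Gamma>t p x \<gamma> x \<longleftrightarrow> walk_chain k (Cay G A) \<gamma> = (\<lambda>_. 0)"
      using cov unfolding homology_cover_iff by blast
    have "cayley_homology_cover G k A \<Gamma>t p x"
      by unfold_locales (use x A assms(1) in simp_all)
    then show ?thesis ..
  qed
  assume cov: "homology_cover k (Cay G A) \<one>\<^bsub>G\<^esub> \<Gamma>t p"
  obtain x0 where "cayley_homology_cover G k A \<Gamma>t p x0" using cover[OF cov] by blast
  then interpret cayley_homology_cover G k A \<Gamma>t p x0 .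
  show "is_Cayley_graph_of \<Gamma>t (cubization G \<Gamma>t p)"
    by (rule is_Cayley_graph_of_cubization[OF assms(5)])
  show "\<exists>(K :: 'g coord_cubes) \<psi>. CAT0_cubical_complex K \<and>
      cubical_action (cubization G \<Gamma>t p) K \<psi> \<and> unbounded_orbits (cubization G \<Gamma>t p) K \<psi>"
    if "infinite (carrier G)"
    using cube.CAT0_cubical_complex_infinite_cube wall_action_cubical wall_action_unbounded[OF that]
    unfolding H_def by blast
qed

end
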